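(* Let $\tau\in(0,1)$, and let $(X,\mathcal{B},\mu,T)$ be the cutting-and-stacking system with parameter $\tau$ described in the context. Then $(X,\mathcal{B},\mu,T)$ is a $\tau$-uniform entropy dimension system, i.e. $\mathrm{Dims}_\mu(X,T)=\{\tau\}$.
   Context: Entropy dimension. $\mathbb{N}=\{1,2,\dots\}$. For an increasing sequence $S=\{s_1<s_2<\cdots\}\subset\mathbb{N}$ its upper dimension is $\overline{D}(S)=\inf\{\theta\ge0:\limsup_{n\to\infty} n/(s_n)^\theta=0\}$. For a probability-measure-preserving system $(X,\mathcal{B},\mu,T)$ and a finite measurable partition $\alpha$, $S$ is an entropy generating sequence of $\alpha$ if $\liminf_{n\to\infty}\frac1n H_\mu(\bigvee_{i=1}^n T^{-s_i}\alpha)>0$ ($H_\mu$ is Shannon entropy); $\overline{D}_\mu(T,\alpha)$ is the supremum of $\overline{D}(S)$ over all entropy generating sequences $S$ of $\alpha$ ($0$ if there are none). The dimension set is $\mathrm{Dims}_\mu(X,T)=\{\overline{D}_\mu(T,\{A,X\setminus A\}): A\in\mathcal{B},\ 0<\mu(A)<1\}$. For $\tau\in(0,1]$ the system is a $\tau$-uniform entropy dimension system ($\tau$-u.d. system) if $\mathrm{Dims}_\mu(X,T)=\{\tau\}$. Parameters. Let $C_\tau$ be an integer with $C_\tau^{\tau/(1-\tau)}>4$ and $r_n=C_\tau n^2$ for $n\ge1$. Let $1<l_1<n_1<l_2<n_2<\cdots$ be any sequence of integers with $\sum_{t\ge1} n_t^{-2\tau/(1-\tau)}<\infty$. Put $e_0=2$,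 $h_0=1$, $w_0=1$, $h_1=e_0$. For $n\ge1$ put inductively $\tilde h_n=h_nr_n$; $w_n=\tilde h_n$ if $n\notin\{n_1,n_2,\dots\}$ and $w_n=\tilde h_{n_t}+h_{l_t}$ if $n=n_t$; $e_n=\big\lfloor\big(\frac{(w_n)^\tau}{e_0e_1\cdots e_{n-1}}\big)^{1/(1-\tau)}\big\rfloor$; $h_{n+1}=w_ne_n$. Let $\xi=\prod_{t\ge1}\big(1+\frac{h_{l_t}}{\tilde h_{n_t}}\big)^{-1}\in(0,1)$. Columns and towers. $X=[0,1)$ and $\mu$ is Lebesgue measure; all intervals are left closed, right open. A column $C=\{B_1,\dots,B_h\}$ is an ordered list of disjoint subintervals (level sets) of equal length; $h$ is its height, the common length $w(C)$ its width. On a column $T$ maps $B_i$ linearly onto $B_{i+1}$ for $1\le i<h$ and is undefined on the top $B_h$. A subcolumn is $\{B_1^0,TB_1^0,\dots,T^{h-1}B_1^0\}$ with $B_1^0\subset B_1$ an interval. Stacking a column $C'$ on top of a column $C$ of the same width gives the column $C*C'$ that lists the levels of $C$ followed by those of $C'$. A tower is a finite collection of (pairwise disjoint) columns of the same height; its width is the sum of the widths of its columns. Operations. (1) Independent cutting and stacking. If towers $W^1$ (columns $C^1_i$, $1\le i\le c_1$) and $W^2$ (columns $C^2_k$, $1\le k\le c_2$) have the same width $w$, divide each $C^1_i$ into subcolumns $C^1_{i,k}$ ($1\le k\le c_2$) of width $w(C^1_i)w(C^2_k)/w$ and each $C^2_k$ into subcolumns $C^2_{k,i}$ ($1\le i\le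 c_1$) of the same widths, and set $W^1*_{ind}W^2=\{C^1_{i,k}*C^2_{k,i}\}_{i,k}$. For a tower $W$ and an integer $e\ge1$, divide each column of $W$ into $e$ equal subcolumns, let $W^i$ be the tower of all $i$-th subcolumns, and put $\mathrm{Ind}(W,e)=W^1*_{ind}W^2*_{ind}\cdots*_{ind}W^e$. (2) Repetitive cutting and stacking. For a tower $W=\{C_1,\dots,C_c\}$ and an integer $r\ge1$, divide each $C_i$ into $r$ equal subcolumns $C_{i,1},\dots,C_{i,r}$ and put $\mathrm{Rep}(W,r)=\{C_{i,1}*C_{i,2}*\cdots*C_{i,r}:1\le i\le c\}$. (3) Inserting spacers while independent cutting and stacking. Let $W=\{C_1,\dots,C_c\}$ and $e,h^*\ge1$ be integers. The columns of $\mathrm{Ind}(W,e)$ are $\overline C_{i_1}*\cdots*\overline C_{i_e}$, $i_1,\dots,i_e\in\{1,\dots,c\}$, with $\overline C_i$ a subcolumn of $C_i$. Cut each such column into $c$ equal subcolumns, indexed by $i_{e+1}\in\{1,\dots,c\}$, written $\overline C_{i_1}^{i_{e+1}}*\cdots*\overline C_{i_e}^{i_{e+1}}$. For each $k=1,\dots,e$, with $\ell\equiv i_{k+1}\pmod{h^*}$ and $0\le\ell\le h^*-1$, insert $\ell$ spacers immediately before the segment $\overline C_{i_k}^{i_{e+1}}$ and $h^*-\ell$ spacers immediately after it, where each spacer is an interval of the same width as the column, cut from the not yet used part of the spacer interval $P_s$. The resulting tower is $\mathrm{Inds}(W,e,h^* )$. Construction. Let $P_0=[0,\xi/2)$, $P_1=[\xi/2,\xi)$,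 $P_s=[\xi,1)$, and $W_0=\tilde W_0=\{P_0,P_1\}$ (two columns of height $1$). Put $W_1=\mathrm{Ind}(\tilde W_0,e_0)$. For $n\ge1$ put $\tilde W_n=\mathrm{Rep}(W_n,r_n)$, and $W_{n+1}=\mathrm{Ind}(\tilde W_n,e_n)$ if $n\notin\{n_1,n_2,\dots\}$, while $W_{n+1}=\mathrm{Inds}(\tilde W_{n_t},e_{n_t},h_{l_t})$ if $n=n_t$ (so $W_n$ has height $h_n$, $\tilde W_n$ has height $\tilde h_n$, and by the choice of $\xi$ the spacers use exactly the total measure $1-\xi$). The widths tend to $0$ and the successive definitions of $T$ are compatible, so they define an invertible $\mu$-preserving map $T$ on $[0,1)$ up to a null set. $\mathcal{B}$ is the $\sigma$-algebra generated by the level sets of all the towers $W_n$. *)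

theory Defs
  imports "HOL-Probability.Probability"
begin

section \<open>Entropy dimension\<close>

text \<open>Sequences are functions on \<^typ>\<open>nat\<close> that are only used at the indices 1, 2, 3, ...\<close>

definition increasing_seq :: "(nat \<Rightarrow> nat) \<Rightarrow> bool" where
  "increasing_seq s \<longleftrightarrow> strict_mono_on {1..} s \<and> 1 \<le> s 1"

definition upper_dim :: "(nat \<Rightarrow> nat) \<Rightarrow> real" where
  "upper_dim s =
     Inf {\<theta>. 0 \<le> \<theta> \<and> limsup (\<lambda>n. ereal (real n / real (s n) powr \<theta>)) = 0}"

text \<open>Empty atoms contribute \<open>0 * ln 0 = 0\<close>; the base of the logarithm plays no role below.\<close>

definition partition_entropy :: "'a measure \<Rightarrow> 'a set set \<Rightarrow> real" where
  "partition_entropy M \<alpha> = - (\<Sum>A\<in>\<alpha>. measure M A * ln (measure M A))"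

definition preimage_join ::
  "'a measure \<Rightarrow> ('a \<Rightarrow> 'a) \<Rightarrow> 'a set set \<Rightarrow> (nat \<Rightarrow> nat) \<Rightarrow> nat \<Rightarrow> 'a set set" where
  "preimage_join M T \<alpha> s n =
     {{x \<in> space M. \<forall>i\<in>{1..n}. (T ^^ s i) x \<in> f i} | f. \<forall>i\<in>{1..n}. f i \<in> \<alpha>}"

definition entropy_generating ::
  "'a measure \<Rightarrow> ('a \<Rightarrow> 'a) \<Rightarrow> 'a set set \<Rightarrow> (nat \<Rightarrow> nat) \<Rightarrow> bool" where
  "entropy_generating M T \<alpha> s \<longleftrightarrow>
     increasing_seq s \<and>
     liminf (\<lambda>n. ereal (partition_entropy M (preimage_join M T \<alpha> s n) / real n)) > 0"

definition upper_entropy_dim :: "'a measure \<Rightarrow> ('a \<Rightarrow> 'a) \<Rightarrow> 'a set set \<Rightarrow> real" where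
  "upper_entropy_dim M T \<alpha> =
     (if \<exists>s. entropy_generating M T \<alpha> s
      then Sup {upper_dim s | s. entropy_generating M T \<alpha> s} else 0)"

definition dimension_set :: "'a measure \<Rightarrow> ('a \<Rightarrow> 'a) \<Rightarrow> real set" where
  "dimension_set M T =
     {upper_entropy_dim M T {A, space M - A} | A. A \<in> sets M \<and> 0 < measure M A \<and> measure M A < 1}"

definition pmp_system :: "'a measure \<Rightarrow> ('a \<Rightarrow> 'a) \<Rightarrow> bool" where
  "pmp_system M T \<longleftrightarrow> prob_space M \<and> T \<in> measurable M M \<and> distr M M T = M"

definition uniform_entropy_dim_system :: "real \<Rightarrow> 'a measure \<Rightarrow> ('a \<Rightarrow> 'a) \<Rightarrow> bool" where
  "uniform_entropy_dim_system \<tau> M T \<longleftrightarrow>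
     0 < \<tau> \<and> \<tau> \<le> 1 \<and> pmp_system M T \<and> dimension_set M T = {\<tau>}"


section \<open>Columns and towers\<close>

text \<open>A column is given by its width and the list of the left end points of its levels, from
  bottom to top. A tower is a list of columns; the position in the list (counted from 1) is the
  number of the column.\<close>

datatype column = Column (col_width: real) (col_ends: "real list")

type_synonym tower = "column list"

abbreviation col_height :: "column \<Rightarrow> nat" where
  "col_height C \<equiv> length (col_ends C)"

definition level :: "column \<Rightarrow> nat \<Rightarrow> real set" where
  "level C i = {col_ends C ! i ..< col_ends C ! i + col_width C}"

definition tower_width :: "tower \<Rightarrow> real" where
  "tower_width W = sum_list (map col_width W)"

definition tower_height :: "tower \<Rightarrow> nat" where
  "tower_height W = col_height (hd W)"

definition tower_levels :: "tower \<Rightarrow> real set set" where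
  "tower_levels W = {level C i | C i. C \<in> set W \<and> i < col_height C}"

text \<open>\<open>subcolumn C d v\<close> is the subcolumn of width \<open>v\<close> whose base starts at distance \<open>d\<close> from the
  left end of the base of \<open>C\<close>.\<close>

definition subcolumn :: "column \<Rightarrow> real \<Rightarrow> real \<Rightarrow> column" where
  "subcolumn C d v = Column v (map (\<lambda>a. a + d) (col_ends C))"

text \<open>Columns are divided from left to right; \<open>equal_subcolumn C m i\<close> is, for \<open>i < m\<close>, the
  subcolumn number \<open>i + 1\<close> of \<open>m\<close> equal ones.\<close>

definition equal_subcolumn :: "column \<Rightarrow> nat \<Rightarrow> nat \<Rightarrow> column" where
  "equal_subcolumn C m i =
     subcolumn C (real i * (col_width C / real m)) (col_width C / real m)"

definition stack :: "column \<Rightarrow> column \<Rightarrow> column" where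
  "stack C C' = Column (col_width C) (col_ends C @ col_ends C')"

definition fold_nonempty :: "('a \<Rightarrow> 'a \<Rightarrow> 'a) \<Rightarrow> 'a list \<Rightarrow> 'a" where
  "fold_nonempty f xs = foldl f (hd xs) (tl xs)"


section \<open>The three cutting and stacking operations\<close>

definition ind_stack :: "tower \<Rightarrow> tower \<Rightarrow> tower" where
  "ind_stack W1 W2 =
     (let w = tower_width W1;
          v = (\<lambda>i k. col_width (W1 ! i) * col_width (W2 ! k) / w)
      in [stack (subcolumn (W1 ! i) (\<Sum>k'<k. v i k') (v i k))
                (subcolumn (W2 ! k) (\<Sum>i'<i. v i' k) (v i k)).
            i \<leftarrow> [0..<length W1], k \<leftarrow> [0..<length W2]])"

definition Ind :: "tower \<Rightarrow> nat \<Rightarrow> tower" where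
  "Ind W e = fold_nonempty ind_stack
     (map (\<lambda>j. map (\<lambda>C. equal_subcolumn C e j) W) [0..<e])"

definition Rep :: "tower \<Rightarrow> nat \<Rightarrow> tower" where
  "Rep W r = map (\<lambda>C. fold_nonempty stack (map (equal_subcolumn C r) [0..<r])) W"

text \<open>The index tuples \<open>(i\<^sub>1, ..., i\<^sub>e)\<close> with entries in \<open>{1, ..., c}\<close> in lexicographic order. This is
  the order in which \<^const>\<open>Ind\<close> lists its columns: the column of \<open>Ind W e\<close> at the position of
  \<open>[i\<^sub>1, ..., i\<^sub>e]\<close> is built from subcolumns of the columns number \<open>i\<^sub>1, ..., i\<^sub>e\<close> of \<open>W\<close>.\<close>

definition index_tuples :: "nat \<Rightarrow> nat \<Rightarrow> nat list list" where
  "index_tuples c e = product_lists (replicate e [1..<Suc c])"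

text \<open>The spacers of the column with index tuple \<open>I = [i\<^sub>1, ..., i\<^bsub>e+1\<^esub>]\<close> are described by a function
  \<open>sp\<close>: the left end points of the \<open>hs\<close> spacers around its segment number \<open>k + 1\<close> are
  \<open>sp I k q\<close>, \<open>q < hs\<close>. As \<open>I ! k\<close> counts from 0, \<open>I ! Suc k\<close> is the index of the following segment
  (for the last segment, the number of the subcolumn). \<open>B\<close> is the subcolumn into which spacers are
  inserted and \<open>H\<close> the height of its segments.\<close>

definition insert_spacers ::
  "(nat list \<Rightarrow> nat \<Rightarrow> nat \<Rightarrow> real) \<Rightarrow> nat \<Rightarrow> nat \<Rightarrow> nat \<Rightarrow> nat list \<Rightarrow> column \<Rightarrow> column" where
  "insert_spacers sp e hs H I B =
     Column (col_width B)
       (concat (map (\<lambda>k. map (sp I k) [0..<(I ! Suc k) mod hs]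
                        @ take H (drop (k * H) (col_ends B))
                        @ map (sp I k) [(I ! Suc k) mod hs..<hs]) [0..<e]))"

definition Inds_with :: "(nat list \<Rightarrow> nat \<Rightarrow> nat \<Rightarrow> real) \<Rightarrow> tower \<Rightarrow> nat \<Rightarrow> nat \<Rightarrow> tower" where
  "Inds_with sp W e hs =
     (let c = length W
      in [insert_spacers sp e hs (tower_height W) (J @ [j]) (equal_subcolumn D c (j - 1)).
            (J, D) \<leftarrow> zip (index_tuples c e) (Ind W e), j \<leftarrow> [1..<Suc c]])"

text \<open>\<open>is_Inds Ps W e hs V\<close>: \<open>V\<close> is \<open>Inds(W, e, hs)\<close> for some choice of pairwise disjoint spacers in
  the spacer interval \<open>Ps\<close>. The spacers used before are levels of \<open>W\<close>, so the part of \<open>Ps\<close> not yet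
  used is \<open>Ps - \<Union>(tower_levels W)\<close>.\<close>

definition is_Inds :: "real set \<Rightarrow> tower \<Rightarrow> nat \<Rightarrow> nat \<Rightarrow> tower \<Rightarrow> bool" where
  "is_Inds Ps W e hs V \<longleftrightarrow>
     (\<exists>sp. V = Inds_with sp W e hs \<and>
        (let spacer = (\<lambda>(I, B, k, q). {sp I k q ..< sp I k q + col_width B});
             idx = {(I, B, k, q). (I, B) \<in> set (zip (index_tuples (length W) (Suc e)) V)
                                  \<and> k < e \<and> q < hs}
         in disjoint_family_on spacer idx \<and>
            (\<forall>p\<in>idx. spacer p \<subseteq> Ps - \<Union>(tower_levels W))))"


section \<open>The construction\<close>

definition rep_num :: "nat \<Rightarrow> nat \<Rightarrow> nat" where
  "rep_num C n = C * n ^ 2"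

text \<open>The sequences \<open>l\<close> and \<open>nn\<close> are only used at indices \<open>t \<ge> 1\<close>. The equations determine
  \<open>h\<close>, \<open>w\<close> and \<open>e\<close>.\<close>

definition cs_parameters ::
  "real \<Rightarrow> nat \<Rightarrow> (nat \<Rightarrow> nat) \<Rightarrow> (nat \<Rightarrow> nat) \<Rightarrow> (nat \<Rightarrow> nat) \<Rightarrow> (nat \<Rightarrow> nat) \<Rightarrow> (nat \<Rightarrow> nat) \<Rightarrow> bool"
where
  "cs_parameters \<tau> C l nn h w e \<longleftrightarrow>
     real C powr (\<tau> / (1 - \<tau>)) > 4 \<and>
     1 < l 1 \<and> (\<forall>t\<ge>1. l t < nn t \<and> nn t < l (Suc t)) \<and>
     summable (\<lambda>t. real (nn (Suc t)) powr (- 2 * \<tau> / (1 - \<tau>))) \<and>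
     e 0 = 2 \<and> h 0 = 1 \<and> w 0 = 1 \<and> h 1 = e 0 \<and>
     (\<forall>n\<ge>1. n \<notin> nn ` {1..} \<longrightarrow> w n = h n * rep_num C n) \<and>
     (\<forall>t\<ge>1. w (nn t) = h (nn t) * rep_num C (nn t) + h (l t)) \<and>
     (\<forall>n\<ge>1. e n = nat \<lfloor>(real (w n) powr \<tau> / real (\<Prod>i<n. e i)) powr (1 / (1 - \<tau>))\<rfloor>) \<and>
     (\<forall>n\<ge>1. h (Suc n) = w n * e n)"

definition cs_xi :: "nat \<Rightarrow> (nat \<Rightarrow> nat) \<Rightarrow> (nat \<Rightarrow> nat) \<Rightarrow> (nat \<Rightarrow> nat) \<Rightarrow> real" where
  "cs_xi C l nn h =
     prodinf (\<lambda>t. inverse (1 + real (h (l (Suc t)))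
                                / real (h (nn (Suc t)) * rep_num C (nn (Suc t)))))"

definition tilde_tower :: "nat \<Rightarrow> (nat \<Rightarrow> tower) \<Rightarrow> nat \<Rightarrow> tower" where
  "tilde_tower C W n = (if n = 0 then W 0 else Rep (W n) (rep_num C n))"

text \<open>The equations between multisets leave the numbering of the columns of each tower \<open>W n\<close>
  arbitrary. (The numbering matters for \<^const>\<open>is_Inds\<close>.)\<close>

definition cs_towers ::
  "nat \<Rightarrow> (nat \<Rightarrow> nat) \<Rightarrow> (nat \<Rightarrow> nat) \<Rightarrow> (nat \<Rightarrow> nat) \<Rightarrow> (nat \<Rightarrow> nat) \<Rightarrow> (nat \<Rightarrow> tower) \<Rightarrow> bool" where
  "cs_towers C l nn h e W \<longleftrightarrow>
     (let \<xi> = cs_xi C l nn h in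
        mset (W 0) = {#Column (\<xi> / 2) [0], Column (\<xi> / 2) [\<xi> / 2]#} \<and>
        (\<forall>n. n \<notin> nn ` {1..} \<longrightarrow> mset (W (Suc n)) = mset (Ind (tilde_tower C W n) (e n))) \<and>
        (\<forall>t\<ge>1. \<exists>V. is_Inds {\<xi>..<1} (tilde_tower C W (nn t)) (e (nn t)) (h (l t)) V \<and>
                    mset (W (Suc (nn t))) = mset V))"

text \<open>The \<open>\<sigma>\<close>-algebra generated by the levels of all towers, on \<open>[0,1)\<close>, with Lebesgue measure.\<close>

definition cs_measure :: "(nat \<Rightarrow> tower) \<Rightarrow> real measure" where
  "cs_measure W = measure_of {0..<1} (\<Union>n. tower_levels (W n)) (emeasure lborel)"

definition cs_step :: "(nat \<Rightarrow> tower) \<Rightarrow> real \<Rightarrow> real \<Rightarrow> bool" where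
  "cs_step W x y \<longleftrightarrow>
     (\<exists>n. \<exists>C\<in>set (W n). \<exists>i. Suc i < col_height C \<and> x \<in> level C i \<and>
        y = x - col_ends C ! i + col_ends C ! Suc i)"

text \<open>Where no tower defines the map (on a null set of \<open>[0,1)\<close>) it is set to be the identity.\<close>

definition cs_map :: "(nat \<Rightarrow> tower) \<Rightarrow> real \<Rightarrow> real" where
  "cs_map W x = (if \<exists>y. cs_step W x y then THE y. cs_step W x y else x)"

end

theory Submission
  imports Defs "HOL-Real_Asymp.Real_Asymp"
begin

text \<open>
  A measurable set is approximated by a union \<open>B\<close> of levels of some tower, and this changes the
  entropy along \<open>k\<close> times by at most \<open>k\<close> times the binary entropy of the symmetric difference.

  Upper bound: for \<open>h\<^sub>N \<le> L < h\<^sub>N\<^sub>+\<^sub>1\<close> a name of length \<open>L\<close> consists of pieces of few columns of a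
  tower, and the number of columns satisfies \<open>ln c\<^sub>N = O(h\<^sub>N\<^sup>\<tau>)\<close> by the choice of \<open>e\<^sub>N\<close>. Counting names bounds
  the entropy along \<open>{0..<L}\<close> by \<open>O(L\<^sup>\<tau> ln L)\<close>, so an entropy generating sequence \<open>s\<close> satisfies
  \<open>n = O(s\<^sub>n\<^sup>\<tau> ln s\<^sub>n)\<close>.

  Lower bound: take \<open>s\<close> to enumerate the numbers \<open>1 + \<Sum>\<^sub>i j\<^sub>i w\<^sub>i\<close> with \<open>i \<ge> n\<^sub>0\<close> and \<open>0 \<le> j\<^sub>i < e\<^sub>i\<close>, of which about
  \<open>e\<^sub>0 \<dots> e\<^sub>N\<^sub>-\<^sub>1\<close>, which is about \<open>h\<^sub>N\<^sup>\<tau>\<close>, lie below \<open>h\<^sub>N\<close>. The translates by multiples of \<open>w\<^sub>n\<close> see independent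
  columns, except for boundary effects in a proportion \<open>O(1/r\<^sub>n)\<close> of the positions; as
  \<open>\<Sum>\<^sub>n 1/r\<^sub>n\<close> converges, the entropy grows linearly along \<open>s\<close> once it is positive at one stage
  \<open>n\<^sub>0 = n\<^sub>t + 1\<close>. There it is positive because the varying numbers \<open>0, \<dots>, h - 1\<close> of spacers (with \<open>h\<close> the
  height at stage \<open>l\<^sub>t\<close>) make the position within the tower of stage \<open>l\<^sub>t\<close> nearly uniformly distributed, so that
  each position in the tower sees \<open>B\<close> with probability about its measure.
\<close>

text \<open>The obstacle in the lower bound is that the offset of a segment depends on the index of
  the segment that follows it, so the names of consecutive blocks are not independent. Given all
  later entries of the index tuple, however, the entry of a block is still uniform and its offset is
  a known rotation. A chain inequality that conditions on the tail of the tuple therefore adds up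
  the entropies of single blocks, averaged over offsets. To make a rotation harmless, names are read
  cyclically in a column: the entropy from a starting position is then periodic in that position,
  and its sum over all positions is what is carried from stage to stage. All columns of a tower have
  the same width, so probabilities are counts and entropies are those of uniform distributions on
  finite sets. Steps with and without spacers take the same form once an ordinary step is also
  indexed by tuples of length \<open>e + 1\<close>, with a dummy last entry. As \<open>e n\<close>
  is computed from the actual product \<open>e 0 * ... * e (n - 1)\<close>, the losses from rounding
  do not accumulate.\<close>

section \<open>Entropy of a function under the uniform distribution on a finite set\<close>

text \<open>Shannon entropy, written as the average information over points instead of a sum over
  values. Comparing two functions then amounts to comparing fibre sizes point by point.\<close>

definition fent :: "'a set \<Rightarrow> ('a \<Rightarrow> 'b) \<Rightarrow> real" where
  "fent X f = (\<Sum>x\<in>X. ln (real (card X) / real (card {x'\<in>X. f x' = f x}))) / real (card X)"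

lemma card_fiber_pos: "finite X \<Longrightarrow> x \<in> X \<Longrightarrow> 0 < card {x'\<in>X. f x' = f x}"
  by (auto simp: card_gt_0_iff)

lemma fent_mono:
  assumes "finite X" "\<And>x y. x \<in> X \<Longrightarrow> y \<in> X \<Longrightarrow> f x = f y \<Longrightarrow> g x = g y"
  shows "fent X g \<le> fent X f"
proof -
  have "ln (real (card X) / real (card {x'\<in>X. g x' = g x}))
      \<le> ln (real (card X) / real (card {x'\<in>X. f x' = f x}))" if x: "x \<in> X" for x
  proof -
    have "{x'\<in>X. f x' = f x} \<subseteq> {x'\<in>X. g x' = g x}" using assms(2) x by blast
    then have "card {x'\<in>X. f x' = f x} \<le> card {x'\<in>X. g x' = g x}"
      using assms(1) by (intro card_mono) auto
    moreover have "0 < card {x'\<in>X. f x' = f x}" "0 < card {x'\<in>X. g x' = g x}"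
      using card_fiber_pos[OF assms(1) x] by blast+
    moreover have "0 < card X" using x assms(1) by (auto simp: card_gt_0_iff)
    ultimately show ?thesis by (intro ln_mono divide_left_mono) auto
  qed
  then show ?thesis unfolding fent_def by (intro divide_right_mono sum_mono) auto
qed

lemma fent_nonneg:
  assumes "finite X"
  shows "0 \<le> fent X f"
proof -
  have "0 \<le> ln (real (card X) / real (card {x'\<in>X. f x' = f x}))" if "x \<in> X" for x
  proof (rule ln_ge_zero)
    have "card {x'\<in>X. f x' = f x} \<le> card X" using assms by (intro card_mono) auto
    then show "1 \<le> real (card X) / real (card {x'\<in>X. f x' = f x})"
      using card_fiber_pos[OF assms that, of f] by simp
  qed
  then show ?thesis unfolding fent_def by (intro divide_nonneg_nonneg sum_nonneg) auto
qed

text \<open>Every fibre has total weight 1; this converts sums over points into sums over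
  values.\<close>

lemma sum_inverse_card_fiber:
  assumes "finite X"
  shows "(\<Sum>x\<in>X. h (f x) / real (card {x'\<in>X. f x' = f x})) = (\<Sum>y\<in>f ` X. (h y :: real))"
proof -
  have "(\<Sum>x\<in>X. h (f x) / real (card {x'\<in>X. f x' = f x}))
      = (\<Sum>y\<in>f ` X. \<Sum>x\<in>{x\<in>X. f x = y}. h (f x) / real (card {x'\<in>X. f x' = f x}))"
    by (rule sum.image_gen[OF assms])
  also have "\<dots> = (\<Sum>y\<in>f ` X. h y)"
  proof (rule sum.cong[OF refl])
    fix y assume "y \<in> f ` X"
    then have "0 < card {x\<in>X. f x = y}" using assms by (auto simp: card_gt_0_iff)
    then show "(\<Sum>x\<in>{x\<in>X. f x = y}. h (f x) / real (card {x'\<in>X. f x' = f x})) = h y"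
      by simp
  qed
  finally show ?thesis .
qed

lemma fent_altdef:
  assumes "finite X"
  shows "fent X f = (\<Sum>y\<in>f ` X. - (real (card {x\<in>X. f x = y}) / real (card X))
                       * ln (real (card {x\<in>X. f x = y}) / real (card X)))"
proof (cases "X = {}")
  case True
  then show ?thesis by (simp add: fent_def)
next
  case False
  have "fent X f = (\<Sum>x\<in>X. ln (real (card X) / real (card {x'\<in>X. f x' = f x})) / real (card X))"
    unfolding fent_def by (simp add: sum_divide_distrib)
  also have "\<dots> = (\<Sum>x\<in>X. (\<lambda>y. - (real (card {x\<in>X. f x = y}) / real (card X))
                       * ln (real (card {x\<in>X. f x = y}) / real (card X))) (f x)
                     / real (card {x'\<in>X. f x' = f x}))"
  proof (rule sum.cong[OF refl])
    fix x assume x: "x \<in> X"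
    have p: "0 < card {x'\<in>X. f x' = f x}" "0 < card X"
      using card_fiber_pos[OF assms x, of f] assms x by (auto simp: card_gt_0_iff)
    have "ln (real (card X) / real (card {x'\<in>X. f x' = f x}))
        = - ln (real (card {x'\<in>X. f x' = f x}) / real (card X))"
      using p by (simp add: ln_div)
    then show "ln (real (card X) / real (card {x'\<in>X. f x' = f x})) / real (card X) = (\<lambda>y. - (real (card {x\<in>X. f x = y}) / real (card X))
                       * ln (real (card {x\<in>X. f x = y}) / real (card X))) (f x)
                     / real (card {x'\<in>X. f x' = f x})"
      using p by (simp add: field_simps)
  qed
  also note sum_inverse_card_fiber[OF assms]
  finally show ?thesis .
qed

text \<open>A lower chain rule for the case that \<open>f\<close> reveals \<open>g b\<close> and the
  symbol \<open>F b a\<close>, but not necessarily \<open>b\<close>. By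
  \<open>ln x \<le> x - 1\<close>, applied to the ratio of the true fibre size \<open>R a b\<close>
  and the product \<open>G b * Q b a\<close>, it is enough that this ratio has mean at most
  1.\<close>

lemma fent_chain:
  fixes f :: "'a \<times> 'b \<Rightarrow> 'c"
  assumes fin: "finite A" "finite B" and ne: "A \<noteq> {}" "B \<noteq> {}"
    and det: "\<And>a b a' b'. a \<in> A \<Longrightarrow> b \<in> B \<Longrightarrow> a' \<in> A \<Longrightarrow> b' \<in> B \<Longrightarrow> f (a, b) = f (a', b')
               \<Longrightarrow> g b = g b' \<and> F b a = F b' a'"
  shows "fent B g + (\<Sum>b\<in>B. fent A (F b)) / real (card B) \<le> fent (A \<times> B) f"
proof -
  define G where "G b = real (card {b'\<in>B. g b' = g b})" for b
  define Q where "Q b a = real (card {a'\<in>A. F b a' = F b a})" for a b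
  define R where "R a b = real (card {p\<in>A\<times>B. f p = f (a, b)})" for a b
  define S where "S b z = {p\<in>A\<times>B. g (snd p) = g b \<and> F (snd p) (fst p) = z}" for b z
  let ?a = "real (card A)" and ?b = "real (card B)"
  have pos: "0 < ?a" "0 < ?b" using fin ne by (auto simp: card_gt_0_iff)
  have Gpos: "0 < G b" if "b \<in> B" for b
    unfolding G_def using card_fiber_pos[OF fin(2) that] by simp
  have Qpos: "0 < Q b a" if "a \<in> A" for a b
    unfolding Q_def using card_fiber_pos[OF fin(1) that] by simp
  have Rpos: "0 < R a b" if "a \<in> A" "b \<in> B" for a b
    unfolding R_def using card_fiber_pos[of "A \<times> B" "(a,b)"] fin that by simp
  have RS: "R a b \<le> real (card (S b (F b a)))" if "a \<in> A" "b \<in> B" for a b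
  proof -
    have "{p\<in>A\<times>B. f p = f (a, b)} \<subseteq> S b (F b a)"
    proof
      fix p assume "p \<in> {p\<in>A\<times>B. f p = f (a, b)}"
      then show "p \<in> S b (F b a)"
        using det[of "fst p" "snd p" a b] that by (cases p) (simp add: S_def)
    qed
    moreover have "finite (S b (F b a))" using fin by (simp add: S_def)
    ultimately show ?thesis unfolding R_def by (intro of_nat_mono card_mono)
  qed
  \<comment> \<open>For fixed \<open>b\<close> the sum over \<open>a\<close> becomes a sum over
    symbols \<open>z\<close>, and the sets \<open>S b z\<close> are disjoint subsets of the product
    of \<open>A\<close> with the fibre of \<open>g\<close> through \<open>b\<close>.\<close>
  have bound: "(\<Sum>b\<in>B. \<Sum>a\<in>A. R a b / (G b * Q b a)) \<le> ?a * ?b"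
  proof -
    have "(\<Sum>a\<in>A. R a b / (G b * Q b a)) \<le> ?a" if b: "b \<in> B" for b
    proof -
      have "(\<Sum>a\<in>A. R a b / (G b * Q b a)) \<le> (\<Sum>a\<in>A. (\<lambda>z. real (card (S b z)) / G b) (F b a) / Q b a)"
      proof (rule sum_mono)
        fix a assume a: "a \<in> A"
        show "R a b / (G b * Q b a) \<le> (\<lambda>z. real (card (S b z)) / G b) (F b a) / Q b a"
          using RS[OF a b] Gpos[OF b] Qpos[OF a, of b] by (simp add: divide_right_mono field_simps)
      qed
      also have "\<dots> = (\<Sum>z\<in>F b ` A. real (card (S b z)) / G b)"
        unfolding Q_def by (rule sum_inverse_card_fiber[OF fin(1)])
      also have "\<dots> = real (\<Sum>z\<in>F b ` A. card (S b z)) / G b"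
        by (simp add: sum_divide_distrib)
      also have "(\<Sum>z\<in>F b ` A. card (S b z)) = card (\<Union>z\<in>F b ` A. S b z)"
        using fin by (intro card_UN_disjoint[symmetric]) (auto simp: S_def)
      also have "real \<dots> \<le> real (card (A \<times> {b'\<in>B. g b' = g b}))"
        using fin by (intro of_nat_mono card_mono) (auto simp: S_def)
      also have "\<dots> = ?a * G b" by (simp add: G_def card_cartesian_product)
      finally show ?thesis using Gpos[OF b] by (simp add: divide_right_mono)
    qed
    then have "(\<Sum>b\<in>B. \<Sum>a\<in>A. R a b / (G b * Q b a)) \<le> (\<Sum>b\<in>B. ?a)" by (rule sum_mono)
    then show ?thesis by (simp add: mult.commute)
  qed
  have "?a * ?b * (fent B g + (\<Sum>b\<in>B. fent A (F b)) / ?b - fent (A \<times> B) f)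
      = (\<Sum>b\<in>B. \<Sum>a\<in>A. ln (?b / G b) + ln (?a / Q b a) - ln (?a * ?b / R a b))"
  proof -
    have 1: "?a * ?b * fent B g = (\<Sum>b\<in>B. \<Sum>a\<in>A. ln (?b / G b))"
    proof -
      have "?a * ?b * fent B g = ?a * (\<Sum>b\<in>B. ln (?b / G b))"
        using pos by (simp add: fent_def G_def)
      then show ?thesis by (simp add: sum_distrib_left)
    qed
    have 2: "?a * ?b * ((\<Sum>b\<in>B. fent A (F b)) / ?b) = (\<Sum>b\<in>B. \<Sum>a\<in>A. ln (?a / Q b a))"
    proof -
      have "?a * ?b * ((\<Sum>b\<in>B. fent A (F b)) / ?b) = (\<Sum>b\<in>B. ?a * fent A (F b))"
        using pos by (simp flip: sum_distrib_left)
      also have "\<dots> = (\<Sum>b\<in>B. \<Sum>a\<in>A. ln (?a / Q b a))"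
        using pos by (simp add: fent_def Q_def)
      finally show ?thesis .
    qed
    have 3: "?a * ?b * fent (A \<times> B) f = (\<Sum>b\<in>B. \<Sum>a\<in>A. ln (?a * ?b / R a b))"
    proof -
      have "?a * ?b * fent (A \<times> B) f = (\<Sum>p\<in>A\<times>B. ln (?a * ?b / R (fst p) (snd p)))"
        using pos by (simp add: fent_def R_def card_cartesian_product)
      also have "\<dots> = (\<Sum>a\<in>A. \<Sum>b\<in>B. ln (?a * ?b / R a b))"
        by (simp add: sum.cartesian_product split_def)
      also have "\<dots> = (\<Sum>b\<in>B. \<Sum>a\<in>A. ln (?a * ?b / R a b))" by (rule sum.swap)
      finally show ?thesis .
    qed
    have "?a * ?b * (fent B g + (\<Sum>b\<in>B. fent A (F b)) / ?b - fent (A \<times> B) f)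
      = ?a * ?b * fent B g + ?a * ?b * ((\<Sum>b\<in>B. fent A (F b)) / ?b) - ?a * ?b * fent (A \<times> B) f"
      by (simp only: distrib_left right_diff_distrib)
    then show ?thesis unfolding 1 2 3 by (simp only: sum.distrib sum_subtractf)
  qed
  also have "\<dots> \<le> (\<Sum>b\<in>B. \<Sum>a\<in>A. R a b / (G b * Q b a) - 1)"
  proof (intro sum_mono)
    fix a b assume a: "a \<in> A" and b: "b \<in> B"
    have "ln (?b / G b) + ln (?a / Q b a) - ln (?a * ?b / R a b) = ln (R a b / (G b * Q b a))"
      using pos Gpos[OF b] Qpos[OF a, of b] Rpos[OF a b] by (simp add: ln_div ln_mult)
    also have "\<dots> \<le> R a b / (G b * Q b a) - 1"
      using Gpos[OF b] Qpos[OF a, of b] Rpos[OF a b] by (intro ln_le_minus_one) simp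
    finally show "ln (?b / G b) + ln (?a / Q b a) - ln (?a * ?b / R a b) \<le> R a b / (G b * Q b a) - 1" .
  qed
  also have "\<dots> \<le> 0" using bound by (simp add: sum_subtractf mult.commute)
  finally have "?a * ?b * (fent B g + (\<Sum>b\<in>B. fent A (F b)) / ?b - fent (A \<times> B) f) \<le> 0" .
  then have "fent B g + (\<Sum>b\<in>B. fent A (F b)) / ?b - fent (A \<times> B) f \<le> 0"
    using pos by (simp add: mult_le_0_iff)
  then show ?thesis by simp
qed

text \<open>All fibre sizes are multiplied by \<open>k\<close>, which cancels in the ratios. It
  serves to pass from index tuples to columns.\<close>

lemma fent_reindex:
  assumes "finite X" "k > 0" "p ` X = Y" "\<And>y. y \<in> Y \<Longrightarrow> card {x\<in>X. p x = y} = k"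
  shows "fent X (f \<circ> p) = fent Y f"
proof -
  have count: "card {x\<in>X. P (p x)} = k * card {y\<in>Y. P y}" for P
  proof -
    have "card {x\<in>X. P (p x)} = card (\<Union>y\<in>{y\<in>Y. P y}. {x\<in>X. p x = y})"
      using assms(3) by (intro arg_cong[where f=card]) auto
    also have "\<dots> = (\<Sum>y\<in>{y\<in>Y. P y}. card {x\<in>X. p x = y})"
      using assms(1,3) by (intro card_UN_disjoint) auto
    also have "\<dots> = k * card {y\<in>Y. P y}" using assms(4) by simp
    finally show ?thesis .
  qed
  have cX: "card X = k * card Y" using count[of "\<lambda>_. True"] by simp
  have "(\<Sum>x\<in>X. ln (real (card X) / real (card {x'\<in>X. f (p x') = f (p x)})))
      = (\<Sum>x\<in>X. ln (real (card Y) / real (card {y\<in>Y. f y = f (p x)})))"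
    using assms(2) count[of "\<lambda>y. f y = f (p _)"] by (simp add: cX)
  also have "\<dots> = (\<Sum>y\<in>Y. \<Sum>x\<in>{x\<in>X. p x = y}. ln (real (card Y) / real (card {y'\<in>Y. f y' = f (p x)})))"
    by (subst sum.image_gen[OF assms(1), of _ p]) (simp add: assms(3))
  also have "\<dots> = (\<Sum>y\<in>Y. real k * ln (real (card Y) / real (card {y'\<in>Y. f y' = f y})))"
  proof (rule sum.cong[OF refl])
    fix y assume "y \<in> Y"
    have "(\<Sum>x\<in>{x\<in>X. p x = y}. ln (real (card Y) / real (card {y'\<in>Y. f y' = f (p x)})))
       = (\<Sum>x\<in>{x\<in>X. p x = y}. ln (real (card Y) / real (card {y'\<in>Y. f y' = f y})))"
      by (rule sum.cong) auto
    then show "(\<Sum>x\<in>{x\<in>X. p x = y}. ln (real (card Y) / real (card {y'\<in>Y. f y' = f (p x)})))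
       = real k * ln (real (card Y) / real (card {y'\<in>Y. f y' = f y}))"
      using assms(4)[OF \<open>y \<in> Y\<close>] by simp
  qed
  finally show ?thesis
    using assms(2) by (simp add: fent_def cX sum_distrib_left[symmetric])
qed

lemma ln_inverse_ge: "0 < x \<Longrightarrow> 1 - x \<le> ln (1 / x)" for x :: real
  using ln_le_minus_one[of x] by (simp add: ln_div)

text \<open>Since \<open>f\<close> decides \<open>P\<close>, its entropy is at least that of the
  event, and \<open>ln (1 / x) \<ge> 1 - x\<close> bounds \<open>- p * ln p - q * ln q\<close> from
  below by \<open>2 * p * q\<close>.\<close>

lemma fent_binary:
  assumes "finite X" "X \<noteq> {}"
    and det: "\<And>x y. x \<in> X \<Longrightarrow> y \<in> X \<Longrightarrow> f x = f y \<Longrightarrow> P x = P y"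
  shows "2 * (real (card {x\<in>X. P x}) / real (card X)) * (real (card {x\<in>X. \<not> P x}) / real (card X))
      \<le> fent X f"
proof -
  let ?c = "real (card X)" and ?p = "real (card {x\<in>X. P x})" and ?q = "real (card {x\<in>X. \<not> P x})"
  have c: "0 < ?c" using assms by (auto simp: card_gt_0_iff)
  have "card X = card ({x\<in>X. P x} \<union> {x\<in>X. \<not> P x})" by (rule arg_cong[where f=card]) auto
  also have "\<dots> = card {x\<in>X. P x} + card {x\<in>X. \<not> P x}"
    using assms(1) by (intro card_Un_disjoint) auto
  finally have pq: "?c = ?p + ?q" by simp
  have "(\<Sum>x\<in>X. if P x then ?q / ?c else ?p / ?c)
      \<le> (\<Sum>x\<in>X. ln (?c / real (card {x'\<in>X. P x' = P x})))"
  proof (rule sum_mono)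
    fix x assume x: "x \<in> X"
    have 0: "0 < card {x'\<in>X. P x' = P x}" by (rule card_fiber_pos[OF assms(1) x])
    have "(if P x then ?q / ?c else ?p / ?c) = 1 - real (card {x'\<in>X. P x' = P x}) / ?c"
    proof -
      have "?q / ?c = 1 - ?p / ?c" "?p / ?c = 1 - ?q / ?c" using pq c
        by (simp_all add: diff_divide_eq_iff eq_divide_eq divide_eq_eq flip: diff_divide_distrib)
      then show ?thesis by simp
    qed
    also have "\<dots> \<le> ln (1 / (real (card {x'\<in>X. P x' = P x}) / ?c))"
      using 0 c by (intro ln_inverse_ge) simp
    finally show "(if P x then ?q / ?c else ?p / ?c) \<le> ln (?c / real (card {x'\<in>X. P x' = P x}))"
      by simp
  qed
  also have "(\<Sum>x\<in>X. if P x then ?q / ?c else ?p / ?c) = ?p * (?q / ?c) + ?q * (?p / ?c)"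
    using assms(1) by (simp add: sum.If_cases Int_def)
  finally have "(?p * (?q / ?c) + ?q * (?p / ?c)) / ?c \<le> fent X P"
    unfolding fent_def using c by (intro divide_right_mono) auto
  moreover have "fent X P \<le> fent X f" by (rule fent_mono[OF assms(1)]) (use det in blast)
  moreover have "(?p * (?q / ?c) + ?q * (?p / ?c)) / ?c = 2 * (?p / ?c) * (?q / ?c)"
    using c by (simp add: field_simps)
  ultimately show ?thesis by linarith
qed

section \<open>Entropy along a finite set of times in a measure preserving system\<close>

definition ment :: "'a measure \<Rightarrow> ('a \<Rightarrow> 'b) \<Rightarrow> real" where
  "ment M F = - (\<Sum>y\<in>F ` space M. measure M (F -` {y} \<inter> space M) * ln (measure M (F -` {y} \<inter> space M)))"

definition bin_ent :: "real \<Rightarrow> real" where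
  "bin_ent p = - (p * ln p) - (1 - p) * ln (1 - p)"

lemma mult_ln_nonpos: "0 \<le> p \<Longrightarrow> p \<le> 1 \<Longrightarrow> p * ln p \<le> (0::real)"
  by (cases "p = 0") (auto intro!: mult_nonneg_nonpos)

text \<open>Encodes the itinerary of \<open>x\<close>: two points have the same value iff they lie
  in the same atom of the join over the times in \<open>N\<close>. Since it depends on the set of
  times and not on an enumeration, passing to fewer times is an intersection.\<close>

definition hits :: "('a \<Rightarrow> 'a) \<Rightarrow> 'a set \<Rightarrow> nat set \<Rightarrow> 'a \<Rightarrow> nat set" where
  "hits T A N x = {t\<in>N. (T ^^ t) x \<in> A}"

lemma hits_eq_iff: "y \<subseteq> N \<Longrightarrow> hits T A N x = y \<longleftrightarrow> (\<forall>t\<in>N. (T ^^ t) x \<in> A \<longleftrightarrow> t \<in> y)"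
  unfolding hits_def by blast

lemma hits_insert: "hits T A (insert t N) x = (if (T ^^ t) x \<in> A then {t} else {}) \<union> hits T A N x"
  by (auto simp: hits_def)

context prob_space
begin

text \<open>Gives access to data processing, the chain rule and the bound by the number of values;
  base \<open>exp 1\<close> turns \<open>log\<close> into \<open>ln\<close>.\<close>

lemma ment_eq_entropy:
  assumes "simple_function M F"
  shows "ment M F = entropy (exp 1) (count_space (F ` space M)) F"
proof -
  interpret information_space M "exp 1" by unfold_locales simp
  show ?thesis
    using entropy_simple_distributed[OF simple_distributedI[OF assms measure_nonneg refl]]
    by (simp add: ment_def log_def)
qed

lemma ment_compose_le:
  assumes "simple_function M F"
  shows "ment M (\<lambda>x. f (F x)) \<le> ment M F"
proof -
  interpret information_space M "exp 1" by unfold_locales simp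
  have "simple_function M (f \<circ> F)" using assms by (rule simple_function_compose)
  then show ?thesis
    using entropy_data_processing[OF assms, of f] ment_eq_entropy[OF assms] ment_eq_entropy[of "f \<circ> F"]
    by (simp add: comp_def)
qed

lemma ment_Pair_le:
  assumes "simple_function M F" "simple_function M G"
  shows "ment M (\<lambda>x. (F x, G x)) \<le> ment M F + ment M G"
proof -
  interpret information_space M "exp 1" by unfold_locales simp
  show ?thesis
    using entropy_chain_rule[OF assms] conditional_entropy_less_eq_entropy[OF assms(2,1)]
      ment_eq_entropy[OF assms(1)] ment_eq_entropy[OF assms(2)]
      ment_eq_entropy[OF simple_function_Pair[OF assms]]
    by simp
qed

text \<open>Values of probability 0 are discarded, so it suffices that \<open>Y\<close> contains the
  value at almost every point. Exceptional points then never have to be counted.\<close>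

lemma ment_le_ln_card:
  assumes F: "simple_function M F" and "finite Y" and ae: "AE x in M. F x \<in> Y"
  shows "ment M F \<le> ln (real (card Y))"
proof -
  interpret information_space M "exp 1" by unfold_locales simp
  let ?f = "\<lambda>y. prob (F -` {y} \<inter> space M)"
  have sub: "F ` space M \<inter> {y. ?f y \<noteq> 0} \<subseteq> Y"
  proof
    fix y assume y: "y \<in> F ` space M \<inter> {y. ?f y \<noteq> 0}"
    show "y \<in> Y"
    proof (rule ccontr)
      assume "y \<notin> Y"
      then have "AE x in M. x \<notin> F -` {y} \<inter> space M" using ae by (auto elim: eventually_mono)
      moreover have "F -` {y} \<inter> space M \<in> events" using F by (simp add: simple_functionD(2))
      ultimately have "?f y = 0" by (subst prob_eq_0) auto
      then show False using y by simp
    qed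
  qed
  have "ment M F \<le> ln (real (card (F ` space M \<inter> {y. ?f y \<noteq> 0})))"
    using entropy_le_card_not_0[OF simple_distributedI[OF F measure_nonneg refl]]
    by (simp add: ment_eq_entropy[OF F] log_def)
  also have "\<dots> \<le> ln (real (card Y))"
  proof (cases "card (F ` space M \<inter> {y. ?f y \<noteq> 0}) = 0")
    case True
    then show ?thesis by (cases "card Y = 0") auto
  next
    case False
    then show ?thesis using card_mono[OF assms(2) sub] by (intro ln_mono) auto
  qed
  finally show ?thesis .
qed

lemma ment_bool:
  assumes [measurable]: "D \<in> events"
  shows "ment M (\<lambda>x. x \<in> D) = bin_ent (prob D)"
proof -
  have sf: "simple_function M (\<lambda>x. x \<in> D)"
    unfolding simple_function_def by (auto intro: finite_subset[of _ "UNIV::bool set"])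
  have c: "ment M (\<lambda>x. x \<in> D) = - (\<Sum>y\<in>(UNIV::bool set). prob ((\<lambda>x. x \<in> D) -` {y} \<inter> space M)
          * ln (prob ((\<lambda>x. x \<in> D) -` {y} \<inter> space M)))"
    unfolding ment_def
  proof (intro arg_cong[where f=uminus] sum.mono_neutral_left)
    show "\<forall>i\<in>UNIV - (\<lambda>x. x \<in> D) ` space M.
       prob ((\<lambda>x. x \<in> D) -` {i} \<inter> space M) * ln (prob ((\<lambda>x. x \<in> D) -` {i} \<inter> space M)) = 0"
    proof
      fix i assume "i \<in> UNIV - (\<lambda>x. x \<in> D) ` space M"
      then have "(\<lambda>x. x \<in> D) -` {i} \<inter> space M = {}" by auto
      then show "prob ((\<lambda>x. x \<in> D) -` {i} \<inter> space M) * ln (prob ((\<lambda>x. x \<in> D) -` {i} \<inter> space M)) = 0"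
        by simp
    qed
  qed auto
  have 1: "(\<lambda>x. x \<in> D) -` {True} \<inter> space M = D" using sets.sets_into_space[OF assms] by auto
  have 2: "(\<lambda>x. x \<in> D) -` {False} \<inter> space M = space M - D" by auto
  show ?thesis unfolding c by (simp add: UNIV_bool 1 2 bin_ent_def prob_compl)
qed

end

locale pmp = prob_space M for M :: "'a measure" +
  fixes T :: "'a \<Rightarrow> 'a"
  assumes T_meas [measurable]: "T \<in> measurable M M" and T_pres: "distr M M T = M"
begin

lemma T_pow_meas [measurable]: "(T ^^ t) \<in> measurable M M"
  by (induction t) (auto intro: measurable_comp)

lemma T_pow_pres: "distr M M (T ^^ t) = M"
proof (induction t)
  case 0
  then show ?case by (simp add: distr_id2 id_def)
next
  case (Suc t)
  have "distr M M (T \<circ> (T ^^ t)) = distr (distr M M (T ^^ t)) M T"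
    by (rule distr_distr[symmetric]) measurable
  then show ?case by (simp add: Suc T_pres comp_def)
qed

lemma prob_vimage_T_pow:
  assumes "A \<in> events"
  shows "prob ((T ^^ t) -` A \<inter> space M) = prob A"
proof -
  have "prob A = measure (distr M M (T ^^ t)) A" by (simp add: T_pow_pres)
  also have "\<dots> = prob ((T ^^ t) -` A \<inter> space M)"
    by (rule measure_distr) (use assms in measurable)
  finally show ?thesis by simp
qed

lemma simple_hits:
  assumes [measurable]: "A \<in> events" and "finite N"
  shows "simple_function M (hits T A N)"
  unfolding simple_function_def
proof (intro conjI ballI)
  have "hits T A N ` space M \<subseteq> Pow N" by (auto simp: hits_def)
  then show "finite (hits T A N ` space M)" using assms(2) by (meson finite_Pow_iff finite_subset)
next
  fix y
  show "hits T A N -` {y} \<inter> space M \<in> sets M"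
  proof (cases "y \<subseteq> N")
    case True
    have "hits T A N -` {y} \<inter> space M = {x\<in>space M. \<forall>t\<in>N. (T ^^ t) x \<in> A \<longleftrightarrow> t \<in> y}"
      by (simp add: vimage_def hits_eq_iff[OF True] Int_def conj_commute)
    also have "\<dots> \<in> sets M"
    proof (intro sets.sets_Collect_finite_All assms(2))
      fix t
      have *: "{x\<in>space M. (T ^^ t) x \<in> A} \<in> sets M"
        using measurable_sets[OF T_pow_meas assms(1), of t] by (simp add: vimage_def Int_def conj_commute)
      have "{x\<in>space M. (T ^^ t) x \<notin> A} = space M - {x\<in>space M. (T ^^ t) x \<in> A}" by auto
      then show "{x\<in>space M. (T ^^ t) x \<in> A \<longleftrightarrow> t \<in> y} \<in> sets M"
        using * by (cases "t \<in> y") auto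
    qed
    finally show ?thesis .
  next
    case False
    then have "hits T A N -` {y} \<inter> space M = {}" by (auto simp: hits_def)
    then show ?thesis by simp
  qed
qed

text \<open>By subadditivity each time contributes at most the entropy of a preimage of the
  partition, which by invariance is the same for all times.\<close>

lemma ment_hits_le:
  assumes A: "A \<in> events" and "finite N"
  shows "ment M (hits T A N) \<le> card N * bin_ent (prob A)"
  using assms(2)
proof (induction N rule: finite_induct)
  case empty
  have "hits T A {} = (\<lambda>x. {})" by (auto simp: hits_def fun_eq_iff)
  then have "ment M (hits T A {}) = ment M (\<lambda>x. {} :: nat set)" by simp
  also have "\<dots> = 0"
  proof -
    have "(\<lambda>x. {} :: nat set) ` space M = {{}}" using not_empty by auto
    moreover have "(\<lambda>x. {} :: nat set) -` {{}} \<inter> space M = space M" by auto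
    ultimately show ?thesis unfolding ment_def by (simp add: prob_space)
  qed
  finally show ?case by simp
next
  case (insert t N)
  have sf: "simple_function M (hits T A {t})" "simple_function M (hits T A N)"
    using A insert by (auto intro: simple_hits)
  have "ment M (hits T A {t}) \<le> ment M (\<lambda>x. (T ^^ t) x \<in> A)"
  proof -
    have sf: "simple_function M (\<lambda>x. (T ^^ t) x \<in> A)"
      using ment_compose_le
      using A T_pow_meas[of t] unfolding simple_function_def
      by (auto intro: finite_subset[of _ "UNIV::bool set"])
    have "hits T A {t} = (\<lambda>x. if (T ^^ t) x \<in> A then {t} else {})"
      by (rule ext) (simp add: hits_insert hits_def[of _ _ "{}"])
    then show ?thesis using ment_compose_le[OF sf, of "\<lambda>b. if b then {t} else {}"] by simp
  qed
  also have "\<dots> = ment M (\<lambda>x. x \<in> (T ^^ t) -` A \<inter> space M)"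
    unfolding ment_def
    by (intro arg_cong[where f=uminus] sum.cong image_cong refl arg_cong2[where f="(*)"]
        arg_cong[where f=prob] arg_cong[where f=ln]) auto
  also have "\<dots> = bin_ent (prob ((T ^^ t) -` A \<inter> space M))"
    by (rule ment_bool) (use A in measurable)
  also have "\<dots> = bin_ent (prob A)" by (simp add: prob_vimage_T_pow A)
  finally have 1: "ment M (hits T A {t}) \<le> bin_ent (prob A)" .
  have "hits T A (insert t N) = (\<lambda>x. (\<lambda>(a, b). a \<union> b) (hits T A {t} x, hits T A N x))"
    by (rule ext) (simp add: hits_insert hits_def[of _ _ "{}"])
  then have "ment M (hits T A (insert t N)) \<le> ment M (\<lambda>x. (hits T A {t} x, hits T A N x))"
    using ment_compose_le[OF simple_function_Pair[OF sf], of "\<lambda>(a, b). a \<union> b"] by simp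
  also have "\<dots> \<le> ment M (hits T A {t}) + ment M (hits T A N)"
    by (rule ment_Pair_le[OF sf])
  finally show ?case using 1 insert by (simp add: algebra_simps)
qed

text \<open>The itinerary for \<open>A\<close> is the symmetric difference of those for
  \<open>B\<close> and for \<open>sym_diff A B\<close>, and the entropy of the latter is
  small.\<close>

lemma ment_hits_diff:
  assumes AB: "A \<in> events" "B \<in> events" and N: "finite N"
  shows "ment M (hits T A N) \<le> ment M (hits T B N) + card N * bin_ent (prob (sym_diff A B))"
proof -
  let ?D = "sym_diff A B"
  have D: "?D \<in> events" using AB by auto
  have sf: "simple_function M (hits T B N)" "simple_function M (hits T ?D N)"
    using AB D N by (auto intro: simple_hits)
  have "hits T A N = (\<lambda>x. (\<lambda>(a, b). sym_diff a b) (hits T B N x, hits T ?D N x))"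
    by (auto simp: hits_def fun_eq_iff)
  then have "ment M (hits T A N) \<le> ment M (\<lambda>x. (hits T B N x, hits T ?D N x))"
    using ment_compose_le[OF simple_function_Pair[OF sf], of "\<lambda>(a, b). sym_diff a b"] by simp
  also have "\<dots> \<le> ment M (hits T B N) + ment M (hits T ?D N)"
    by (rule ment_Pair_le[OF sf])
  also have "ment M (hits T ?D N) \<le> card N * bin_ent (prob ?D)"
    by (rule ment_hits_le[OF D N])
  finally show ?thesis by simp
qed

lemma ment_hits_subset:
  assumes "A \<in> events" "finite N" "N' \<subseteq> N"
  shows "ment M (hits T A N') \<le> ment M (hits T A N)"
proof -
  have "hits T A N' = (\<lambda>x. hits T A N x \<inter> N')" using assms(3) by (auto simp: hits_def fun_eq_iff)
  then show ?thesis
    using ment_compose_le[OF simple_hits[OF assms(1,2)], of "\<lambda>a. a \<inter> N'"] by simp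
qed

text \<open>Only the part of the measure over good positions \<open>i\<close> is described by
  uniform distributions; \<open>l\<close> stands for the mass of one position. Each
  \<open>fent X (F i)\<close> is at most the cross entropy relative to the true law
  \<open>Q\<close>, and \<open>l\<close> times the sum of the individual laws is dominated by
  \<open>Q\<close>, while \<open>- ln (Q y) \<ge> 0\<close>.\<close>

lemma ment_hits_ge_mixture:
  assumes A: "A \<in> events" and N: "finite N" and X: "finite X" and I: "finite I" and l: "0 \<le> l"
    and mix: "\<And>y. y \<subseteq> N \<Longrightarrow> l * (\<Sum>i\<in>I. real (card {x\<in>X. F i x = y}) / real (card X))
              \<le> prob (hits T A N -` {y} \<inter> space M)"
    and FN: "\<And>i x. i \<in> I \<Longrightarrow> x \<in> X \<Longrightarrow> F i x \<subseteq> N"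
  shows "l * (\<Sum>i\<in>I. fent X (F i)) \<le> ment M (hits T A N)"
proof (cases "l = 0 \<or> X = {}")
  case True
  have "0 \<le> ment M (hits T A N)"
    unfolding ment_def using mult_ln_nonpos[OF measure_nonneg prob_le_1] by (auto intro!: sum_nonpos)
  then show ?thesis using True by (auto simp: fent_def)
next
  case False
  then have l: "0 < l" and X0: "0 < real (card X)" using assms by (auto simp: card_gt_0_iff)
  define Q where "Q y = prob (hits T A N -` {y} \<inter> space M)" for y
  define q where "q i y = real (card {x\<in>X. F i x = y}) / real (card X)" for i y
  have q0: "0 \<le> q i y" for i y by (simp add: q_def)
  have Q1: "Q y \<le> 1" "0 \<le> Q y" for y by (auto simp: Q_def)
  have sumQ: "(\<Sum>y\<in>Pow N. Q y) \<le> 1"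
  proof -
    have "(\<Sum>y\<in>Pow N. Q y) = prob (\<Union>y\<in>Pow N. hits T A N -` {y} \<inter> space M)"
      unfolding Q_def using N simple_functionD(2)[OF simple_hits[OF A N]]
      by (intro finite_measure_finite_Union[symmetric]) (auto simp: disjoint_family_on_def)
    then show ?thesis by simp
  qed
  have sumq: "(\<Sum>y\<in>Pow N. q i y) = 1" if i: "i \<in> I" for i
  proof -
    have "(\<Sum>y\<in>Pow N. card {x\<in>X. F i x = y}) = card (\<Union>y\<in>Pow N. {x\<in>X. F i x = y})"
      using N X by (intro card_UN_disjoint[symmetric]) auto
    also have "(\<Union>y\<in>Pow N. {x\<in>X. F i x = y}) = X" using FN[OF i] by auto
    finally have "real (\<Sum>y\<in>Pow N. card {x\<in>X. F i x = y}) = real (card X)" by simp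
    then show ?thesis unfolding q_def using X0 by (simp flip: sum_divide_distrib)
  qed
  have ent_q: "fent X (F i) \<le> (\<Sum>y\<in>Pow N. q i y * (- ln (Q y)))" if i: "i \<in> I" for i
  proof -
    have "fent X (F i) = (\<Sum>y\<in>F i ` X. - q i y * ln (q i y))"
      unfolding fent_altdef[OF X] q_def by simp
    also have "\<dots> = (\<Sum>y\<in>Pow N. - q i y * ln (q i y))"
    proof (rule sum.mono_neutral_left)
      show "F i ` X \<subseteq> Pow N" using FN[OF i] by auto
      show "\<forall>y\<in>Pow N - F i ` X. - q i y * ln (q i y) = 0"
      proof
        fix y assume "y \<in> Pow N - F i ` X"
        then have "{x\<in>X. F i x = y} = {}" by auto
        then have "q i y = 0" unfolding q_def by (simp only: card.empty)
        then show "- q i y * ln (q i y) = 0" by simp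
      qed
    qed (use N in auto)
    \<comment> \<open>Gibbs' inequality from \<open>ln x \<le> x - 1\<close> at
      \<open>x = Q y / q i y\<close>; the corrections \<open>Q y - q i y\<close> sum to at most 0,
      as \<open>Q\<close> has mass at most 1 and \<open>q i\<close> has mass 1.\<close>
    also have "\<dots> \<le> (\<Sum>y\<in>Pow N. q i y * (- ln (Q y)) + (Q y - q i y))"
    proof (rule sum_mono)
      fix y assume y: "y \<in> Pow N"
      show "- q i y * ln (q i y) \<le> q i y * (- ln (Q y)) + (Q y - q i y)"
      proof (cases "q i y = 0")
        case True
        then show ?thesis using Q1 by simp
      next
        case False
        then have p: "0 < q i y" using q0[of i y] by simp
        have "l * q i y \<le> l * (\<Sum>i\<in>I. q i y)"
          using l I i q0 by (intro mult_left_mono member_le_sum) auto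
        also have "\<dots> \<le> Q y" using mix[of y] y by (simp add: q_def Q_def)
        finally have P: "0 < Q y" using p l by (meson less_le_trans mult_pos_pos)
        have "ln (Q y / q i y) \<le> Q y / q i y - 1" using p P by (intro ln_le_minus_one) simp
        then have "q i y * ln (Q y / q i y) \<le> q i y * (Q y / q i y - 1)"
          using p by (intro mult_left_mono) auto
        also have "\<dots> = Q y - q i y" using p by (simp add: field_simps)
        finally show ?thesis using p P by (simp add: ln_div algebra_simps)
      qed
    qed
    also have "\<dots> \<le> (\<Sum>y\<in>Pow N. q i y * (- ln (Q y)))"
      using sumQ sumq[OF i] by (simp add: sum.distrib sum_subtractf sum_negf)
    finally show ?thesis .
  qed
  have "l * (\<Sum>i\<in>I. fent X (F i)) \<le> l * (\<Sum>i\<in>I. \<Sum>y\<in>Pow N. q i y * (- ln (Q y)))"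
    using l ent_q by (intro mult_left_mono sum_mono) auto
  also have "\<dots> = (\<Sum>y\<in>Pow N. l * (\<Sum>i\<in>I. q i y) * (- ln (Q y)))"
    by (subst sum.swap) (simp add: sum_distrib_left sum_distrib_right mult.assoc sum_negf)
  also have "\<dots> \<le> (\<Sum>y\<in>Pow N. Q y * (- ln (Q y)))"
  proof (rule sum_mono)
    fix y assume y: "y \<in> Pow N"
    have le: "l * (\<Sum>i\<in>I. q i y) \<le> Q y" using mix[of y] y by (simp add: q_def Q_def)
    have "ln (Q y) \<le> 0"
    proof (cases "Q y = 0")
      case False
      then have "0 < Q y" using Q1(2)[of y] by simp
      then show ?thesis using Q1 by simp
    qed simp
    then show "l * (\<Sum>i\<in>I. q i y) * (- ln (Q y)) \<le> Q y * (- ln (Q y))"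
      using le by (intro mult_right_mono) auto
  qed
  also have "\<dots> = ment M (hits T A N)"
  proof -
    have "(\<Sum>y\<in>Pow N. Q y * ln (Q y)) = (\<Sum>y\<in>hits T A N ` space M. Q y * ln (Q y))"
    proof (rule sum.mono_neutral_right)
      show "\<forall>y\<in>Pow N - hits T A N ` space M. Q y * ln (Q y) = 0"
      proof
        fix y assume "y \<in> Pow N - hits T A N ` space M"
        then have "hits T A N -` {y} \<inter> space M = {}" by auto
        then show "Q y * ln (Q y) = 0" by (simp add: Q_def)
      qed
    qed (use N in \<open>auto simp: hits_def\<close>)
    then show ?thesis by (simp add: ment_def Q_def sum_negf)
  qed
  finally show ?thesis .
qed

text \<open>The nonempty members of the join are the level sets of \<open>hits\<close>. A choice of
  cells that no point realises gives the empty set, which contributes 0.\<close>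

lemma partition_entropy_preimage_join:
  assumes A: "A \<in> events"
  shows "partition_entropy M (preimage_join M T {A, space M - A} s n) = ment M (hits T A (s ` {1..n}))"
proof -
  let ?N = "s ` {1..n}"
  let ?V = "\<lambda>y. hits T A ?N -` {y} \<inter> space M"
  let ?J = "preimage_join M T {A, space M - A} s n"
  have inT: "(T ^^ t) x \<in> space M" if "x \<in> space M" for x t
    using measurable_space[OF T_pow_meas that] .
  have sub: "?V ` (hits T A ?N ` space M) \<subseteq> ?J"
  proof
    fix U assume "U \<in> ?V ` (hits T A ?N ` space M)"
    then obtain x where "U = ?V (hits T A ?N x)" by blast
    moreover have "hits T A ?N x \<subseteq> ?N" by (auto simp: hits_def)
    ultimately obtain y where y: "y \<subseteq> ?N" "U = ?V y" by blast
    have "U = {x \<in> space M. \<forall>i\<in>{1..n}. (T ^^ s i) x \<in> (if s i \<in> y then A else space M - A)}"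
    proof -
      have "?V y = {x \<in> space M. \<forall>t\<in>?N. (T ^^ t) x \<in> A \<longleftrightarrow> t \<in> y}"
        by (simp only: vimage_def singleton_iff hits_eq_iff[OF y(1)]) auto
      also have "\<dots> = {x \<in> space M. \<forall>i\<in>{1..n}. (T ^^ s i) x \<in> (if s i \<in> y then A else space M - A)}"
      proof (intro Collect_cong conj_cong refl)
        fix x assume x: "x \<in> space M"
        have "((T ^^ t) x \<in> A) = (t \<in> y) \<longleftrightarrow> (T ^^ t) x \<in> (if t \<in> y then A else space M - A)" for t
          using inT[OF x] by simp
        then show "(\<forall>t\<in>?N. ((T ^^ t) x \<in> A) = (t \<in> y))
            = (\<forall>i\<in>{1..n}. (T ^^ s i) x \<in> (if s i \<in> y then A else space M - A))"
          by (simp only: ball_simps image_iff) blast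
      qed
      finally show ?thesis using y(2) by simp
    qed
    then show "U \<in> ?J"
      unfolding preimage_join_def
      by (intro CollectI exI[of _ "\<lambda>i. if s i \<in> y then A else space M - A"]) auto
  qed
  have sup: "U = {} \<or> U \<in> ?V ` (hits T A ?N ` space M)" if U: "U \<in> ?J" for U
  proof -
    obtain f where f: "U = {x \<in> space M. \<forall>i\<in>{1..n}. (T ^^ s i) x \<in> f i}"
      "\<forall>i\<in>{1..n}. f i \<in> {A, space M - A}"
      using U unfolding preimage_join_def by blast
    show ?thesis
    proof (cases "U = {}")
      case False
      then obtain x where x: "x \<in> U" by blast
      have fi: "f i = (if (T ^^ s i) x \<in> A then A else space M - A)" if "i \<in> {1..n}" for i
      proof -
        have "f i = A \<or> f i = space M - A" "(T ^^ s i) x \<in> f i" using f x that by blast+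
        then show ?thesis by auto
      qed
      have "U = ?V (hits T A ?N x)"
      proof (intro set_eqI iffI)
        fix z assume "z \<in> U"
        then have z: "z \<in> space M" "\<And>i. i \<in> {1..n} \<Longrightarrow> (T ^^ s i) z \<in> f i" using f(1) by auto
        have "(T ^^ s i) z \<in> A \<longleftrightarrow> (T ^^ s i) x \<in> A" if "i \<in> {1..n}" for i
          using z(2)[OF that] fi[OF that] by (auto split: if_splits)
        then show "z \<in> ?V (hits T A ?N x)" using z(1) by (auto simp: hits_def)
      next
        fix z assume z: "z \<in> ?V (hits T A ?N x)"
        have "(T ^^ s i) z \<in> A \<longleftrightarrow> (T ^^ s i) x \<in> A" if "i \<in> {1..n}" for i
        proof -
          have "hits T A ?N z = hits T A ?N x" using z by simp
          then have "s i \<in> hits T A ?N z \<longleftrightarrow> s i \<in> hits T A ?N x" by simp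
          then show ?thesis using that by (simp add: hits_def)
        qed
        then show "z \<in> U" unfolding f(1) using z fi inT by auto
      qed
      moreover have "x \<in> space M" using x f by auto
      ultimately show ?thesis by blast
    qed simp
  qed
  have finH: "finite (hits T A ?N ` space M)"
    using simple_functionD(1)[OF simple_hits[OF A, of ?N]] by simp
  have "?J \<subseteq> insert {} (?V ` (hits T A ?N ` space M))" using sup by blast
  then have finJ: "finite ?J" using finH by (meson finite.insertI finite_imageI finite_subset)
  have "(\<Sum>U\<in>?J. prob U * ln (prob U)) = (\<Sum>U\<in>?V ` (hits T A ?N ` space M). prob U * ln (prob U))"
  proof (rule sum.mono_neutral_right[OF finJ sub])
    show "\<forall>U\<in>?J - ?V ` (hits T A ?N ` space M). prob U * ln (prob U) = 0"
    proof
      fix U assume "U \<in> ?J - ?V ` (hits T A ?N ` space M)"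
      then have "U = {}" using sup by blast
      then show "prob U * ln (prob U) = 0" by simp
    qed
  qed
  also have "\<dots> = (\<Sum>y\<in>hits T A ?N ` space M. prob (?V y) * ln (prob (?V y)))"
    by (rule sum.reindex_cong[OF _ refl refl]) (auto simp: inj_on_def)
  finally show ?thesis by (simp add: partition_entropy_def ment_def)
qed

end

lemma bin_ent_tendsto_0: "(bin_ent \<longlongrightarrow> 0) (at_right 0)"
  unfolding bin_ent_def by real_asymp

subsection \<open>Cutting and stacking of uniform towers\<close>

definition col_occ :: "column \<Rightarrow> real \<Rightarrow> nat" where
  "col_occ C x = (\<Sum>a\<leftarrow>col_ends C. of_bool (x \<in> {a..<a + col_width C}))"

text \<open>Levels are counted with multiplicity. A bound of 1 encodes that all levels are disjoint,
  positivity encodes their union, and the counts simply add under cutting and stacking.\<close>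

definition occ :: "tower \<Rightarrow> real \<Rightarrow> nat" where
  "occ V x = (\<Sum>C\<leftarrow>V. col_occ C x)"

text \<open>Equal widths survive each of the three operations, so widths need not be tracked column
  by column.\<close>

definition uniform_tower :: "real \<Rightarrow> nat \<Rightarrow> tower \<Rightarrow> bool" where
  "uniform_tower v h V \<longleftrightarrow> V \<noteq> [] \<and> 0 < v \<and> (\<forall>C\<in>set V. col_width C = v \<and> col_height C = h)"

lemma sum_list_pos_iff_nat: "0 < (\<Sum>x\<leftarrow>xs. f x :: nat) \<longleftrightarrow> (\<exists>x\<in>set xs. 0 < f x)"
  by (induction xs) auto

lemma col_occ_pos_iff: "0 < col_occ C x \<longleftrightarrow> (\<exists>i<col_height C. x \<in> level C i)"
proof -
  have "0 < col_occ C x \<longleftrightarrow> (\<exists>a\<in>set (col_ends C). x \<in> {a..<a + col_width C})"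
    unfolding col_occ_def sum_list_pos_iff_nat by simp
  also have "\<dots> \<longleftrightarrow> (\<exists>i<col_height C. x \<in> level C i)"
    unfolding level_def by (metis in_set_conv_nth)
  finally show ?thesis .
qed

lemma occ_pos_iff: "0 < occ V x \<longleftrightarrow> x \<in> \<Union>(tower_levels V)"
proof -
  have "0 < occ V x \<longleftrightarrow> (\<exists>C\<in>set V. 0 < col_occ C x)"
    unfolding occ_def sum_list_pos_iff_nat ..
  then show ?thesis unfolding col_occ_pos_iff tower_levels_def by blast
qed

text \<open>A repeated column would put the left end of its bottom level into two levels.\<close>

lemma occ_le_1_distinct:
  assumes "uniform_tower v h V" "0 < h" "\<And>x. occ V x \<le> 1"
  shows "distinct V"
proof (rule ccontr)
  assume "\<not> distinct V"
  then obtain xs ys zs C where V: "V = xs @ [C] @ ys @ [C] @ zs"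
    using not_distinct_decomp by blast
  have C: "col_width C = v" "col_height C = h" "0 < v"
    using assms(1) by (auto simp: uniform_tower_def V)
  have "0 < col_occ C (col_ends C ! 0)"
    unfolding col_occ_pos_iff using C assms(2) by (intro exI[of _ 0]) (auto simp: level_def)
  then have "2 \<le> occ V (col_ends C ! 0)" by (simp add: occ_def V)
  then show False using assms(3)[of "col_ends C ! 0"] by simp
qed

lemma sum_list_of_bool_ge_2:
  assumes "i < j" "j < length xs" "P (xs ! i)" "P (xs ! j)"
  shows "2 \<le> (\<Sum>x\<leftarrow>xs. of_bool (P x) :: nat)"
proof -
  have "(\<Sum>x\<leftarrow>xs. of_bool (P x) :: nat) = (\<Sum>k<length xs. of_bool (P (xs ! k)))"
    by (simp add: sum_list_sum_nth atLeast0LessThan)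
  also have "\<dots> \<ge> (\<Sum>k\<in>{i, j}. of_bool (P (xs ! k)))"
    using assms by (intro sum_mono2) auto
  finally show ?thesis using assms by simp
qed

lemma occ_le_1_disjoint:
  assumes occ: "\<And>x. occ V x \<le> 1" and C: "C \<in> set V" "i < col_height C" "x \<in> level C i"
    and D: "D \<in> set V" "j < col_height D" "x \<in> level D j"
  shows "C = D \<and> i = j"
proof (rule ccontr)
  assume neq: "\<not> (C = D \<and> i = j)"
  show False
  proof (cases "C = D")
    case True
    then have ij: "i \<noteq> j" using neq by simp
    have "2 \<le> col_occ C x"
    proof (cases "i < j")
      case True
      then show ?thesis unfolding col_occ_def using C D \<open>C = D\<close>
        by (intro sum_list_of_bool_ge_2[of i j]) (auto simp: level_def)
    next
      case False
      then show ?thesis unfolding col_occ_def using C D \<open>C = D\<close> ij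
        by (intro sum_list_of_bool_ge_2[of j i]) (auto simp: level_def)
    qed
    also have "col_occ C x \<le> occ V x"
      unfolding occ_def using C(1) by (intro member_le_sum_list) auto
    finally show False using occ[of x] by simp
  next
    case False
    obtain xs ys where V: "V = xs @ C # ys" using C(1) split_list by metis
    have "0 < col_occ C x" unfolding col_occ_pos_iff using C by blast
    moreover have "0 < col_occ D x" unfolding col_occ_pos_iff using D by blast
    moreover have "D \<in> set (xs @ ys)" using D(1) False V by auto
    then have "col_occ D x \<le> occ (xs @ ys) x"
      unfolding occ_def by (intro member_le_sum_list) auto
    ultimately have "2 \<le> occ V x" by (simp add: occ_def V)
    then show False using occ[of x] by simp
  qed
qed

lemma sum_of_bool_intervals:
  fixes a v x :: real
  assumes "0 < v"
  shows "(\<Sum>j<m. of_bool (x \<in> {a + real j * v..<a + real j * v + v}) :: nat)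
       = of_bool (x \<in> {a..<a + real m * v})"
proof (induction m)
  case (Suc m)
  have le: "a \<le> a + v * real m" using assms by simp
  show ?case using assms unfolding sum.lessThan_Suc Suc.IH
    by (auto simp: of_bool_def algebra_simps intro: order_trans[OF le])
qed simp

lemma sum_col_occ_subcolumn:
  assumes "0 < v" "col_width C = real m * v"
  shows "(\<Sum>j<m. col_occ (subcolumn C (real j * v) v) x) = col_occ C x"
proof -
  have 1: "(\<Sum>j<m. \<Sum>a\<leftarrow>as. of_bool (x \<in> {a + real j * v..<a + real j * v + v}) :: nat)
      = (\<Sum>a\<leftarrow>as. of_bool (x \<in> {a..<a + real m * v}))" for as :: "real list"
  proof (induction as)
    case (Cons a as)
    then show ?case
      using sum_of_bool_intervals[OF assms(1), where m = m and x = x and a = a] by (simp add: sum.distrib del: atLeastLessThan_iff)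
  qed simp
  have 2: "col_occ (subcolumn C d v) x = (\<Sum>a\<leftarrow>col_ends C. of_bool (x \<in> {a + d..<a + d + v}))" for d
    by (simp add: col_occ_def subcolumn_def comp_def)
  show ?thesis unfolding 2 using 1[of "col_ends C"] by (simp add: col_occ_def assms(2))
qed

lemma col_occ_stack: "col_width C = col_width C' \<Longrightarrow> col_occ (stack C C') x = col_occ C x + col_occ C' x"
  by (simp add: col_occ_def stack_def)

lemma sum_list_concat_map: "(\<Sum>x\<leftarrow>concat (map f xs). g x) = (\<Sum>y\<leftarrow>xs. \<Sum>x\<leftarrow>f y. (g x :: nat))"
  by (induction xs) auto

lemma occ_conv_nth: "occ V x = (\<Sum>i<length V. col_occ (V ! i) x)"
  by (simp add: occ_def sum_list_sum_nth atLeast0LessThan)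

lemma tower_width_uniform:
  "uniform_tower v h V \<Longrightarrow> tower_width V = real (length V) * v"
  unfolding tower_width_def uniform_tower_def
  by (subst map_cong[OF refl, of V col_width "\<lambda>_. v"]) (auto simp: sum_list_triv)

text \<open>With equal total widths, the product formula for the widths amounts to cutting each
  column of the first tower into \<open>length W2\<close> equal parts.\<close>

lemma ind_stack_uniform:
  assumes W1: "uniform_tower v1 h1 W1" and W2: "uniform_tower v2 h2 W2"
    and eq: "real (length W1) * v1 = real (length W2) * v2"
  defines "v \<equiv> v1 / real (length W2)"
  shows "ind_stack W1 W2 = concat (map (\<lambda>i. map (\<lambda>k.
      stack (subcolumn (W1 ! i) (real k * v) v) (subcolumn (W2 ! k) (real i * v) v))
      [0..<length W2]) [0..<length W1])"
proof -
  have pos: "0 < v1" "0 < v2" "0 < length W1" "0 < length W2"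
    using W1 W2 by (auto simp: uniform_tower_def)
  have w1: "col_width (W1 ! i) = v1" if "i < length W1" for i using W1 that by (auto simp: uniform_tower_def)
  have w2: "col_width (W2 ! k) = v2" if "k < length W2" for k using W2 that by (auto simp: uniform_tower_def)
  have vv: "v1 * v2 / (real (length W1) * v1) = v"
    using pos eq unfolding v_def by (simp add: divide_simps)
  show ?thesis
    unfolding ind_stack_def Let_def tower_width_uniform[OF W1]
    by (intro arg_cong[where f=concat] map_cong refl arg_cong2[where f=stack] arg_cong2[where f="subcolumn _"])
       (auto simp: w1 w2 vv)
qed

lemma uniform_subcolumn [simp]:
  "col_width (subcolumn C d v) = v" "col_height (subcolumn C d v) = col_height C"
  by (simp_all add: subcolumn_def)

lemma stack_simps [simp]:
  "col_width (stack C C') = col_width C" "col_height (stack C C') = col_height C + col_height C'"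
  "col_ends (stack C C') = col_ends C @ col_ends C'"
  by (simp_all add: stack_def)

lemma
  assumes W1: "uniform_tower v1 h1 W1" and W2: "uniform_tower v2 h2 W2"
    and eq: "real (length W1) * v1 = real (length W2) * v2"
  shows uniform_ind_stack: "uniform_tower (v1 / real (length W2)) (h1 + h2) (ind_stack W1 W2)"
    and length_ind_stack: "length (ind_stack W1 W2) = length W1 * length W2"
    and occ_ind_stack: "occ (ind_stack W1 W2) x = occ W1 x + occ W2 x"
proof -
  have pos: "0 < v1" "0 < v2" "0 < length W1" "0 < length W2"
    using W1 W2 by (auto simp: uniform_tower_def)
  let ?v = "v1 / real (length W2)"
  have v: "0 < ?v" "v1 = real (length W2) * ?v" "v2 = real (length W1) * ?v"
    using pos eq by (auto simp: field_simps)
  note IS = ind_stack_uniform[OF W1 W2 eq]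
  show L: "length (ind_stack W1 W2) = length W1 * length W2"
    unfolding IS by (simp add: length_concat comp_def sum_list_triv)
  have "0 < length (ind_stack W1 W2)" unfolding L using pos by simp
  then show "uniform_tower ?v (h1 + h2) (ind_stack W1 W2)"
    using v(1) W1 W2 unfolding uniform_tower_def IS by (auto simp: uniform_tower_def)
  have "occ (ind_stack W1 W2) x = (\<Sum>i<length W1. \<Sum>k<length W2.
      col_occ (subcolumn (W1 ! i) (real k * ?v) ?v) x + col_occ (subcolumn (W2 ! k) (real i * ?v) ?v) x)"
    unfolding IS occ_def sum_list_concat_map
    by (simp add: col_occ_stack comp_def interv_sum_list_conv_sum_set_nat atLeast0LessThan)
  also have "\<dots> = (\<Sum>i<length W1. \<Sum>k<length W2. col_occ (subcolumn (W1 ! i) (real k * ?v) ?v) x)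
      + (\<Sum>k<length W2. \<Sum>i<length W1. col_occ (subcolumn (W2 ! k) (real i * ?v) ?v) x)"
    by (subst (2) sum.swap) (simp add: sum.distrib)
  also have "\<dots> = (\<Sum>i<length W1. col_occ (W1 ! i) x) + (\<Sum>k<length W2. col_occ (W2 ! k) x)"
  proof (intro arg_cong2[where f="(+)"] sum.cong refl sum_col_occ_subcolumn v(1))
    fix i assume "i \<in> {..<length W1}"
    then show "col_width (W1 ! i) = real (length W2) * ?v" using W1 v(2) by (simp add: uniform_tower_def)
  next
    fix k assume "k \<in> {..<length W2}"
    then show "col_width (W2 ! k) = real (length W1) * ?v" using W2 v(3) by (simp add: uniform_tower_def)
  qed
  finally show "occ (ind_stack W1 W2) x = occ W1 x + occ W2 x" by (simp add: occ_conv_nth)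
qed

text \<open>\<open>built v Z its E\<close>: the column of width \<open>v\<close> with left end points \<open>E\<close> is a stack of translated
  subcolumns of the columns in \<open>its\<close>, with one level inside \<open>Z\<close> for each \<^const>\<open>None\<close>.\<close>

inductive built :: "real \<Rightarrow> real set \<Rightarrow> column option list \<Rightarrow> real list \<Rightarrow> bool" for v Z where
  Nil: "built v Z [] []"
| Some: "built v Z its E \<Longrightarrow> 0 \<le> d \<Longrightarrow> d + v \<le> col_width C
    \<Longrightarrow> built v Z (Some C # its) (map (\<lambda>a. a + d) (col_ends C) @ E)"
| None: "built v Z its E \<Longrightarrow> {a..<a + v} \<subseteq> Z \<Longrightarrow> built v Z (None # its) (a # E)"

inductive_cases built_SomeE: "built v Z (Some C # its) E"

inductive_cases built_NilE: "built v Z [] E"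

lemma built_append: "built v Z its E \<Longrightarrow> built v Z its' E' \<Longrightarrow> built v Z (its @ its') (E @ E')"
  by (induction rule: built.induct) (auto intro: built.intros)

lemma built_mono: "built v Z its E \<Longrightarrow> Z \<subseteq> Z' \<Longrightarrow> built v Z' its E"
  by (induction rule: built.induct) (auto intro: built.intros)

lemma built_single: "0 \<le> d \<Longrightarrow> d + v \<le> col_width C \<Longrightarrow> built v Z [Some C] (map (\<lambda>a. a + d) (col_ends C))"
  using built.Some[OF built.Nil, of d v C Z] by simp

lemma built_shift:
  "built v Z its E \<Longrightarrow> 0 \<le> d \<Longrightarrow> d + v' \<le> v \<Longrightarrow> built v' Z its (map (\<lambda>a. a + d) E)"
proof (induction rule: built.induct)
  case Nil
  then show ?case by (simp add: built.Nil)
next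
  case (Some its E d' C)
  then have "built v' Z (Some C # its) (map (\<lambda>a. a + (d' + d)) (col_ends C) @ map (\<lambda>a. a + d) E)"
    by (intro built.Some) auto
  then show ?case by (simp add: comp_def algebra_simps)
next
  case (None its E a)
  then show ?case by (simp add: subset_iff) (intro built.None; auto)
qed

lemma built_concat:
  assumes "\<And>x. x \<in> set xs \<Longrightarrow> built v Z (f x) (g x)"
  shows "built v Z (concat (map f xs)) (concat (map g xs))"
  using assms by (induction xs) (auto intro: built.Nil built_append)

text \<open>Composes recipes: those of \<open>Rep\<close> with those of \<open>Ind\<close>, and both
  with the cut before spacers are inserted.\<close>

lemma built_trans:
  assumes "built v Z (map Some (map g xs)) E"
    and "\<And>i. i \<in> set xs \<Longrightarrow> built (col_width (g i)) Z (f i) (col_ends (g i))"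
  shows "built v Z (concat (map f xs)) E"
  using assms
proof (induction xs arbitrary: E)
  case Nil
  then show ?case by (auto elim: built_NilE intro: built.Nil)
next
  case (Cons i xs)
  from Cons.prems(1) obtain E' d where E': "E = map (\<lambda>a. a + d) (col_ends (g i)) @ E'"
    "built v Z (map Some (map g xs)) E'" "0 \<le> d" "d + v \<le> col_width (g i)"
    unfolding list.map by (elim built_SomeE) blast
  have "built v Z (f i) (map (\<lambda>a. a + d) (col_ends (g i)))"
    using Cons.prems(2)[of i] E'(3,4) by (intro built_shift[of "col_width (g i)"]) auto
  moreover have "built v Z (concat (map f xs)) E'" using Cons E'(2) by simp
  ultimately show ?case unfolding E'(1) by (simp add: built_append)
qed

lemma built_nth:
  assumes "built v Z (map Some Cs) E" "k < length Cs" "\<And>C. C \<in> set Cs \<Longrightarrow> col_height C = H"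
  shows "built v Z [Some (Cs ! k)] (take H (drop (k * H) E))"
  using assms
proof (induction Cs arbitrary: E k)
  case (Cons C Cs)
  from Cons.prems(1) obtain E' d where E': "E = map (\<lambda>a. a + d) (col_ends C) @ E'"
    "built v Z (map Some Cs) E'" "0 \<le> d" "d + v \<le> col_width C"
    by simp (elim built_SomeE, blast)
  have H: "col_height C = H" using Cons.prems by simp
  show ?case
  proof (cases k)
    case 0
    then show ?thesis using E' H built_single[of d v C Z] by simp
  next
    case (Suc k')
    then have "drop (k * H) E = drop (k' * H) E'" by (simp add: E'(1) H)
    then show ?thesis using Cons.IH[OF E'(2), of k'] Cons.prems Suc by simp
  qed
qed simp

section \<open>Index tuples and the columns of an independent stacking\<close>

lemma concat_concat_map: "concat (concat xss) = concat (map concat xss)"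
  by (induction xss) auto

lemma product_lists_snoc:
  "product_lists (xss @ [xs]) = concat (map (\<lambda>J. map (\<lambda>x. J @ [x]) xs) (product_lists xss))"
  by (induction xss) (auto simp: map_concat comp_def concat_concat_map)

text \<open>Lexicographic order extended at the last entry, matching the left fold that defines
  \<open>Ind\<close>, where each new slice multiplies the list from the right.\<close>

lemma index_tuples_Suc:
  "index_tuples c (Suc e) = concat (map (\<lambda>J. map (\<lambda>i. J @ [i]) [1..<Suc c]) (index_tuples c e))"
  unfolding index_tuples_def
  by (simp only: replicate_Suc replicate_append_same[symmetric] product_lists_snoc)

definition tuples :: "nat \<Rightarrow> nat \<Rightarrow> nat list set" where
  "tuples c e = {J. length J = e \<and> set J \<subseteq> {1..c}}"

lemma set_index_tuples: "set (index_tuples c e) = tuples c e"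
  unfolding index_tuples_def tuples_def product_lists_set
  by (rule Collect_cong)
    (auto simp: list_all2_conv_all_nth subset_eq all_set_conv_all_nth simp del: upt_Suc)

lemma distinct_index_tuples: "distinct (index_tuples c e)"
  unfolding index_tuples_def by (intro distinct_product_lists) auto

lemma finite_tuples: "finite (tuples c e)"
  by (simp add: set_index_tuples[symmetric])

lemma length_index_tuples: "length (index_tuples c e) = c ^ e"
  by (induction e) (simp_all add: index_tuples_Suc length_concat comp_def sum_list_triv del: upt_Suc, simp add: index_tuples_def)

lemma card_tuples: "card (tuples c e) = c ^ e"
  using distinct_card[OF distinct_index_tuples[of c e]] by (simp add: set_index_tuples length_index_tuples)

lemma list_all2_concat_map:
  "(\<And>x. x \<in> set xs \<Longrightarrow> list_all2 P (f x) (g x)) \<Longrightarrow> list_all2 P (concat (map f xs)) (concat (map g xs))"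
  by (induction xs) (auto intro: list_all2_appendI)

definition tuple_built :: "tower \<Rightarrow> nat list \<Rightarrow> column \<Rightarrow> bool" where
  "tuple_built W J D \<longleftrightarrow> built (col_width D) {} (map Some (map (\<lambda>i. W ! (i - 1)) J)) (col_ends D)"

text \<open>Induction over the number \<open>m\<close> of stacked slices. The tower so far has
  \<open>c ^ m\<close> columns of width \<open>w / (e * c ^ (m - 1))\<close>, hence total width
  \<open>c * w / e\<close>, the same as the next slice; this is what
  \<open>ind_stack_uniform\<close> asks for.\<close>

lemma Ind_aux:
  fixes W :: tower and e :: nat
  assumes W: "uniform_tower w h W" and e: "1 \<le> e"
  defines "c \<equiv> length W" and "P \<equiv> (\<lambda>j. map (\<lambda>C. equal_subcolumn C e j) W)"
  assumes m: "1 \<le> m" "m \<le> e"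
  defines "V \<equiv> foldl ind_stack (P 0) (map P [1..<m])"
  shows "uniform_tower (w / (real e * real c ^ (m - 1))) (m * h) V \<and> length V = c ^ m
     \<and> (\<forall>x. occ V x = (\<Sum>j<m. occ (P j) x)) \<and> list_all2 (tuple_built W) (index_tuples c m) V"
proof -
  have c: "0 < c" using W by (auto simp: uniform_tower_def c_def)
  have P: "uniform_tower (w / real e) h (P j)" "length (P j) = c" for j
    using W e by (auto simp: P_def uniform_tower_def equal_subcolumn_def c_def)
  have PB: "built (w / real e) {} [Some (W ! k)] (col_ends (P j ! k))" if "k < c" "j < e" for j k
  proof -
    have w: "0 < w" "col_width (W ! k) = w" using W that by (auto simp: uniform_tower_def c_def)
    have "real j * (w / real e) + w / real e = (real j + 1) * w / real e"
      by (simp add: add_divide_distrib distrib_right)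
    also have "\<dots> \<le> real e * w / real e" using w that e by (intro divide_right_mono mult_right_mono) auto
    also have "\<dots> = w" using e by simp
    finally have "real j * (w / real e) + w / real e \<le> w" .
    then have "built (w / real e) {} [Some (W ! k)] (map (\<lambda>a. a + real j * (w / real e)) (col_ends (W ! k)))"
      using w by (intro built_single) auto
    then show ?thesis using that w by (simp add: P_def equal_subcolumn_def c_def subcolumn_def)
  qed
  show ?thesis
    unfolding V_def using m
  proof (induction m rule: nat_induct_at_least)
    case base
    have "list_all2 (tuple_built W) (index_tuples c 1) (P 0)"
      using PB[of _ 0] P(2)[of 0] P(1)[of 0] e
      by (auto simp: index_tuples_def list_all2_conv_all_nth tuple_built_def uniform_tower_def
          comp_def simp del: upt_Suc)
    then show ?case using P by simp
  next
    case (Suc m)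
    note step = Suc
    let ?V = "foldl ind_stack (P 0) (map P [1..<m])"
    let ?v1 = "w / (real e * real c ^ (m - 1))"
    have IH: "uniform_tower ?v1 (m * h) ?V" "length ?V = c ^ m"
      "\<And>x. occ ?V x = (\<Sum>j<m. occ (P j) x)" "list_all2 (tuple_built W) (index_tuples c m) ?V"
      using step by auto
    have V': "foldl ind_stack (P 0) (map P [1..<Suc m]) = ind_stack ?V (P m)" using step by simp
    have cm: "real c ^ m = real c * real c ^ (m - 1)"
      using step by (simp add: power_eq_if)
    have eq: "real (length ?V) * ?v1 = real (length (P m)) * (w / real e)"
      unfolding IH(2) P(2) using c by (simp add: cm)
    have v: "?v1 / real (length (P m)) = w / (real e * real c ^ (Suc m - 1))"
      using c by (simp add: P cm)
    let ?v = "w / (real e * real c ^ (Suc m - 1))"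
    have ub: "uniform_tower ?v (Suc m * h) (ind_stack ?V (P m))"
      using uniform_ind_stack[OF IH(1) P(1)[of m] eq] unfolding v by (simp add: add.commute)
    moreover have "length (ind_stack ?V (P m)) = c ^ Suc m"
      unfolding length_ind_stack[OF IH(1) P(1)[of m] eq] IH(2) P(2) by simp
    moreover have "occ (ind_stack ?V (P m)) x = (\<Sum>j<Suc m. occ (P j) x)" for x
      unfolding occ_ind_stack[OF IH(1) P(1)[of m] eq] IH(3) by simp
    moreover have "list_all2 (tuple_built W) (index_tuples c (Suc m)) (ind_stack ?V (P m))"
    proof -
      \<comment> \<open>Puts the tuples in the nested order of the two loops in
        \<open>ind_stack\<close>.\<close>
      have it: "index_tuples c (Suc m) = concat (map (\<lambda>i. map (\<lambda>k. index_tuples c m ! i @ [Suc k]) [0..<c]) [0..<c ^ m])"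
      proof -
        have "map (\<lambda>J. map (\<lambda>i. J @ [i]) [1..<Suc c]) (index_tuples c m)
          = map (\<lambda>i. map (\<lambda>k. index_tuples c m ! i @ [Suc k]) [0..<c]) [0..<c ^ m]"
          by (rule nth_equalityI) (auto simp: length_index_tuples map_Suc_upt[symmetric] simp del: upt_Suc map_Suc_upt)
        then show ?thesis unfolding index_tuples_Suc by (simp only:)
      qed
      have vs: "0 < ?v" using ub by (simp add: uniform_tower_def)
      have w0: "0 < w" using W by (auto simp: uniform_tower_def)
      have bound: "real i * ?v + ?v \<le> real N * ?v" if "i < N" for i N
      proof -
        have "real i * ?v + ?v = (real i + 1) * ?v" by (simp only: distrib_right mult_1)
        also have "\<dots> \<le> real N * ?v" using that vs by (intro mult_right_mono) auto
        finally show ?thesis .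
      qed
      show ?thesis
        unfolding it ind_stack_uniform[OF IH(1) P(1)[of m] eq] IH(2) P(2) v[unfolded P(2)]
      proof (rule list_all2_concat_map, rule list_all2_all_nthI, simp)
        fix i k assume i: "i \<in> set [0..<c ^ m]" and "k < length (map (\<lambda>k. index_tuples c m ! i @ [Suc k]) [0..<c])"
        then have k: "k < c" by simp
        have "tuple_built W (index_tuples c m ! i) (?V ! i)"
          using list_all2_nthD[OF IH(4), of i] i by (simp add: length_index_tuples)
        moreover have "col_width (?V ! i) = ?v1" using IH(1) i IH(2) by (auto simp: uniform_tower_def)
        ultimately have b1: "built ?v1 {} (map Some (map (\<lambda>i. W ! (i - 1)) (index_tuples c m ! i))) (col_ends (?V ! i))"
          by (simp add: tuple_built_def)
        have "?v1 = real c * ?v" using c by (simp add: cm)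
        then have "built ?v {} (map Some (map (\<lambda>i. W ! (i - 1)) (index_tuples c m ! i)))
             (map (\<lambda>a. a + real k * ?v) (col_ends (?V ! i)))"
          using bound[of k c] k vs w0 by (intro built_shift[OF b1]) auto
        moreover have "w / real e = real (c ^ m) * ?v" using c by simp
        then have "built ?v {} [Some (W ! k)] (map (\<lambda>a. a + real i * ?v) (col_ends (P m ! k)))"
          using bound[of i "c ^ m"] i vs w0 k step
          by (intro built_shift[OF PB[of k m]]) auto
        ultimately have "built ?v {} (map Some (map (\<lambda>i. W ! (i - 1)) (index_tuples c m ! i)) @ [Some (W ! k)])
          (map (\<lambda>a. a + real k * ?v) (col_ends (?V ! i)) @ map (\<lambda>a. a + real i * ?v) (col_ends (P m ! k)))"
          by (rule built_append)
        then show "tuple_built W (map (\<lambda>k. index_tuples c m ! i @ [Suc k]) [0..<c] ! k)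
           (map (\<lambda>k. stack (subcolumn (?V ! i) (real k * ?v) ?v) (subcolumn (P m ! k) (real i * ?v) ?v)) [0..<c] ! k)"
          using k by (simp add: tuple_built_def subcolumn_def)
      qed
    qed
    ultimately show ?case unfolding V' by blast
  qed
qed

lemma occ_equal_subcolumns:
  assumes W: "uniform_tower w h W" and e: "1 \<le> e"
  shows "(\<Sum>j<e. occ (map (\<lambda>C. equal_subcolumn C e j) W) x) = occ W x"
proof -
  have "(\<Sum>j<e. occ (map (\<lambda>C. equal_subcolumn C e j) W) x)
      = (\<Sum>i<length W. \<Sum>j<e. col_occ (equal_subcolumn (W ! i) e j) x)"
    by (subst sum.swap) (simp add: occ_conv_nth)
  also have "\<dots> = (\<Sum>i<length W. col_occ (W ! i) x)"
  proof (rule sum.cong[OF refl])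
    fix i assume i: "i \<in> {..<length W}"
    then have "col_width (W ! i) = w" "0 < w" using W by (auto simp: uniform_tower_def)
    then show "(\<Sum>j<e. col_occ (equal_subcolumn (W ! i) e j) x) = col_occ (W ! i) x"
      using e unfolding equal_subcolumn_def by (intro sum_col_occ_subcolumn) auto
  qed
  finally show ?thesis by (simp add: occ_conv_nth)
qed

lemma
  assumes W: "uniform_tower w h W" and e: "1 \<le> e"
  shows uniform_Ind: "uniform_tower (w / (real e * real (length W) ^ (e - 1))) (e * h) (Ind W e)"
    and length_Ind: "length (Ind W e) = length W ^ e"
    and occ_Ind: "occ (Ind W e) x = occ W x"
    and Ind_built: "list_all2 (tuple_built W) (index_tuples (length W) e) (Ind W e)"
proof -
  have "[0..<e] = 0 # [1..<e]" using e by (simp add: upt_conv_Cons)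
  then have Ind: "Ind W e = foldl ind_stack (map (\<lambda>C. equal_subcolumn C e 0) W)
      (map (\<lambda>j. map (\<lambda>C. equal_subcolumn C e j) W) [1..<e])"
    by (simp add: Ind_def fold_nonempty_def)
  note * = Ind_aux[OF W e e order_refl, folded Ind]
  show "uniform_tower (w / (real e * real (length W) ^ (e - 1))) (e * h) (Ind W e)"
    "length (Ind W e) = length W ^ e"
    "list_all2 (tuple_built W) (index_tuples (length W) e) (Ind W e)"
    "occ (Ind W e) x = occ W x"
    using * occ_equal_subcolumns[OF W e, of x] by auto
qed

section \<open>One step of the construction, parametrised by index tuples\<close>

text \<open>The case \<open>hs = 0\<close> is separate because \<open>i mod 0 = i\<close>, whereas a
  step without spacers must have offset 0.\<close>

definition off :: "nat \<Rightarrow> nat \<Rightarrow> nat" where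
  "off hs i = (if hs = 0 then 0 else i mod hs)"

definition seg_items :: "tower \<Rightarrow> nat \<Rightarrow> nat \<Rightarrow> nat \<Rightarrow> nat \<Rightarrow> column option list" where
  "seg_items W r hs i i' = replicate (off hs i') None @ replicate r (Some (W ! (i - 1)))
     @ replicate (hs - off hs i') None"

text \<open>The recipe, bottom to top, of the column with index tuple \<open>J\<close>. The tuple
  has \<open>e + 1\<close> entries because segment \<open>k\<close> takes its offset from entry
  \<open>k + 1\<close>.\<close>

definition plan :: "tower \<Rightarrow> nat \<Rightarrow> nat \<Rightarrow> nat \<Rightarrow> nat list \<Rightarrow> column option list" where
  "plan W r hs e J = concat (map (\<lambda>k. seg_items W r hs (J ! k) (J ! Suc k)) [0..<e])"

text \<open>The common form of both kinds of step. As \<open>p\<close> is \<open>\<kappa>\<close> to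
  one, uniform counting on tuples becomes uniform counting on columns. Without spacers the last
  entry is a dummy and \<open>\<kappa>\<close> is the number of columns; with spacers
  \<open>\<kappa> = 1\<close>.\<close>

definition step_rel :: "tower \<Rightarrow> nat \<Rightarrow> nat \<Rightarrow> nat \<Rightarrow> real set \<Rightarrow> tower \<Rightarrow> bool" where
  "step_rel W r e hs Z W' \<longleftrightarrow> (\<exists>p \<kappa>. \<kappa> > 0 \<and> p ` tuples (length W) (Suc e) = set W'
     \<and> (\<forall>D\<in>set W'. card {J\<in>tuples (length W) (Suc e). p J = D} = \<kappa>)
     \<and> (\<forall>J\<in>tuples (length W) (Suc e). built (col_width (p J)) Z (plan W r hs e J) (col_ends (p J))))"

lemma foldl_stack:
  "col_width (foldl stack C Cs) = col_width C"
  "col_ends (foldl stack C Cs) = col_ends C @ concat (map col_ends Cs)"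
  by (induction Cs arbitrary: C) auto

definition rep_col :: "column \<Rightarrow> nat \<Rightarrow> column" where
  "rep_col C r = fold_nonempty stack (map (equal_subcolumn C r) [0..<r])"

lemma
  assumes "1 \<le> r"
  shows col_width_rep_col: "col_width (rep_col C r) = col_width C / real r"
    and col_ends_rep_col: "col_ends (rep_col C r) = concat (map (\<lambda>j. col_ends (equal_subcolumn C r j)) [0..<r])"
proof -
  have r: "[0..<r] = 0 # [1..<r]" using assms by (simp add: upt_conv_Cons)
  show "col_width (rep_col C r) = col_width C / real r"
    "col_ends (rep_col C r) = concat (map (\<lambda>j. col_ends (equal_subcolumn C r j)) [0..<r])"
    unfolding rep_col_def fold_nonempty_def r
    by (simp_all add: foldl_stack equal_subcolumn_def comp_def)
qed

lemma built_equal_subcolumn: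
  assumes "0 < col_width C" "j < r"
  shows "built (col_width C / real r) Z [Some C] (col_ends (equal_subcolumn C r j))"
proof -
  have "real j * (col_width C / real r) + col_width C / real r = (real j + 1) * col_width C / real r"
    by (simp add: add_divide_distrib distrib_right)
  also have "\<dots> \<le> real r * col_width C / real r" using assms by (intro divide_right_mono mult_right_mono) auto
  finally have "real j * (col_width C / real r) + col_width C / real r \<le> col_width C" using assms by simp
  then show ?thesis
    using assms by (auto simp: equal_subcolumn_def subcolumn_def intro!: built_single)
qed

lemma built_rep_col:
  assumes "1 \<le> r" "0 < col_width C"
  shows "built (col_width C / real r) Z (replicate r (Some C)) (col_ends (rep_col C r))"
proof -
  have "built (col_width C / real r) Z (concat (map (\<lambda>j. [Some C]) [0..<r]))
      (concat (map (\<lambda>j. col_ends (equal_subcolumn C r j)) [0..<r]))"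
    using assms by (intro built_concat built_equal_subcolumn) auto
  moreover have "concat (map (\<lambda>j. [Some C]) [0..<r]) = replicate r (Some C)"
    by (simp add: map_replicate_const concat_map_singleton)
  ultimately show ?thesis using assms by (simp add: col_ends_rep_col)
qed

lemma col_occ_rep_col:
  assumes "1 \<le> r" "0 < col_width C"
  shows "col_occ (rep_col C r) x = col_occ C x"
proof -
  have "col_occ (rep_col C r) x = (\<Sum>j<r. col_occ (equal_subcolumn C r j) x)"
    using assms(1) unfolding col_occ_def
    by (simp add: col_ends_rep_col col_width_rep_col sum_list_concat_map equal_subcolumn_def
        interv_sum_list_conv_sum_set_nat atLeast0LessThan)
  also have "\<dots> = col_occ C x"
    using assms unfolding equal_subcolumn_def by (intro sum_col_occ_subcolumn) auto
  finally show ?thesis .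
qed

lemma col_height_rep_col: "1 \<le> r \<Longrightarrow> col_height (rep_col C r) = r * col_height C"
  by (simp add: col_ends_rep_col length_concat comp_def equal_subcolumn_def sum_list_triv)

lemma Rep_conv: "Rep W r = map (\<lambda>C. rep_col C r) W"
  by (simp add: Rep_def rep_col_def)

text \<open>Lets stage 0, whose tower is not repeated, share the form of the later stages, with one
  copy.\<close>

lemma Rep_1 [simp]: "Rep W 1 = W"
proof -
  have "rep_col C 1 = C" for C
    by (cases C) (simp add: rep_col_def fold_nonempty_def equal_subcolumn_def subcolumn_def)
  then show ?thesis by (simp add: Rep_conv)
qed

lemma uniform_Rep:
  "uniform_tower v h W \<Longrightarrow> 1 \<le> r \<Longrightarrow> uniform_tower (v / real r) (r * h) (Rep W r)"
  by (auto simp: uniform_tower_def Rep_conv col_width_rep_col col_height_rep_col)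

lemma occ_Rep: "uniform_tower v h W \<Longrightarrow> 1 \<le> r \<Longrightarrow> occ (Rep W r) x = occ W x"
  unfolding occ_def Rep_conv
  by (auto simp: uniform_tower_def comp_def col_occ_rep_col intro!: arg_cong[where f=sum_list])

lemma built_Rep_nth:
  assumes "uniform_tower v h W" "1 \<le> r" "i \<in> {1..length W}"
  shows "built (col_width (Rep W r ! (i - 1))) Z (replicate r (Some (W ! (i - 1)))) (col_ends (Rep W r ! (i - 1)))"
proof -
  have i: "i - 1 < length W" using assms(3) by auto
  then have "0 < col_width (W ! (i - 1))" using assms(1) by (auto simp: uniform_tower_def)
  then show ?thesis using built_rep_col[OF assms(2)] i assms(2) by (simp add: Rep_conv col_width_rep_col)
qed

text \<open>The towers are given only up to reordering, so a correspondence by position is replaced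
  by a bijection between sets.\<close>

lemma obtain_enumeration:
  assumes "list_all2 R Js V" "distinct Js" "distinct V"
  obtains p where "bij_betw p (set Js) (set V)" "\<And>J. J \<in> set Js \<Longrightarrow> R J (p J)"
proof -
  define p where "p J = V ! (THE i. i < length Js \<and> Js ! i = J)" for J
  have p: "p (Js ! i) = V ! i" if "i < length Js" for i
    unfolding p_def using assms(2) that
    by (intro arg_cong[where f="(!) V"] the_equality) (auto simp: nth_eq_iff_index_eq)
  have len: "length V = length Js" using assms(1) by (simp add: list_all2_lengthD)
  have "inj_on p (set Js)"
    using assms(2,3) by (auto simp: inj_on_def in_set_conv_nth p len nth_eq_iff_index_eq)
  moreover have "p ` set Js = set V"
    by (auto simp: set_conv_nth len p image_def)
  moreover have "R J (p J)" if "J \<in> set Js" for J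
    using that assms(1) by (auto simp: in_set_conv_nth p list_all2_conv_all_nth)
  ultimately show ?thesis using that by (simp add: bij_betw_def)
qed

lemma occ_mset: "mset V = mset W \<Longrightarrow> occ V x = occ W x"
  unfolding occ_def by (metis mset_map sum_mset_sum_list)

lemma uniform_tower_mset: "mset V = mset W \<Longrightarrow> uniform_tower v h W \<Longrightarrow> uniform_tower v h V"
  unfolding uniform_tower_def using mset_eq_setD[of V W] by auto

lemma tuples_butlast: "J \<in> tuples c (Suc e) \<Longrightarrow> butlast J \<in> tuples c e"
  by (auto simp: tuples_def dest: in_set_butlastD)

lemma tuples_butlast_fiber: "I \<in> tuples c e \<Longrightarrow> {J\<in>tuples c (Suc e). butlast J = I} = (\<lambda>i. I @ [i]) ` {1..c}"
proof (intro set_eqI iffI)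
  fix J assume "J \<in> {J\<in>tuples c (Suc e). butlast J = I}"
  then have J: "length J = Suc e" "set J \<subseteq> {1..c}" "butlast J = I" by (auto simp: tuples_def)
  then have "J = I @ [last J]" using append_butlast_last_id[of J] by (cases J) auto
  moreover have "last J \<in> {1..c}" using J last_in_set[of J] by (cases J) auto
  ultimately show "J \<in> (\<lambda>i. I @ [i]) ` {1..c}" by blast
qed (auto simp: tuples_def)

lemma map_nth_butlast: "length J = Suc e \<Longrightarrow> map (\<lambda>k. f (J ! k)) [0..<e] = map f (butlast J)"
  by (intro nth_equalityI) (auto simp: nth_butlast)

text \<open>Since \<open>occ \<le> 1\<close> makes the columns distinct, indexing by tuples of
  length \<open>e\<close> is a bijection. Forgetting the last entry of a longer tuple makes every
  fibre have \<open>length W\<close> elements.\<close>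

lemma Ind_step:
  assumes W: "uniform_tower v h W" "\<And>x. occ W x \<le> 1" and "0 < h" "1 \<le> r" "1 \<le> e"
    and W': "mset W' = mset (Ind (Rep W r) e)"
  shows "\<exists>v'. uniform_tower v' (e * (r * h)) W' \<and> real (length W') * v' = real (length W) * v / real (r * e)
    \<and> length W' = length W ^ e \<and> (\<forall>x. occ W' x = occ W x) \<and> step_rel W r e 0 Z W'"
proof -
  let ?c = "length W"
  let ?Wt = "Rep W r"
  have c: "0 < ?c" "length ?Wt = ?c" using W by (auto simp: uniform_tower_def Rep_conv)
  note Wt = uniform_Rep[OF W(1) \<open>1 \<le> r\<close>]
  note I = uniform_Ind[OF Wt \<open>1 \<le> e\<close>] length_Ind[OF Wt \<open>1 \<le> e\<close>] occ_Ind[OF Wt \<open>1 \<le> e\<close>] Ind_built[OF Wt \<open>1 \<le> e\<close>]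
  let ?v = "v / real r / (real e * real ?c ^ (e - 1))"
  have u: "uniform_tower ?v (e * (r * h)) W'" using uniform_tower_mset[OF W' I(1)] c by simp
  have len: "length W' = ?c ^ e" using mset_eq_length[OF W'] I(2) c by simp
  have o: "occ W' x = occ W x" for x
    using occ_mset[OF W'] I(3) occ_Rep[OF W(1) \<open>1 \<le> r\<close>] by simp
  have "real (length W') * ?v = real ?c * v / real (r * e)"
    using c \<open>1 \<le> r\<close> \<open>1 \<le> e\<close> unfolding len by (simp add: power_eq_if[of _ e] field_simps)
  moreover have "step_rel W r e 0 Z W'"
  proof -
    have "distinct (Ind ?Wt e)"
      using \<open>1 \<le> e\<close> \<open>1 \<le> r\<close> \<open>0 < h\<close> W(2) occ_Rep[OF W(1) \<open>1 \<le> r\<close>] I(3)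
      by (intro occ_le_1_distinct[OF I(1)]) auto
    from obtain_enumeration[OF I(4) distinct_index_tuples this]
    obtain p where p: "bij_betw p (tuples ?c e) (set (Ind ?Wt e))"
      "\<And>J. J \<in> tuples ?c e \<Longrightarrow> tuple_built ?Wt J (p J)"
      using c by (metis set_index_tuples)
    have sW': "set W' = set (Ind ?Wt e)" using mset_eq_setD[OF W'] .
    have img: "(\<lambda>J. p (butlast J)) ` tuples ?c (Suc e) = set W'"
    proof -
      have "butlast ` tuples ?c (Suc e) = tuples ?c e"
      proof (intro set_eqI iffI)
        fix I assume I: "I \<in> tuples ?c e"
        then have "{J\<in>tuples ?c (Suc e). butlast J = I} \<noteq> {}"
          using c(1) by (subst tuples_butlast_fiber) (auto simp: Suc_le_eq)
        then show "I \<in> butlast ` tuples ?c (Suc e)" by blast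
      qed (auto intro: tuples_butlast)
      then show ?thesis using p(1) by (simp add: sW' bij_betw_def image_image[symmetric])
    qed
    have fib: "card {J\<in>tuples ?c (Suc e). p (butlast J) = D} = ?c" if D: "D \<in> set W'" for D
    proof -
      have "D \<in> p ` tuples ?c e" using D p(1) by (simp add: sW' bij_betw_def)
      then obtain I where I: "I \<in> tuples ?c e" "p I = D" by blast
      have "{J\<in>tuples ?c (Suc e). p (butlast J) = D} = {J\<in>tuples ?c (Suc e). butlast J = I}"
        using I p(1) tuples_butlast[of _ ?c e] by (auto simp: bij_betw_def inj_on_def)
      then show ?thesis
        by (simp add: tuples_butlast_fiber[OF I(1)] card_image inj_on_def)
    qed
    have bu: "built (col_width (p (butlast J))) Z (plan W r 0 e J) (col_ends (p (butlast J)))"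
      if J: "J \<in> tuples ?c (Suc e)" for J
    proof -
      have Jl: "length J = Suc e" "set (butlast J) \<subseteq> {1..?c}"
        using J tuples_butlast[OF J] by (auto simp: tuples_def)
      have "built (col_width (p (butlast J))) Z (map Some (map (\<lambda>i. ?Wt ! (i - 1)) (butlast J)))
          (col_ends (p (butlast J)))"
        using p(2)[OF tuples_butlast[OF J]] unfolding tuple_built_def by (rule built_mono) simp
      then have "built (col_width (p (butlast J))) Z
          (concat (map (\<lambda>i. replicate r (Some (W ! (i - 1)))) (butlast J))) (col_ends (p (butlast J)))"
        by (rule built_trans) (use built_Rep_nth[OF W(1) \<open>1 \<le> r\<close>] Jl in blast)
      moreover have "plan W r 0 e J = concat (map (\<lambda>i. replicate r (Some (W ! (i - 1)))) (butlast J))"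
        unfolding plan_def seg_items_def off_def
        using map_nth_butlast[OF Jl(1), of "\<lambda>i. replicate r (Some (W ! (i - 1)))"] by simp
      ultimately show ?thesis by simp
    qed
    show ?thesis unfolding step_rel_def using c(1) img fib bu by blast
  qed
  ultimately show ?thesis using u len o by blast
qed

lemma concat_take_drop:
  "concat (map (\<lambda>k. take H (drop (k * H) E)) [0..<e]) = take (e * H) E"
  by (induction e) (auto simp: take_add[symmetric] add.commute)

lemma sum_indicator_disjoint_le_1:
  assumes "finite A" "disjoint_family_on S A"
  shows "(\<Sum>a\<in>A. of_bool (x \<in> S a) :: nat) \<le> 1"
proof -
  have "(\<Sum>a\<in>A. of_bool (x \<in> S a) :: nat) = card {a\<in>A. x \<in> S a}"
    using assms(1) by (simp add: of_bool_def sum.If_cases Int_def)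
  also have "\<dots> \<le> 1"
    using assms by (subst One_nat_def, subst card_le_Suc0_iff_eq) (auto simp: disjoint_family_on_def)
  finally show ?thesis .
qed

lemma sum_of_bool_pos:
  assumes "0 < (\<Sum>a\<in>A. of_bool (P a) :: nat)"
  shows "\<exists>a\<in>A. P a"
proof (rule ccontr)
  assume "\<not> (\<exists>a\<in>A. P a)"
  then have "(\<Sum>a\<in>A. of_bool (P a) :: nat) = 0" by (intro sum.neutral) auto
  then show False using assms by simp
qed

text \<open>Compared with the step without spacers, occupation counts grow by the new spacers. These
  are pairwise disjoint and avoid the old levels, so the counts stay at most 1. Of their position
  only this is remembered: they lie in \<open>{0..<1}\<close> outside the old levels.\<close>

lemma Inds_step:
  assumes W: "uniform_tower v h W" "\<And>x. occ W x \<le> 1" and "0 < h" "1 \<le> r" "1 \<le> e" "1 \<le> hs"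
    and is_Inds: "is_Inds Ps (Rep W r) e hs V" and W': "mset W' = mset V" and Ps: "Ps \<subseteq> {0..<1}"
  shows "\<exists>v'. uniform_tower v' (e * (r * h + hs)) W'
    \<and> real (length W') * v' = real (length W) * v / real (r * e)
    \<and> length W' = length W ^ Suc e \<and> (\<forall>x. occ W x \<le> occ W' x \<and> occ W' x \<le> 1)
    \<and> step_rel W r e hs ({0..<1} - \<Union>(tower_levels W)) W'"
proof -
  let ?c = "length W"
  let ?Wt = "Rep W r"
  let ?Z = "{0..<1} - \<Union>(tower_levels W)"
  have c: "0 < ?c" "length ?Wt = ?c" using W by (auto simp: uniform_tower_def Rep_conv)
  note Wt = uniform_Rep[OF W(1) \<open>1 \<le> r\<close>]
  note I = uniform_Ind[OF Wt \<open>1 \<le> e\<close>] length_Ind[OF Wt \<open>1 \<le> e\<close>] occ_Ind[OF Wt \<open>1 \<le> e\<close>] Ind_built[OF Wt \<open>1 \<le> e\<close>]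
  let ?u = "v / real r / (real e * real ?c ^ (e - 1))"
  let ?v = "?u / real ?c"
  let ?H = "r * h"
  have v00: "0 < ?u" using I(1)[unfolded c(2)] unfolding uniform_tower_def by blast
  moreover have "0 < ?v" by (rule divide_pos_pos[OF v00]) (use c in simp)
  ultimately have v0: "0 < ?u" "0 < ?v" by blast+
  obtain sp where sp: "V = Inds_with sp ?Wt e hs"
    and disj: "disjoint_family_on (\<lambda>(I, B, k, q). {sp I k q ..< sp I k q + col_width B})
       {(I, B, k, q). (I, B) \<in> set (zip (index_tuples ?c (Suc e)) V) \<and> k < e \<and> q < hs}"
    and sub: "\<And>I B k q. (I, B) \<in> set (zip (index_tuples ?c (Suc e)) V) \<Longrightarrow> k < e \<Longrightarrow> q < hs
        \<Longrightarrow> {sp I k q ..< sp I k q + col_width B} \<subseteq> Ps - \<Union>(tower_levels ?Wt)"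
    using is_Inds c(2) unfolding is_Inds_def Let_def by auto
  have Hh: "tower_height ?Wt = ?H"
    using Wt unfolding tower_height_def uniform_tower_def by simp
  define ins where "ins J D j = insert_spacers sp e hs ?H (J @ [j]) (equal_subcolumn D ?c (j - 1))" for J D j
  let ?Js = "index_tuples ?c e" and ?Is = "Ind ?Wt e"
  \<comment> \<open>Pairs of an index tuple and its column; \<open>V\<close> and the list of index
    tuples are the two projections.\<close>
  define L where "L = concat (map (\<lambda>(J, D). map (\<lambda>j. (J @ [j], ins J D j)) [1..<Suc ?c]) (zip ?Js ?Is))"
  have lenJI: "length ?Js = length ?Is" using I(2) c by (simp add: length_index_tuples)
  have V: "V = map snd L"
    unfolding sp Inds_with_def Let_def L_def Hh c(2) map_concat ins_def
    by (simp add: comp_def case_prod_beta' del: upt_Suc)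
  have JS: "index_tuples ?c (Suc e) = map fst L"
  proof -
    have "map fst L = concat (map ((\<lambda>J. map (\<lambda>i. J @ [i]) [1..<Suc ?c]) \<circ> fst) (zip ?Js ?Is))"
      unfolding L_def map_concat by (simp add: comp_def case_prod_beta' del: upt_Suc)
    also have "\<dots> = concat (map (\<lambda>J. map (\<lambda>i. J @ [i]) [1..<Suc ?c]) (map fst (zip ?Js ?Is)))"
      by (simp del: upt_Suc)
    also have "\<dots> = index_tuples ?c (Suc e)"
      unfolding index_tuples_Suc map_fst_zip[OF lenJI] ..
    finally show ?thesis by simp
  qed
  have zipL: "zip (index_tuples ?c (Suc e)) V = L" unfolding V JS by (rule zip_map_fst_snd)
  have D: "col_width D = ?u" "col_height D = e * ?H" if "D \<in> set ?Is" for D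
    using I(1) c that by (auto simp: uniform_tower_def)
  have wB: "col_width (ins J D j) = ?v" if "D \<in> set ?Is" for J D j
    using D[OF that] by (simp add: ins_def insert_spacers_def equal_subcolumn_def)
  have inL: "(J @ [j], ins J D j) \<in> set L" if "(J, D) \<in> set (zip ?Js ?Is)" "j \<in> {1..?c}" for J D j
  proof -
    have "(J @ [j], ins J D j) \<in> set ((\<lambda>(J, D). map (\<lambda>j. (J @ [j], ins J D j)) [1..<Suc ?c]) (J, D))"
      using that(2) by (simp del: upt_Suc)
    then show ?thesis using that(1) unfolding L_def set_concat set_map by blast
  qed
  have Linv: "\<exists>J D j. (J, D) \<in> set (zip ?Js ?Is) \<and> j \<in> {1..?c} \<and> I = J @ [j] \<and> B = ins J D j"
    if IB: "(I, B) \<in> set L" for I B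
  proof -
    obtain p where p: "p \<in> set (zip ?Js ?Is)"
      "(I, B) \<in> set ((\<lambda>(J, D). map (\<lambda>j. (J @ [j], ins J D j)) [1..<Suc ?c]) p)"
      using IB unfolding L_def set_concat set_map by blast
    obtain J D where JD: "p = (J, D)" by (cases p)
    have "\<exists>j\<in>{1..?c}. I = J @ [j] \<and> B = ins J D j"
      using p(2) unfolding JD by (auto simp del: upt_Suc)
    then show ?thesis using p(1) unfolding JD by blast
  qed
  have spZ: "{sp (J @ [j]) k q ..< sp (J @ [j]) k q + ?v} \<subseteq> ?Z"
    if "(J, D) \<in> set (zip ?Js ?Is)" "j \<in> {1..?c}" "k < e" "q < hs" for J D j k q
  proof -
    have lv: "\<Union>(tower_levels ?Wt) = \<Union>(tower_levels W)"
      unfolding set_eq_iff occ_pos_iff[symmetric] occ_Rep[OF W(1) \<open>1 \<le> r\<close>] by blast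
    have D: "D \<in> set ?Is" using that(1) by (rule set_zip_rightD)
    have "{sp (J @ [j]) k q ..< sp (J @ [j]) k q + col_width (ins J D j)} \<subseteq> Ps - \<Union>(tower_levels ?Wt)"
      by (rule sub) (use inL[OF that(1,2)] that(3,4) zipL in simp_all)
    then show ?thesis using Ps unfolding lv wB[OF D] by blast
  qed
  have tup: "J \<in> tuples ?c e" "tuple_built ?Wt J D" "D \<in> set ?Is" if "(J, D) \<in> set (zip ?Js ?Is)" for J D
  proof -
    show "J \<in> tuples ?c e" using set_zip_leftD[OF that] by (simp add: set_index_tuples)
    show "tuple_built ?Wt J D" using I(4) that c by (auto simp: list_all2_iff)
    show "D \<in> set ?Is" using that by (rule set_zip_rightD)
  qed
  have built_ins: "built (col_width (ins J D j)) ?Z (plan W r hs e (J @ [j])) (col_ends (ins J D j))"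
    if JD: "(J, D) \<in> set (zip ?Js ?Is)" and j: "j \<in> {1..?c}" for J D j
  proof -
    let ?I = "J @ [j]"
    let ?B = "equal_subcolumn D ?c (j - 1)"
    have J: "length J = e" "set J \<subseteq> {1..?c}" using tup(1)[OF JD] by (auto simp: tuples_def)
    have bD: "built ?v ?Z [Some D] (col_ends ?B)"
      using built_equal_subcolumn[of D "j - 1" ?c ?Z] v0 D(1)[OF tup(3)[OF JD]] j by auto
    have "built ?v ?Z (concat (map (\<lambda>D. map Some (map (\<lambda>i. ?Wt ! (i - 1)) J)) [D])) (col_ends ?B)"
    proof (rule built_trans[where g = "\<lambda>D. D"])
      show "built ?v ?Z (map Some (map (\<lambda>D. D) [D])) (col_ends ?B)" using bD by simp
      fix D' assume "D' \<in> set [D]"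
      then have "D' = D" by simp
      then show "built (col_width D') ?Z (map Some (map (\<lambda>i. ?Wt ! (i - 1)) J)) (col_ends D')"
        using built_mono[OF tup(2)[OF JD, unfolded tuple_built_def], of ?Z] by simp
    qed
    then have bB: "built ?v ?Z (map Some (map (\<lambda>i. ?Wt ! (i - 1)) J)) (col_ends ?B)" by simp
    have seg: "built ?v ?Z (seg_items W r hs (?I ! k) (?I ! Suc k))
      (map (sp ?I k) [0..<(?I ! Suc k) mod hs] @ take ?H (drop (k * ?H) (col_ends ?B))
                        @ map (sp ?I k) [(?I ! Suc k) mod hs..<hs])" if k: "k < e" for k
    proof -
      have off: "off hs (?I ! Suc k) = (?I ! Suc k) mod hs" "(?I ! Suc k) mod hs < hs"
        using \<open>1 \<le> hs\<close> by (auto simp: off_def)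
      have spacers: "built ?v ?Z (replicate (b - a) None) (map (sp ?I k) [a..<b])" if "b \<le> hs" for a b
      proof -
        have "built ?v ?Z (concat (map (\<lambda>q. [None]) [a..<b])) (concat (map (\<lambda>q. [sp ?I k q]) [a..<b]))"
          using spZ[OF JD j k] that by (intro built_concat built.None built.Nil) auto
        moreover have "concat (map (\<lambda>q. [None :: column option]) [a..<b]) = replicate (b - a) None"
          by (simp add: concat_map_singleton map_replicate_const)
        ultimately show ?thesis by (simp add: concat_map_singleton)
      qed
      have hgt: "col_height C = ?H" if CJ: "C \<in> set (map (\<lambda>i. ?Wt ! (i - 1)) J)" for C
      proof -
        obtain i where "i \<in> {1..?c}" "C = ?Wt ! (i - 1)" using CJ J(2) by auto
        then have "C \<in> set ?Wt" using c(2) by (auto intro!: nth_mem)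
        then show ?thesis using Wt by (auto simp: uniform_tower_def)
      qed
      have "built ?v ?Z [Some (map (\<lambda>i. ?Wt ! (i - 1)) J ! k)] (take ?H (drop (k * ?H) (col_ends ?B)))"
        by (rule built_nth[OF bB]) (use k J(1) hgt in auto)
      then have "built ?v ?Z (map Some (map (\<lambda>i. ?Wt ! (i - 1)) [J ! k])) (take ?H (drop (k * ?H) (col_ends ?B)))"
        using k J(1) by simp
      then have "built ?v ?Z (concat (map (\<lambda>i. replicate r (Some (W ! (i - 1)))) [J ! k])) (take ?H (drop (k * ?H) (col_ends ?B)))"
      proof (rule built_trans)
        fix i assume "i \<in> set [J ! k]"
        moreover have "J ! k \<in> set J" using J(1) k by simp
        ultimately have "i \<in> {1..?c}" using J(2) by auto
        show "built (col_width (?Wt ! (i - 1))) ?Z (replicate r (Some (W ! (i - 1)))) (col_ends (?Wt ! (i - 1)))"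
          by (rule built_Rep_nth[OF W(1) \<open>1 \<le> r\<close> \<open>i \<in> {1..?c}\<close>])
      qed
      then have mid: "built ?v ?Z (replicate r (Some (W ! (?I ! k - 1)))) (take ?H (drop (k * ?H) (col_ends ?B)))"
        using k J(1) by (simp add: nth_append)
      show ?thesis
        unfolding seg_items_def off
        using spacers[of "(?I ! Suc k) mod hs" 0] spacers[of hs "(?I ! Suc k) mod hs"] off(2)
        by (intro built_append mid) auto
    qed
    have "built ?v ?Z (plan W r hs e ?I) (col_ends (ins J D j))"
      unfolding plan_def ins_def insert_spacers_def column.sel
      by (rule built_concat) (use seg in auto)
    then show ?thesis using wB[OF tup(3)[OF JD]] by simp
  qed
  have hgt_ins: "col_height (ins J D j) = e * (?H + hs)" if "(J, D) \<in> set (zip ?Js ?Is)" for J D j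
  proof -
    have "length (col_ends (equal_subcolumn D ?c (j - 1))) = e * ?H"
      using D(2)[OF tup(3)[OF that]] by (simp add: equal_subcolumn_def)
    moreover have "?H \<le> e * ?H - k * ?H" if "k < e" for k
    proof -
      have "Suc k * ?H \<le> e * ?H" using that by (intro mult_right_mono) auto
      then show ?thesis by simp
    qed
    moreover have ms: "m mod hs \<le> a + hs" for m a :: nat
      using \<open>1 \<le> hs\<close> by (simp add: less_imp_le trans_le_add2)
    ultimately have "col_height (ins J D j) = (\<Sum>k\<leftarrow>[0..<e]. ?H + hs)"
      unfolding ins_def insert_spacers_def column.sel length_concat map_map
      by (intro arg_cong[where f=sum_list] map_cong refl) (auto simp: ms ms[where a = 0, simplified])
    then show ?thesis by (simp add: sum_list_triv)
  qed
  have lenV: "length V = ?c ^ Suc e"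
    using arg_cong[OF JS, of length] by (simp add: V length_index_tuples)
  have uV: "uniform_tower ?v (e * (?H + hs)) V"
    unfolding uniform_tower_def
  proof (intro conjI ballI)
    show "V \<noteq> []" using lenV c by auto
    show "0 < ?v" by (rule v0)
    fix B assume "B \<in> set V"
    then obtain J D j where "(J, D) \<in> set (zip ?Js ?Is)" "B = ins J D j" using Linv unfolding V by fastforce
    then show "col_width B = ?v" "col_height B = e * (?H + hs)" using wB tup(3) hgt_ins by auto
  qed
  \<comment> \<open>The number of new spacers that contain \<open>x\<close>.\<close>
  let ?S = "\<lambda>x. \<Sum>(I, B)\<leftarrow>L. \<Sum>k<e. \<Sum>q<hs. of_bool (x \<in> {sp I k q..<sp I k q + ?v}) :: nat"
  have occV: "occ V x = occ W x + ?S x" for x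
  proof -
    have col: "col_occ (ins J D j) x = col_occ (equal_subcolumn D ?c (j - 1)) x
        + (\<Sum>k<e. \<Sum>q<hs. of_bool (x \<in> {sp (J @ [j]) k q..<sp (J @ [j]) k q + ?v}))"
      if "(J, D) \<in> set (zip ?Js ?Is)" for J D j
    proof -
      let ?I = "J @ [j]"
      let ?B = "equal_subcolumn D ?c (j - 1)"
      let ?f = "\<lambda>a. of_bool (x \<in> {a..<a + ?v}) :: nat"
      have wB': "col_width ?B = ?v" using D(1)[OF tup(3)[OF that]] by (simp add: equal_subcolumn_def)
      have "length (col_ends ?B) = e * ?H"
        using D(2)[OF tup(3)[OF that]] by (simp add: equal_subcolumn_def)
      then have E: "concat (map (\<lambda>k. take ?H (drop (k * ?H) (col_ends ?B))) [0..<e]) = col_ends ?B"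
        by (simp add: concat_take_drop)
      have spl: "(\<Sum>q\<leftarrow>[0..<m mod hs]. f q) + (\<Sum>q\<leftarrow>[m mod hs..<hs]. f q) = (\<Sum>q<hs. f q)" for m and f :: "nat \<Rightarrow> nat"
        using \<open>1 \<le> hs\<close> sum.atLeastLessThan_concat[of 0 "m mod hs" hs f]
        by (simp add: interv_sum_list_conv_sum_set_nat atLeast0LessThan less_imp_le)
      have spl3: "(\<Sum>q\<leftarrow>[0..<m mod hs]. f q) + X + (\<Sum>q\<leftarrow>[m mod hs..<hs]. f q) = X + (\<Sum>q<hs. f q)"
        for m X and f :: "nat \<Rightarrow> nat"
        using spl[of f m] by simp
      have "col_occ (ins J D j) x = (\<Sum>k\<leftarrow>[0..<e].
          (\<Sum>q\<leftarrow>[0..<(?I ! Suc k) mod hs]. ?f (sp ?I k q))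
          + (\<Sum>a\<leftarrow>take ?H (drop (k * ?H) (col_ends ?B)). ?f a)
          + (\<Sum>q\<leftarrow>[(?I ! Suc k) mod hs..<hs]. ?f (sp ?I k q)))"
        unfolding col_occ_def wB[OF tup(3)[OF that]]
        unfolding ins_def insert_spacers_def column.sel sum_list_concat_map
        by (simp add: comp_def add.assoc)
      also have "\<dots> = (\<Sum>k\<leftarrow>[0..<e]. (\<Sum>a\<leftarrow>take ?H (drop (k * ?H) (col_ends ?B)). ?f a)
          + (\<Sum>q<hs. ?f (sp ?I k q)))"
        by (intro arg_cong[where f=sum_list] map_cong refl) (rule spl3)
      also have "\<dots> = (\<Sum>a\<leftarrow>concat (map (\<lambda>k. take ?H (drop (k * ?H) (col_ends ?B))) [0..<e]). ?f a)
           + (\<Sum>k<e. \<Sum>q<hs. ?f (sp ?I k q))"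
        unfolding sum_list_concat_map
        by (simp add: sum_list_addf interv_sum_list_conv_sum_set_nat atLeast0LessThan sum.distrib)
      finally show ?thesis unfolding E unfolding col_occ_def[of ?B] wB' .
    qed
    have "occ V x = (\<Sum>(J, D)\<leftarrow>zip ?Js ?Is. \<Sum>j\<leftarrow>[1..<Suc ?c]. col_occ (ins J D j) x)"
      unfolding V L_def occ_def map_map sum_list_concat_map
      by (simp add: comp_def case_prod_beta' del: upt_Suc)
    also have "\<dots> = (\<Sum>(J, D)\<leftarrow>zip ?Js ?Is. (\<Sum>j\<leftarrow>[1..<Suc ?c]. col_occ (equal_subcolumn D ?c (j - 1)) x)
       + (\<Sum>j\<leftarrow>[1..<Suc ?c]. \<Sum>k<e. \<Sum>q<hs. of_bool (x \<in> {sp (J @ [j]) k q..<sp (J @ [j]) k q + ?v})))"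
      by (intro arg_cong[where f=sum_list] map_cong refl) (auto simp: col sum_list_addf simp del: upt_Suc)
    also have "\<dots> = (\<Sum>(J, D)\<leftarrow>zip ?Js ?Is. \<Sum>j\<leftarrow>[1..<Suc ?c]. col_occ (equal_subcolumn D ?c (j - 1)) x) + ?S x"
      unfolding L_def sum_list_concat_map by (simp add: case_prod_beta' sum_list_addf comp_def del: upt_Suc)
    also have "(\<Sum>(J, D)\<leftarrow>zip ?Js ?Is. \<Sum>j\<leftarrow>[1..<Suc ?c]. col_occ (equal_subcolumn D ?c (j - 1)) x)
       = (\<Sum>(J, D)\<leftarrow>zip ?Js ?Is. col_occ D x)"
    proof (intro arg_cong[where f=sum_list] map_cong refl, clarify)
      fix J D assume JD: "(J, D) \<in> set (zip ?Js ?Is)"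
      have "(\<Sum>j\<leftarrow>[1..<Suc ?c]. col_occ (equal_subcolumn D ?c (j - 1)) x)
          = (\<Sum>j<?c. col_occ (equal_subcolumn D ?c j) x)"
        by (simp add: map_Suc_upt[symmetric] comp_def interv_sum_list_conv_sum_set_nat atLeast0LessThan
            del: map_Suc_upt upt_Suc)
      also have "\<dots> = col_occ D x"
        using v0 c D(1)[OF tup(3)[OF JD]] unfolding equal_subcolumn_def
        by (intro sum_col_occ_subcolumn) auto
      finally show "(\<Sum>j\<leftarrow>[1..<Suc ?c]. col_occ (equal_subcolumn D ?c (j - 1)) x) = col_occ D x" .
    qed
    also have "\<dots> = (\<Sum>D\<leftarrow>map snd (zip ?Js ?Is). col_occ D x)" by (simp add: comp_def case_prod_beta')
    also have "\<dots> = occ ?Is x" by (simp add: map_snd_zip[OF lenJI] occ_def)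
    also have "\<dots> = occ W x" using I(3) occ_Rep[OF W(1) \<open>1 \<le> r\<close>] by simp
    finally show ?thesis .
  qed
  have S1: "?S x \<le> 1" "0 < ?S x \<Longrightarrow> occ W x = 0" for x
  proof -
    have dL: "distinct L" using distinct_index_tuples[of ?c "Suc e"] unfolding JS by (simp add: distinct_map)
    have "?S x = (\<Sum>p\<in>set L. \<Sum>k<e. \<Sum>q<hs. of_bool (x \<in> {sp (fst p) k q..<sp (fst p) k q + ?v}))"
      using dL by (simp add: sum_list_distinct_conv_sum_set case_prod_beta')
    also have "\<dots> = (\<Sum>p\<in>set L. \<Sum>kq\<in>{..<e} \<times> {..<hs}. of_bool (x \<in> {sp (fst p) (fst kq) (snd kq)..<sp (fst p) (fst kq) (snd kq) + ?v}))"
      by (intro sum.cong refl) (simp only: sum.cartesian_product case_prod_beta')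
    also have "\<dots> = (\<Sum>p\<in>set L \<times> {..<e} \<times> {..<hs}. of_bool (x \<in> {sp (fst (fst p)) (fst (snd p)) (snd (snd p))..<sp (fst (fst p)) (fst (snd p)) (snd (snd p)) + ?v}))"
      by (simp only: sum.cartesian_product case_prod_beta')
    finally have S: "?S x = \<dots>" .
    have wL: "col_width B = ?v" if "(I, B) \<in> set L" for I B
      using Linv[OF that] wB tup(3) by blast
    have "disjoint_family_on (\<lambda>p. {sp (fst (fst p)) (fst (snd p)) (snd (snd p))..<sp (fst (fst p)) (fst (snd p)) (snd (snd p)) + ?v})
        (set L \<times> {..<e} \<times> {..<hs})"
    proof (unfold disjoint_family_on_def, intro ballI impI)
      fix m n assume mn: "m \<in> set L \<times> {..<e} \<times> {..<hs}" "n \<in> set L \<times> {..<e} \<times> {..<hs}" "m \<noteq> n"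
      obtain I B k q where m: "m = ((I, B), k, q)" by (metis surj_pair)
      obtain I' B' k' q' where n: "n = ((I', B'), k', q')" by (metis surj_pair)
      have w: "col_width B = ?v" "col_width B' = ?v" using mn wL unfolding m n by auto
      have "{sp I k q..<sp I k q + col_width B} \<inter> {sp I' k' q'..<sp I' k' q' + col_width B'} = {}"
        using disjoint_family_onD[OF disj, of "(I, B, k, q)" "(I', B', k', q')"] mn
        unfolding m n zipL by auto
      then show "{sp (fst (fst m)) (fst (snd m)) (snd (snd m))..<sp (fst (fst m)) (fst (snd m)) (snd (snd m)) + ?v} \<inter>
           {sp (fst (fst n)) (fst (snd n)) (snd (snd n))..<sp (fst (fst n)) (fst (snd n)) (snd (snd n)) + ?v} = {}"
        unfolding w m n by simp
    qed
    then show "?S x \<le> 1" unfolding S by (intro sum_indicator_disjoint_le_1) auto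
    assume "0 < ?S x"
    then have "\<exists>p\<in>set L \<times> {..<e} \<times> {..<hs}.
       x \<in> {sp (fst (fst p)) (fst (snd p)) (snd (snd p))..<sp (fst (fst p)) (fst (snd p)) (snd (snd p)) + ?v}"
      unfolding S by (rule sum_of_bool_pos)
    then obtain p where pL: "p \<in> set L \<times> {..<e} \<times> {..<hs}"
       "x \<in> {sp (fst (fst p)) (fst (snd p)) (snd (snd p))..<sp (fst (fst p)) (fst (snd p)) (snd (snd p)) + ?v}"
      by blast
    then obtain I B k q where p: "(I, B) \<in> set L" "k < e" "q < hs" "x \<in> {sp I k q..<sp I k q + ?v}"
      by (metis (no_types, lifting) SigmaE fst_conv snd_conv lessThan_iff surj_pair)
    obtain J D j where JD: "(J, D) \<in> set (zip ?Js ?Is)" "j \<in> {1..?c}" "I = J @ [j]" using Linv[OF p(1)] by blast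
    have "x \<notin> \<Union>(tower_levels W)" using spZ[OF JD(1,2) p(2,3)] p(4) unfolding JD(3) by blast
    then show "occ W x = 0" using occ_pos_iff[of W x] by simp
  qed
  have occ1: "occ W x \<le> occ V x \<and> occ V x \<le> 1" for x
  proof (cases "0 < ?S x")
    case True
    show ?thesis unfolding occV S1(2)[OF True] using S1(1)[of x] by linarith
  next
    case False
    then show ?thesis unfolding occV using W(2)[of x] by linarith
  qed
  have dV: "distinct V"
    using \<open>0 < h\<close> \<open>1 \<le> e\<close> \<open>1 \<le> r\<close> occ1 by (intro occ_le_1_distinct[OF uV]) auto
  have l2: "list_all2 (\<lambda>I B. built (col_width B) ?Z (plan W r hs e I) (col_ends B)) (index_tuples ?c (Suc e)) V"
    unfolding list_all2_iff zipL using built_ins Linv lenV by (fastforce simp: length_index_tuples)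
  from obtain_enumeration[OF l2 distinct_index_tuples dV] obtain p where p: "bij_betw p (tuples ?c (Suc e)) (set V)"
      "\<And>J. J \<in> tuples ?c (Suc e) \<Longrightarrow> built (col_width (p J)) ?Z (plan W r hs e J) (col_ends (p J))"
    unfolding set_index_tuples by blast
  have sW': "set W' = set V" using mset_eq_setD[OF W'] .
  have "card {J\<in>tuples ?c (Suc e). p J = D} = 1" if D: "D \<in> set W'" for D
  proof -
    have "D \<in> p ` tuples ?c (Suc e)" using D p(1) by (simp add: sW' bij_betw_def)
    then obtain I where I: "I \<in> tuples ?c (Suc e)" "p I = D" by blast
    have "{J\<in>tuples ?c (Suc e). p J = D} = {I}"
      using I p(1) by (auto simp: bij_betw_def inj_on_def)
    then show ?thesis by simp
  qed
  moreover have "p ` tuples ?c (Suc e) = set W'" using p(1) sW' by (simp add: bij_betw_def)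
  ultimately have "step_rel W r e hs ?Z W'"
    unfolding step_rel_def using p(2)
    by (intro exI[of _ p] exI[of _ "1::nat"] conjI) (simp, blast+)
  moreover have "uniform_tower ?v (e * (?H + hs)) W'" by (rule uniform_tower_mset[OF W' uV])
  moreover have len: "length W' = ?c ^ Suc e" using mset_eq_length[OF W'] lenV by simp
  moreover have "real (length W') * ?v = real ?c * v / real (r * e)"
    using c \<open>1 \<le> r\<close> \<open>1 \<le> e\<close> unfolding len by (simp add: power_eq_if[of _ e] field_simps)
  moreover have "occ W x \<le> occ W' x \<and> occ W' x \<le> 1" for x using occ1 occ_mset[OF W'] by simp
  ultimately show ?thesis by blast
qed

subsection \<open>The parameters\<close>

locale cs_params =
  fixes \<tau> :: real and C :: nat and l nn h w e :: "nat \<Rightarrow> nat"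
  assumes tau: "0 < \<tau>" "\<tau> < 1" and params: "cs_parameters \<tau> C l nn h w e"
begin

text \<open>The value 1 at 0 covers the first step, in which nothing is repeated.\<close>

definition rr :: "nat \<Rightarrow> nat" where "rr n = (if n = 0 then 1 else C * n ^ 2)"

text \<open>The number of spacers around each segment: \<open>h (l t)\<close> at step
  \<open>nn t\<close>, and 0 at all other steps.\<close>

definition hs :: "nat \<Rightarrow> nat" where "hs n = w n - h n * rr n"

definition EE :: "nat \<Rightarrow> nat" where "EE n = (\<Prod>i<n. e i)"

lemma par:
  "real C powr (\<tau> / (1 - \<tau>)) > 4" "1 < l 1" "\<And>t. t \<ge> 1 \<Longrightarrow> l t < nn t" "\<And>t. t \<ge> 1 \<Longrightarrow> nn t < l (Suc t)"
  "summable (\<lambda>t. real (nn (Suc t)) powr (- 2 * \<tau> / (1 - \<tau>)))"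
  "e 0 = 2" "h 0 = 1" "w 0 = 1" "h 1 = e 0"
  "\<And>n. n \<ge> 1 \<Longrightarrow> n \<notin> nn ` {1..} \<Longrightarrow> w n = h n * rep_num C n"
  "\<And>t. t \<ge> 1 \<Longrightarrow> w (nn t) = h (nn t) * rep_num C (nn t) + h (l t)"
  "\<And>n. n \<ge> 1 \<Longrightarrow> e n = nat \<lfloor>(real (w n) powr \<tau> / real (\<Prod>i<n. e i)) powr (1 / (1 - \<tau>))\<rfloor>"
  "\<And>n. n \<ge> 1 \<Longrightarrow> h (Suc n) = w n * e n"
  using params unfolding cs_parameters_def by blast+

lemma C_ge_2: "2 \<le> C"
proof (rule ccontr)
  assume "\<not> 2 \<le> C"
  then have "C = 0 \<or> C = 1" by auto
  then show False using par(1) by auto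
qed

lemma rr_pos: "1 \<le> rr n"
  using C_ge_2 by (auto simp: rr_def)

lemma rr_conv: "n \<ge> 1 \<Longrightarrow> rep_num C n = rr n"
  by (auto simp: rr_def rep_num_def)

lemma l_nn_bounds: "t \<ge> 1 \<Longrightarrow> t < l t \<and> t < nn t"
proof (induction t rule: nat_induct_at_least)
  case base
  then show ?case using par(2) par(3)[of 1] by simp
next
  case (Suc t)
  then show ?case using par(4)[of t] par(3)[of "Suc t"] by simp
qed

lemma nn_less: "1 \<le> s \<Longrightarrow> s < t \<Longrightarrow> nn s < nn t"
proof (induction t)
  case (Suc t)
  have "nn t < nn (Suc t)" if "1 \<le> t" using par(4)[of t] par(3)[of "Suc t"] that by simp
  then show ?case using Suc by (cases "s = t") auto
qed simp

lemma nn_inj: "1 \<le> s \<Longrightarrow> 1 \<le> t \<Longrightarrow> nn s = nn t \<longleftrightarrow> s = t"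
  using nn_less[of s t] nn_less[of t s] by (metis linorder_neqE_nat less_irrefl)

lemma nn_not_small: "0 \<notin> nn ` {1..}" "1 \<notin> nn ` {1..}"
  using l_nn_bounds by force+

lemma w_conv: "w n = h n * rr n + hs n"
proof (cases "n = 0")
  case True
  then show ?thesis by (simp add: hs_def par rr_def)
next
  case False
  then have n: "n \<ge> 1" by simp
  have "h n * rr n \<le> w n"
  proof (cases "n \<in> nn ` {1..}")
    case True
    then show ?thesis using par(11) rr_conv[OF n] by auto
  next
    case False
    then show ?thesis using par(10)[OF n] rr_conv[OF n] by simp
  qed
  then show ?thesis by (simp add: hs_def)
qed

lemma hs_nn: "t \<ge> 1 \<Longrightarrow> hs (nn t) = h (l t)"
  using par(11)[of t] rr_conv[of "nn t"] l_nn_bounds[of t] by (simp add: hs_def)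

lemma hs_0: "n \<notin> nn ` {1..} \<Longrightarrow> hs n = 0"
  using par(10)[of n] rr_conv[of n] par by (cases "n = 0") (auto simp: hs_def rr_def)

lemma h_Suc: "h (Suc n) = w n * e n"
  using par(9) par(13)[of n] by (cases "n = 0") (auto simp: par)

lemma EE_Suc: "EE (Suc n) = EE n * e n" and EE_0 [simp]: "EE 0 = 1"
  by (simp_all add: EE_def)

text \<open>For \<open>n \<ge> 1\<close> the real number whose integer part is
  \<open>e n\<close>.\<close>

definition xx :: "nat \<Rightarrow> real" where
  "xx n = (real (w n) powr \<tau> / real (EE n)) powr (1 / (1 - \<tau>))"

lemma e_floor: "n \<ge> 1 \<Longrightarrow> real (e n) \<le> xx n \<and> xx n < real (e n) + 1"
proof -
  assume n: "n \<ge> 1"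
  have e: "e n = nat \<lfloor>xx n\<rfloor>" using par(12)[OF n] by (simp add: xx_def EE_def)
  have "0 \<le> xx n" by (simp add: xx_def)
  then show ?thesis unfolding e by linarith
qed

lemma xx_powr: "xx n powr (1 - \<tau>) = real (w n) powr \<tau> / real (EE n)"
  using tau by (simp add: xx_def powr_powr)

lemma xx_ge:
  assumes "0 < y" "y powr (1 - \<tau>) \<le> real (w n) powr \<tau> / real (EE n)"
  shows "y \<le> xx n"
proof (rule ccontr)
  assume "\<not> y \<le> xx n"
  then have "xx n powr (1 - \<tau>) < y powr (1 - \<tau>)"
    using tau by (intro powr_less_mono2) (auto simp: xx_def)
  then show False using assms(2) by (simp add: xx_powr)
qed

lemma C_powr: "4 powr (1 - \<tau>) \<le> real C powr \<tau>"
proof -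
  have "4 powr (1 - \<tau>) \<le> (real C powr (\<tau> / (1 - \<tau>))) powr (1 - \<tau>)"
    using par(1) tau by (intro powr_mono2) auto
  also have "\<dots> = real C powr \<tau>" using tau by (simp add: powr_powr)
  finally show ?thesis .
qed

text \<open>Write \<open>e n\<close> as \<open>e n powr (1 - \<tau>) * e n powr \<tau>\<close>. By
  the choice of \<open>e n\<close> the first factor times \<open>EE n\<close> is at most
  \<open>w n powr \<tau>\<close>, and \<open>h (Suc n) = w n * e n\<close>.\<close>

lemma EE_le_step:
  assumes "n \<ge> 1" "0 < EE n" "0 < e n"
  shows "real (EE (Suc n)) \<le> real (h (Suc n)) powr \<tau>"
proof -
  have "real (e n) powr (1 - \<tau>) \<le> xx n powr (1 - \<tau>)"
    using e_floor[OF assms(1)] tau by (intro powr_mono2) auto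
  then have 1: "real (EE n) * real (e n) powr (1 - \<tau>) \<le> real (w n) powr \<tau>"
    using assms(2) by (simp add: xx_powr field_simps)
  have "real (e n) = real (e n) powr (1 - \<tau>) * real (e n) powr \<tau>"
    using assms(3) by (simp flip: powr_add)
  then have "real (EE (Suc n)) = (real (EE n) * real (e n) powr (1 - \<tau>)) * real (e n) powr \<tau>"
    by (simp add: EE_Suc)
  also have "\<dots> \<le> real (w n) powr \<tau> * real (e n) powr \<tau>"
    using 1 by (intro mult_right_mono) auto
  also have "\<dots> = real (h (Suc n)) powr \<tau>" by (simp add: h_Suc powr_mult)
  finally show ?thesis .
qed

text \<open>The bound on \<open>EE n\<close> makes the base of \<open>xx n\<close> at least
  \<open>(w n / h n) powr \<tau>\<close>, hence at least \<open>rr n powr \<tau>\<close>; the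
  condition on \<open>C\<close> then supplies the factor 4.\<close>

lemma e_large:
  assumes n: "n \<ge> 1" and h: "0 < h n" and E0: "0 < EE n" and E: "real (EE n) \<le> real (h n) powr \<tau>"
  shows "4 * real n powr (2 * \<tau> / (1 - \<tau>)) \<le> xx n"
proof (rule xx_ge)
  have n0: "0 < real n" using n by simp
  then show "0 < 4 * real n powr (2 * \<tau> / (1 - \<tau>))" by simp
  have "(4 * real n powr (2 * \<tau> / (1 - \<tau>))) powr (1 - \<tau>) = 4 powr (1 - \<tau>) * real n powr (2 * \<tau>)"
    using tau n0 by (simp add: powr_mult powr_powr)
  also have "\<dots> \<le> real C powr \<tau> * (real n ^ 2) powr \<tau>"
    using C_powr n0 by (intro mult_mono) (auto simp: powr_powr simp flip: powr_numeral)
  also have "\<dots> = real (rr n) powr \<tau>" using n by (simp add: rr_def powr_mult)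
  also have "\<dots> = (real (h n) powr \<tau> * real (rr n) powr \<tau>) / real (h n) powr \<tau>" using h by simp
  also have "\<dots> = real (h n * rr n) powr \<tau> / real (h n) powr \<tau>" by (simp add: powr_mult)
  also have "\<dots> \<le> real (w n) powr \<tau> / real (h n) powr \<tau>"
    using tau by (intro divide_right_mono powr_mono2) (auto simp: w_conv[of n] simp flip: of_nat_mult)
  also have "\<dots> \<le> real (w n) powr \<tau> / real (EE n)"
    using E E0 h by (intro divide_left_mono mult_pos_pos) auto
  finally show "(4 * real n powr (2 * \<tau> / (1 - \<tau>))) powr (1 - \<tau>) \<le> real (w n) powr \<tau> / real (EE n)" .
qed

text \<open>Treated apart because \<open>EE 1 = 2\<close> exceeds
  \<open>h 1 powr \<tau> = 2 powr \<tau>\<close>, so \<open>e_large\<close> does not apply. The 4 in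
  the condition on \<open>C\<close> is just what makes \<open>xx 1 \<ge> 2\<close>.\<close>

lemma e_1: "2 \<le> e 1"
proof -
  have "w 1 = 2 * C"
    using w_conv[of 1] hs_0[OF nn_not_small(2)] par(6,9) by (simp add: rr_def)
  moreover have "EE 1 = 2" using EE_Suc[of 0] par(6) by simp
  ultimately have xx: "real (w 1) powr \<tau> / real (EE 1) = (2 * real C) powr \<tau> / 2" by simp
  have "(2::real) powr (1 - \<tau>) = 2 powr \<tau> * 4 powr (1 - \<tau>) / 2"
  proof -
    have "(4::real) powr (1 - \<tau>) = 2 powr (2 * (1 - \<tau>))"
      using powr_powr[of 2 2 "1 - \<tau>"] by simp
    then have "2 powr \<tau> * (4::real) powr (1 - \<tau>) / 2 powr 1 = 2 powr (\<tau> + 2 * (1 - \<tau>) - 1)"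
      by (simp only: powr_add powr_diff)
    also have "\<tau> + 2 * (1 - \<tau>) - 1 = 1 - \<tau>" by simp
    finally show ?thesis by simp
  qed
  also have "\<dots> \<le> 2 powr \<tau> * real C powr \<tau> / 2"
    using C_powr by (intro divide_right_mono mult_left_mono) auto
  also have "\<dots> = (2 * real C) powr \<tau> / 2" by (simp add: powr_mult)
  finally have "2 powr (1 - \<tau>) \<le> real (w 1) powr \<tau> / real (EE 1)" unfolding xx .
  then have "2 \<le> xx 1" by (intro xx_ge) auto
  then show ?thesis using e_floor[of 1] by simp
qed

text \<open>A joint induction: the bound on \<open>EE n\<close> makes \<open>e n\<close> large, and
  \<open>e n > 0\<close> passes the bound on to the next stage. The bound on \<open>EE n\<close>
  starts only at 2.\<close>

lemma e_main: "n \<ge> 1 \<Longrightarrow> (\<forall>i\<le>n. 2 \<le> e i) \<and> 0 < h n \<and> 0 < EE n \<and> (n \<ge> 2 \<longrightarrow> real (EE n) \<le> real (h n) powr \<tau>)"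
proof (induction n rule: nat_induct_at_least)
  case base
  have "EE 1 = 2" using EE_Suc[of 0] par(6) by simp
  then show ?case using e_1 par(6,9) by (auto simp: le_Suc_eq)
next
  case (Suc n)
  have en: "2 \<le> e n" using Suc by auto
  have w: "0 < w n" using Suc rr_pos[of n] by (simp add: w_conv)
  have hS: "0 < h (Suc n)" using en w by (simp add: h_Suc)
  have ES: "0 < EE (Suc n)" using Suc en less_le_trans[of 0 2 "e n"] by (simp add: EE_Suc)
  have EhS: "real (EE (Suc n)) \<le> real (h (Suc n)) powr \<tau>"
    using Suc en less_le_trans[of 0 2 "e n"] by (intro EE_le_step) auto
  have "4 * real (Suc n) powr (2 * \<tau> / (1 - \<tau>)) \<le> xx (Suc n)"
    by (rule e_large) (use hS ES EhS in auto)
  moreover have "1 \<le> real (Suc n) powr (2 * \<tau> / (1 - \<tau>))"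
    using tau by (intro ge_one_powr_ge_zero) auto
  ultimately have "2 \<le> e (Suc n)" using e_floor[of "Suc n"] by linarith
  then show ?case using Suc hS ES EhS by (auto simp: le_Suc_eq)
qed

lemma e_ge_2: "2 \<le> e n" using e_main[of "Suc n"] by simp
lemma e_ge_1: "1 \<le> e n" using e_ge_2[of n] by simp
lemma h_pos: "0 < h n" using e_main[of n] par(7) by (cases "n = 0") auto
lemma w_pos: "0 < w n" using h_pos[of n] rr_pos[of n] by (simp add: w_conv)
lemma EE_pos: "0 < EE n" using e_main[of n] by (cases "n = 0") auto
lemma EE_le: "2 \<le> n \<Longrightarrow> real (EE n) \<le> real (h n) powr \<tau>" using e_main[of n] by simp

text \<open>With the condition on \<open>nn\<close> this makes the reciprocals of
  \<open>e (nn t)\<close> summable, which controls what the additional index entry at the steps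
  \<open>nn t\<close> does to the number of columns.\<close>

lemma e_inverse_le: "2 \<le> n \<Longrightarrow> 1 / real (e n) \<le> real n powr (- 2 * \<tau> / (1 - \<tau>))"
proof -
  assume n: "2 \<le> n"
  let ?p = "real n powr (2 * \<tau> / (1 - \<tau>))"
  have "4 * ?p \<le> xx n" using n h_pos EE_pos EE_le by (intro e_large) auto
  moreover have p: "1 \<le> ?p" using tau n by (intro ge_one_powr_ge_zero) auto
  ultimately have "?p \<le> real (e n)" using e_floor[of n] n by linarith
  then have "1 / real (e n) \<le> 1 / ?p" using p by (intro frac_le) linarith+
  also have "\<dots> = real n powr (- 2 * \<tau> / (1 - \<tau>))" by (simp add: powr_minus_divide)
  finally show ?thesis .
qed

text \<open>From \<open>xx n < e n + 1 \<le> 2 * e n\<close>: taking the integer part costs at most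
  the factor \<open>2 powr (1 - \<tau>)\<close>, and only the last stage counts, because
  \<open>xx n\<close> contains the true product \<open>EE n\<close>.\<close>

lemma EE_ge: "1 \<le> n \<Longrightarrow> real (h (Suc n)) powr \<tau> \<le> 2 * real (EE (Suc n))"
proof -
  assume n: "1 \<le> n"
  have e: "1 \<le> real (e n)" using e_ge_1[of n] by simp
  have "real (w n) powr \<tau> / real (EE n) \<le> (2 * real (e n)) powr (1 - \<tau>)"
    unfolding xx_powr[symmetric] using e_floor[OF n] tau e by (intro powr_mono2) (auto simp: xx_def)
  also have "\<dots> \<le> 2 * real (e n) powr (1 - \<tau>)"
  proof -
    have "(2::real) powr (1 - \<tau>) \<le> 2 powr 1" using tau by (intro powr_mono) auto
    then show ?thesis by (simp add: powr_mult mult_right_mono)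
  qed
  finally have 1: "real (w n) powr \<tau> \<le> 2 * real (EE n) * real (e n) powr (1 - \<tau>)"
    using EE_pos[of n] by (simp add: field_simps)
  have "real (e n) = real (e n) powr (1 - \<tau>) * real (e n) powr \<tau>"
    using e by (simp flip: powr_add)
  have "real (h (Suc n)) powr \<tau> = real (w n) powr \<tau> * real (e n) powr \<tau>"
    by (simp add: h_Suc powr_mult)
  also have "\<dots> \<le> (2 * real (EE n) * real (e n) powr (1 - \<tau>)) * real (e n) powr \<tau>"
    using 1 by (intro mult_right_mono) auto
  also have "\<dots> = 2 * real (EE n) * real (e n)"
    using \<open>real (e n) = _\<close> by (simp add: mult.assoc)
  finally show ?thesis by (simp add: EE_Suc)
qed

text \<open>For \<open>L < h (Suc n)\<close> this bounds the number \<open>L / w n\<close> of blocks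
  in a window, times the order \<open>h n powr \<tau>\<close> of the entropy of one block, by
  \<open>2 * L powr \<tau>\<close>.\<close>

lemma h_Suc_powr: "2 \<le> n \<Longrightarrow> real (h (Suc n)) powr (1 - \<tau>) * real (h n) powr \<tau> \<le> 2 * real (w n)"
proof -
  assume n: "2 \<le> n"
  have "real (e n) powr (1 - \<tau>) \<le> xx n powr (1 - \<tau>)"
    using e_floor[of n] tau n by (intro powr_mono2) auto
  then have 1: "real (EE n) * real (e n) powr (1 - \<tau>) \<le> real (w n) powr \<tau>"
    using EE_pos[of n] by (simp add: xx_powr field_simps)
  have "real (h (Suc n)) powr (1 - \<tau>) * real (h n) powr \<tau>
      \<le> real (h (Suc n)) powr (1 - \<tau>) * (2 * real (EE n))"
    using EE_ge[of "n - 1"] n by (intro mult_left_mono) auto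
  also have "\<dots> = 2 * real (w n) powr (1 - \<tau>) * (real (EE n) * real (e n) powr (1 - \<tau>))"
    by (simp add: h_Suc powr_mult)
  also have "\<dots> \<le> 2 * real (w n) powr (1 - \<tau>) * real (w n) powr \<tau>"
    using 1 by (intro mult_left_mono) auto
  also have "\<dots> = 2 * real (w n)" using w_pos[of n] by (simp add: mult.assoc flip: powr_add)
  finally show ?thesis .
qed

lemma w_le_h_Suc: "2 * w n \<le> h (Suc n)"
  using e_ge_2[of n] by (simp add: h_Suc mult.commute)

lemma h_le_w: "h n \<le> w n"
proof -
  have "h n * 1 \<le> h n * rr n" by (intro mult_le_mono2 rr_pos)
  then show ?thesis using w_conv[of n] by linarith
qed

lemma h_Suc_ge: "2 * h n \<le> h (Suc n)"
  using w_le_h_Suc[of n] h_le_w[of n] by simp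

lemma h_mono: "m \<le> n \<Longrightarrow> h m \<le> h n"
  by (rule lift_Suc_mono_le[of h]) (use h_Suc_ge in \<open>auto intro: order_trans[OF _ h_Suc_ge]\<close>)

lemma h_ge: "2 ^ n \<le> h n"
proof (induction n)
  case (Suc n)
  then show ?case using h_Suc_ge[of n] by simp
qed (simp add: par)

lemma h_gt: "n < h n"
  using h_ge[of n] less_exp[of n] by (meson less_le_trans)

lemma hs_le: "hs n \<le> h n"
proof (cases "n \<in> nn ` {1..}")
  case True
  then obtain t where t: "t \<ge> 1" "n = nn t" by auto
  then show ?thesis using hs_nn[of t] h_mono[of "l t" "nn t"] par(3)[of t] by simp
qed (simp add: hs_0)

lemma sum_inverse_e_le:
  "(\<Sum>i\<in>{i. i < n \<and> i \<in> nn ` {1..}}. 1 / real (e i)) \<le> (\<Sum>t. real (nn (Suc t)) powr (- 2 * \<tau> / (1 - \<tau>)))"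
proof -
  have fin: "finite {t. nn (Suc t) < n}"
  proof (rule finite_subset)
    show "{t. nn (Suc t) < n} \<subseteq> {..n}"
    proof
      fix t assume "t \<in> {t. nn (Suc t) < n}"
      then show "t \<in> {..n}" using l_nn_bounds[of "Suc t"] by simp
    qed
  qed simp
  have "{i. i < n \<and> i \<in> nn ` {1..}} = (\<lambda>t. nn (Suc t)) ` {t. nn (Suc t) < n}"
    by (auto simp: image_iff) (metis Suc_le_D)
  then have "(\<Sum>i\<in>{i. i < n \<and> i \<in> nn ` {1..}}. 1 / real (e i))
      = (\<Sum>t\<in>{t. nn (Suc t) < n}. 1 / real (e (nn (Suc t))))"
    by (simp add: sum.reindex inj_on_def nn_inj)
  also have "\<dots> \<le> (\<Sum>t\<in>{t. nn (Suc t) < n}. real (nn (Suc t)) powr (- 2 * \<tau> / (1 - \<tau>)))"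
  proof (intro sum_mono e_inverse_le)
    fix t show "2 \<le> nn (Suc t)" using l_nn_bounds[of "Suc t"] by simp
  qed
  also have "\<dots> \<le> (\<Sum>t. real (nn (Suc t)) powr (- 2 * \<tau> / (1 - \<tau>)))"
    using fin par(5) by (intro sum_le_suminf) auto
  finally show ?thesis .
qed

end

subsection \<open>The towers\<close>

lemma plan_items:
  "J \<in> tuples (length W) (Suc e) \<Longrightarrow> Some D \<in> set (plan W r hs e J) \<Longrightarrow> D \<in> set W"
proof -
  assume J: "J \<in> tuples (length W) (Suc e)" and "Some D \<in> set (plan W r hs e J)"
  then obtain k where k: "k < e" "D = W ! (J ! k - 1)"
    by (auto simp: plan_def seg_items_def split: if_splits)
  have "J ! k \<in> set J" using J k by (auto simp: tuples_def)
  then have "J ! k \<in> {1..length W}" using J by (auto simp: tuples_def)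
  then show ?thesis unfolding k(2) by (intro nth_mem) auto
qed

lemma built_level_cases:
  assumes "built v Z its E" "p < length E"
  shows "{E ! p..<E ! p + v} \<subseteq> Z \<or> (\<exists>D i. Some D \<in> set its \<and> i < col_height D \<and> {E ! p..<E ! p + v} \<subseteq> level D i)"
  using assms
proof (induction arbitrary: p rule: built.induct)
  case (Some its E d D)
  show ?case
  proof (cases "p < col_height D")
    case True
    then have "{(map (\<lambda>a. a + d) (col_ends D) @ E) ! p..<(map (\<lambda>a. a + d) (col_ends D) @ E) ! p + v} \<subseteq> level D p"
      using Some.hyps by (auto simp: nth_append level_def)
    then show ?thesis using True by auto
  next
    case False
    then have nth: "(map (\<lambda>a. a + d) (col_ends D) @ E) ! p = E ! (p - col_height D)"
      by (simp add: nth_append)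
    have "p - col_height D < length E" using Some.prems False by auto
    from Some.IH[OF this] show ?thesis unfolding nth by (meson list.set_intros(2))
  qed
next
  case (None its E a)
  then show ?case by (cases p) auto
qed simp

text \<open>A level that meets level \<open>i\<close> of \<open>D\<close> must come from a copy of
  \<open>D\<close>, because the levels in question are disjoint from each other and from the
  spacers. Inside a copy, going up one level is the same translation as in \<open>D\<close>. This is
  the compatibility of the successive definitions of the map.\<close>

lemma built_step:
  assumes "built v Z its E" "p < length E" "x \<in> {E ! p..<E ! p + v}" "x \<in> level D i" "i < col_height D"
    and "D \<in> S" "\<And>D. Some D \<in> set its \<Longrightarrow> D \<in> S"
    and disj: "\<And>D D' i i' x. D \<in> S \<Longrightarrow> D' \<in> S \<Longrightarrow> i < col_height D \<Longrightarrow> i' < col_height D'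
      \<Longrightarrow> x \<in> level D i \<Longrightarrow> x \<in> level D' i' \<Longrightarrow> D = D' \<and> i = i'"
    and Z: "\<And>D i x. D \<in> S \<Longrightarrow> i < col_height D \<Longrightarrow> x \<in> level D i \<Longrightarrow> x \<notin> Z"
  shows "{E ! p..<E ! p + v} \<subseteq> level D i
    \<and> (Suc i < col_height D \<longrightarrow> Suc p < length E \<and> E ! Suc p - E ! p = col_ends D ! Suc i - col_ends D ! i)"
  using assms(1-7)
proof (induction arbitrary: p rule: built.induct)
  case (Some its E d D')
  let ?E = "map (\<lambda>a. a + d) (col_ends D') @ E"
  show ?case
  proof (cases "p < col_height D'")
    case True
    then have sub: "{?E ! p..<?E ! p + v} \<subseteq> level D' p"
      using Some.hyps by (auto simp: nth_append level_def)
    then have "D' = D \<and> p = i"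
      using True Some.prems by (intro disj[of _ _ _ _ x]) auto
    then show ?thesis using sub by (auto simp: nth_append)
  next
    case False
    then obtain q where q: "p = col_height D' + q" by (metis le_add_diff_inverse not_less)
    have nth: "?E ! p = E ! q" "?E ! Suc p = E ! Suc q" unfolding q by (simp_all add: nth_append)
    show ?thesis
      unfolding nth using Some.IH[of q] Some.prems unfolding nth by (simp add: q)
  qed
next
  case (None its E a)
  show ?case
  proof (cases p)
    case 0
    then have "x \<in> Z" using None by auto
    then show ?thesis using Z[of D i x] None.prems by auto
  next
    case (Suc p')
    then show ?thesis using None.IH[of p'] None.prems by auto
  qed
qed simp

locale cs_sys = cs_params +
  fixes W :: "nat \<Rightarrow> tower"
  assumes towers: "cs_towers C l nn h e W"
begin

definition c :: "nat \<Rightarrow> nat" where "c n = length (W n)"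
definition v :: "nat \<Rightarrow> real" where "v n = col_width (hd (W n))"
definition U :: "nat \<Rightarrow> real set" where "U n = \<Union>(tower_levels (W n))"
text \<open>The measure covered by tower \<open>n\<close>.\<close>

definition mm :: "nat \<Rightarrow> real" where "mm n = real (c n) * v n * real (h n)"
definition xi :: real where "xi = cs_xi C l nn h"
text \<open>The relative growth of the covered measure at step \<open>n\<close>.\<close>

definition aa :: "nat \<Rightarrow> real" where "aa n = real (hs n) / real (h n * rr n)"

lemma aa_nonneg: "0 \<le> aa n" by (simp add: aa_def)

lemma aa_le: "aa n \<le> 1 / real (rr n)"
  using hs_le[of n] h_pos[of n] rr_pos[of n] unfolding aa_def by (simp add: divide_simps)

lemma cs_xi_conv: "cs_xi C l nn h = prodinf (\<lambda>t. inverse (1 + aa (nn (Suc t))))"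
proof -
  have "rep_num C (nn (Suc t)) = rr (nn (Suc t))" for t
    using l_nn_bounds[of "Suc t"] by (intro rr_conv) simp
  then show ?thesis unfolding cs_xi_def aa_def by (simp add: hs_nn)
qed

text \<open>There are at most \<open>h n\<close> spacers per segment of \<open>rr n\<close> copies,
  so \<open>aa n \<le> 1 / rr n\<close>, which is summable along \<open>nn\<close> since
  \<open>rr\<close> grows quadratically.\<close>

lemma convergent_aa: "convergent_prod (\<lambda>t. 1 + aa (nn (Suc t)))"
proof (rule summable_imp_convergent_prod_real)
  show "summable (\<lambda>t. \<bar>aa (nn (Suc t))\<bar>)"
  proof (rule summable_comparison_test')
    show "summable (\<lambda>t. inverse (real (Suc t) ^ 2))"
      using inverse_power_summable[of 2, where 'a = real] by (subst summable_Suc_iff) simp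
    fix t :: nat
    have n: "Suc t < nn (Suc t)" using l_nn_bounds[of "Suc t"] by simp
    have "real (Suc t) ^ 2 \<le> real (nn (Suc t)) ^ 2" using n by (intro power_mono) auto
    also have "\<dots> \<le> real C * real (nn (Suc t)) ^ 2" using C_ge_2 mult_right_mono[of 1 "real C" "real (nn (Suc t)) ^ 2"] by simp
    also have "\<dots> = real (rr (nn (Suc t)))" using n by (simp add: rr_def)
    finally have "1 / real (rr (nn (Suc t))) \<le> 1 / real (Suc t) ^ 2"
      by (intro divide_left_mono) (use rr_pos[of "nn (Suc t)"] in auto)
    then show "norm \<bar>aa (nn (Suc t))\<bar> \<le> inverse (real (Suc t) ^ 2)"
      using aa_le[of "nn (Suc t)"] aa_nonneg[of "nn (Suc t)"] by (simp add: inverse_eq_divide)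
  qed
  show "aa (nn (Suc t)) \<noteq> - 1" for t using aa_nonneg[of "nn (Suc t)"] by linarith
qed

lemma xi_conv: "xi = inverse (prodinf (\<lambda>t. 1 + aa (nn (Suc t))))"
  unfolding xi_def cs_xi_conv by (rule prodinf_inverse[OF convergent_aa])

lemma prodinf_aa_pos: "0 < prodinf (\<lambda>t. 1 + aa (nn (Suc t)))"
  by (rule less_0_prodinf[OF convergent_aa]) (use aa_nonneg in \<open>auto intro: add_pos_nonneg\<close>)

lemma xi_pos: "0 < xi"
  using prodinf_aa_pos by (simp add: xi_conv)

lemma xi_le_1: "xi \<le> 1"
proof -
  have "1 \<le> prodinf (\<lambda>t. 1 + aa (nn (Suc t)))"
    by (rule LIMSEQ_le_const[OF convergent_prod_LIMSEQ[OF convergent_aa]])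
      (auto intro!: exI[of _ 0] prod_ge_1 simp: aa_nonneg)
  then show ?thesis unfolding xi_conv by (simp add: inverse_le_1_iff)
qed

lemma tow:
  "mset (W 0) = {#Column (xi / 2) [0], Column (xi / 2) [xi / 2]#}"
  "n \<notin> nn ` {1..} \<Longrightarrow> mset (W (Suc n)) = mset (Ind (tilde_tower C W n) (e n))"
  "t \<ge> 1 \<Longrightarrow> \<exists>V. is_Inds {xi..<1} (tilde_tower C W (nn t)) (e (nn t)) (h (l t)) V \<and> mset (W (Suc (nn t))) = mset V"
  using towers unfolding cs_towers_def Let_def xi_def by blast+

lemma tilde_conv: "tilde_tower C W n = Rep (W n) (rr n)"
  using rr_conv[of n] by (simp add: tilde_tower_def rr_def rep_num_def flip: One_nat_def)

definition good :: "nat \<Rightarrow> bool" where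
  "good n \<longleftrightarrow> uniform_tower (v n) (h n) (W n) \<and> (\<forall>x. occ (W n) x \<le> 1) \<and> U n \<subseteq> {0..<1}"

definition next_rel :: "nat \<Rightarrow> bool" where
  "next_rel n \<longleftrightarrow> real (c (Suc n)) * v (Suc n) = real (c n) * v n / real (rr n * e n)
    \<and> c (Suc n) = (if n \<in> nn ` {1..} then c n ^ Suc (e n) else c n ^ e n)
    \<and> (\<forall>x. occ (W n) x \<le> occ (W (Suc n)) x)
    \<and> step_rel (W n) (rr n) (e n) (hs n) ({0..<1} - U n) (W (Suc n))"

lemma uniform_tower_v: "uniform_tower v' h' (W n) \<Longrightarrow> v n = v'"
  unfolding uniform_tower_def v_def by simp

lemma good_0: "good 0"
proof -
  let ?L = "[Column (xi / 2) [0], Column (xi / 2) [xi / 2]]"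
  have W0: "mset (W 0) = mset ?L" using tow(1) by simp
  have "uniform_tower (xi / 2) 1 ?L" using xi_pos by (simp add: uniform_tower_def)
  then have u: "uniform_tower (xi / 2) 1 (W 0)" by (rule uniform_tower_mset[OF W0])
  then have v0: "v 0 = xi / 2" by (rule uniform_tower_v)
  have "uniform_tower (v 0) (h 0) (W 0)" using u by (simp only: v0 par(7))
  moreover have "occ (W 0) x \<le> 1" for x
    unfolding occ_mset[OF W0] by (auto simp: occ_def col_occ_def of_bool_def)
  moreover have "U 0 \<subseteq> {0..<1}"
  proof -
    have "level D i \<subseteq> {0..<1}" if "D \<in> set (W 0)" "i < col_height D" for D i
    proof -
      have "D = Column (xi / 2) [0] \<or> D = Column (xi / 2) [xi / 2]"
        using that(1) mset_eq_setD[OF W0] by simp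
      then show ?thesis using that(2) xi_pos xi_le_1 by (elim disjE) (auto simp: level_def)
    qed
    then show ?thesis unfolding U_def tower_levels_def by blast
  qed
  ultimately show ?thesis by (simp add: good_def)
qed

lemma next_step:
  assumes "good n"
  shows "next_rel n \<and> good (Suc n)"
proof -
  have u: "uniform_tower (v n) (h n) (W n)" and o: "\<And>x. occ (W n) x \<le> 1" and U: "U n \<subseteq> {0..<1}"
    using assms by (auto simp: good_def)
  have *: "\<exists>v'. uniform_tower v' (h (Suc n)) (W (Suc n))
    \<and> real (c (Suc n)) * v' = real (c n) * v n / real (rr n * e n)
    \<and> c (Suc n) = (if n \<in> nn ` {1..} then c n ^ Suc (e n) else c n ^ e n)
    \<and> (\<forall>x. occ (W n) x \<le> occ (W (Suc n)) x \<and> occ (W (Suc n)) x \<le> 1)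
    \<and> step_rel (W n) (rr n) (e n) (hs n) ({0..<1} - U n) (W (Suc n))"
  proof (cases "n \<in> nn ` {1..}")
    case True
    then obtain t where t: "t \<ge> 1" "n = nn t" by auto
    have hs: "hs n = h (l t)" using hs_nn[OF t(1)] t(2) by simp
    obtain V where V: "is_Inds {xi..<1} (Rep (W n) (rr n)) (e n) (hs n) V" "mset (W (Suc n)) = mset V"
      using tow(3)[OF t(1)] unfolding t(2)[symmetric] tilde_conv hs by blast
    have hs1: "1 \<le> hs n" using h_pos[of "l t"] by (simp add: hs)
    have hS: "h (Suc n) = e n * (rr n * h n + hs n)" by (simp add: h_Suc w_conv mult.commute)
    show ?thesis
      using Inds_step[OF u o h_pos rr_pos e_ge_1 hs1 V] True xi_pos unfolding c_def U_def hS by auto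
  next
    case False
    have W': "mset (W (Suc n)) = mset (Ind (Rep (W n) (rr n)) (e n))"
      using tow(2)[OF False] by (simp add: tilde_conv)
    have hS: "h (Suc n) = e n * (rr n * h n)" by (simp add: h_Suc w_conv hs_0[OF False] mult.commute)
    obtain v' where v': "uniform_tower v' (e n * (rr n * h n)) (W (Suc n))"
      "real (length (W (Suc n))) * v' = real (length (W n)) * v n / real (rr n * e n)"
      "length (W (Suc n)) = length (W n) ^ e n" "\<forall>x. occ (W (Suc n)) x = occ (W n) x"
      "step_rel (W n) (rr n) (e n) 0 ({0..<1} - U n) (W (Suc n))"
      using Ind_step[OF u o h_pos rr_pos e_ge_1 W', of "{0..<1} - U n"] by blast
    show ?thesis
      by (rule exI[of _ v']) (use v' False o hs_0[OF False] in \<open>simp add: c_def hS\<close>)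
  qed
  then obtain v' where v': "uniform_tower v' (h (Suc n)) (W (Suc n))"
    "real (c (Suc n)) * v' = real (c n) * v n / real (rr n * e n)"
    "c (Suc n) = (if n \<in> nn ` {1..} then c n ^ Suc (e n) else c n ^ e n)"
    "\<forall>x. occ (W n) x \<le> occ (W (Suc n)) x \<and> occ (W (Suc n)) x \<le> 1"
    "step_rel (W n) (rr n) (e n) (hs n) ({0..<1} - U n) (W (Suc n))" by blast
  have vv: "v (Suc n) = v'" by (rule uniform_tower_v[OF v'(1)])
  have "level D p \<subseteq> {0..<1}" if "D \<in> set (W (Suc n))" "p < col_height D" for D p
  proof -
    have "\<exists>J. J \<in> tuples (length (W n)) (Suc (e n)) \<and>
      built (col_width D) ({0..<1} - U n) (plan (W n) (rr n) (hs n) (e n) J) (col_ends D)"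
    proof -
      obtain P where P: "P ` tuples (length (W n)) (Suc (e n)) = set (W (Suc n))"
        "\<forall>J\<in>tuples (length (W n)) (Suc (e n)). built (col_width (P J)) ({0..<1} - U n)
          (plan (W n) (rr n) (hs n) (e n) J) (col_ends (P J))"
        using v'(5) unfolding step_rel_def by blast
      then have "D \<in> P ` tuples (length (W n)) (Suc (e n))" using that(1) by simp
      then show ?thesis using P(2) by blast
    qed
    then obtain J where J: "J \<in> tuples (length (W n)) (Suc (e n))"
      and b: "built (col_width D) ({0..<1} - U n) (plan (W n) (rr n) (hs n) (e n) J) (col_ends D)" by blast
    show ?thesis
      using built_level_cases[OF b that(2)] plan_items[OF J(1)] U
      unfolding U_def tower_levels_def level_def[of D] by blast
  qed
  then have "U (Suc n) \<subseteq> {0..<1}" unfolding U_def tower_levels_def by blast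
  then show ?thesis using v' vv unfolding next_rel_def good_def by auto
qed

lemma good_all: "good n"
  by (induction n) (auto simp: good_0 next_step)

lemma next_all: "next_rel n"
  using next_step[OF good_all] by simp

lemma W_facts:
  "uniform_tower (v n) (h n) (W n)" "occ (W n) x \<le> 1" "U n \<subseteq> {0..<1}" "0 < v n" "0 < c n"
  "D \<in> set (W n) \<Longrightarrow> col_width D = v n" "D \<in> set (W n) \<Longrightarrow> col_height D = h n"
  using good_all[of n] by (auto simp: good_def uniform_tower_def c_def)

lemma distinct_W: "distinct (W n)"
  by (rule occ_le_1_distinct[OF W_facts(1) h_pos W_facts(2)])

lemma card_set_W: "card (set (W n)) = c n"
  using distinct_card[OF distinct_W] by (simp add: c_def)

lemma level_disjoint:
  assumes "D \<in> set (W n)" "i < h n" "x \<in> level D i" "D' \<in> set (W n)" "i' < h n" "x \<in> level D' i'"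
  shows "D = D' \<and> i = i'"
  using occ_le_1_disjoint[OF W_facts(2), of D n i x D' i'] assms W_facts(7) by auto

lemma U_iff: "x \<in> U n \<longleftrightarrow> (\<exists>D\<in>set (W n). \<exists>i<h n. x \<in> level D i)"
  using W_facts(7) unfolding U_def tower_levels_def by fastforce

lemma U_mono_Suc: "U n \<subseteq> U (Suc n)"
proof
  fix x assume "x \<in> U n"
  then have "0 < occ (W n) x" by (simp add: U_def occ_pos_iff)
  also have "\<dots> \<le> occ (W (Suc n)) x" using next_all[of n] by (simp add: next_rel_def)
  finally show "x \<in> U (Suc n)" by (simp add: U_def occ_pos_iff)
qed

definition TT :: "nat \<Rightarrow> nat list set" where "TT n = tuples (c n) (Suc (e n))"

definition pln :: "nat \<Rightarrow> nat list \<Rightarrow> column option list" where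
  "pln n J = plan (W n) (rr n) (hs n) (e n) J"

lemma step_rel_obtain:
  obtains p \<kappa> where "\<kappa> > 0" "p ` TT n = set (W (Suc n))"
    "\<And>D. D \<in> set (W (Suc n)) \<Longrightarrow> card {J\<in>TT n. p J = D} = \<kappa>"
    "\<And>J. J \<in> TT n \<Longrightarrow> built (v (Suc n)) ({0..<1} - U n) (pln n J) (col_ends (p J))"
proof -
  obtain p \<kappa> where p: "\<kappa> > 0" "p ` TT n = set (W (Suc n))"
    "\<forall>D\<in>set (W (Suc n)). card {J\<in>TT n. p J = D} = \<kappa>"
    "\<forall>J\<in>TT n. built (col_width (p J)) ({0..<1} - U n) (pln n J) (col_ends (p J))"
    using next_all[of n] unfolding next_rel_def step_rel_def TT_def pln_def c_def by blast
  have "built (v (Suc n)) ({0..<1} - U n) (pln n J) (col_ends (p J))" if "J \<in> TT n" for J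
    using p(2,4) that W_facts(6)[where D = "p J" and n = "Suc n"] by force
  then show ?thesis using that p(1-3) by blast
qed

text \<open>Combines the recipe of \<open>D\<close> with \<open>built_step\<close>; the spacers
  avoid \<open>U n\<close>, so a level through a point of \<open>U n\<close> comes from a
  copy.\<close>

lemma refine:
  assumes D: "D \<in> set (W (Suc n))" "p < h (Suc n)" "x \<in> level D p"
    and C: "D' \<in> set (W n)" "i < h n" "x \<in> level D' i"
  shows "level D p \<subseteq> level D' i \<and> (Suc i < h n \<longrightarrow> Suc p < h (Suc n)
     \<and> col_ends D ! Suc p - col_ends D ! p = col_ends D' ! Suc i - col_ends D' ! i)"
proof -
  obtain P \<kappa> where P: "P ` TT n = set (W (Suc n))"
    "\<And>J. J \<in> TT n \<Longrightarrow> built (v (Suc n)) ({0..<1} - U n) (pln n J) (col_ends (P J))"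
    using step_rel_obtain[of n] by metis
  obtain J where J: "J \<in> TT n" "D = P J" using D(1) P(1) by blast
  have b: "built (v (Suc n)) ({0..<1} - U n) (pln n J) (col_ends D)" using P(2)[OF J(1)] J(2) by simp
  have w: "col_width D = v (Suc n)" "col_height D = h (Suc n)" "col_height D' = h n"
    using D C W_facts by auto
  have "{col_ends D ! p..<col_ends D ! p + v (Suc n)} \<subseteq> level D' i
    \<and> (Suc i < col_height D' \<longrightarrow> Suc p < length (col_ends D)
      \<and> col_ends D ! Suc p - col_ends D ! p = col_ends D' ! Suc i - col_ends D' ! i)"
  proof (rule built_step[OF b, where S = "set (W n)" and x = x])
    show "E \<in> set (W n)" if "Some E \<in> set (pln n J)" for E
      using plan_items[of J "W n" "e n"] J(1) that unfolding TT_def pln_def c_def by blast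
    show "E = E' \<and> i = i'" if "E \<in> set (W n)" "E' \<in> set (W n)" "i < col_height E" "i' < col_height E'"
      "x \<in> level E i" "x \<in> level E' i'" for E E' i i' x
      using level_disjoint[of E n i x E' i'] that W_facts(7) by auto
    show "x \<notin> {0..<1} - U n" if "E \<in> set (W n)" "i < col_height E" "x \<in> level E i" for E i x
      using U_iff[of x n] that W_facts(7) by auto
  qed (use D C w in \<open>auto simp: level_def\<close>)
  then show ?thesis using w by (simp add: level_def)
qed

lemma mm_Suc: "mm (Suc n) = mm n * (1 + aa n)"
proof -
  have "mm (Suc n) = (real (c n) * v n / real (rr n * e n)) * real (w n * e n)"
  proof -
    have "real (c (Suc n)) * v (Suc n) = real (c n) * v n / real (rr n * e n)"
      using next_all[of n] unfolding next_rel_def by blast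
    then show ?thesis by (simp only: mm_def h_Suc)
  qed
  also have "\<dots> = real (c n) * v n * (real (w n) / real (rr n))"
    using e_ge_1[of n] by (simp add: field_simps)
  also have "real (w n) / real (rr n) = real (h n) * (1 + aa n)"
    using rr_pos[of n] h_pos[of n] by (simp add: w_conv aa_def field_simps)
  finally show ?thesis by (simp add: mm_def)
qed

lemma mm_0: "mm 0 = xi"
proof -
  have "c 0 = 2" using arg_cong[OF tow(1), of size] by (simp add: c_def)
  moreover have "set (W 0) = {Column (xi / 2) [0], Column (xi / 2) [xi / 2]}"
    using arg_cong[OF tow(1), of set_mset] by simp
  then have "v 0 = xi / 2" using W_facts(6)[where D = "Column (xi / 2) [0]" and n = 0] by simp
  ultimately show ?thesis by (simp add: mm_def par)
qed

lemma c_0: "c 0 = 2"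
  using arg_cong[OF tow(1), of size] by (simp add: c_def)

lemma mm_prod: "mm n = xi * (\<Prod>i<n. 1 + aa i)"
  by (induction n) (simp_all add: mm_0 mm_Suc)

lemma mm_pos: "0 < mm n"
  using W_facts(4)[of n] W_facts(5)[of n] h_pos[of n] by (simp add: mm_def)

lemma mm_incseq: "incseq mm"
proof (rule incseq_SucI)
  fix n
  have "0 \<le> mm n * aa n" using mm_pos[of n] aa_nonneg[of n] by simp
  then show "mm n \<le> mm (Suc n)" by (simp add: mm_Suc algebra_simps)
qed

text \<open>Only the steps \<open>nn t\<close> insert spacers; all other factors are 1.\<close>

lemma prod_nn: "(\<Prod>i<Suc (nn (Suc t)). 1 + aa i) = (\<Prod>s\<le>t. 1 + aa (nn (Suc s)))"
proof -
  have "(\<Prod>i<Suc (nn (Suc t)). 1 + aa i) = (\<Prod>i\<in>(\<lambda>s. nn (Suc s)) ` {..t}. 1 + aa i)"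
  proof (rule prod.mono_neutral_right)
    show "(\<lambda>s. nn (Suc s)) ` {..t} \<subseteq> {..<Suc (nn (Suc t))}"
    proof (rule image_subsetI)
      fix s assume s: "s \<in> {..t}"
      show "nn (Suc s) \<in> {..<Suc (nn (Suc t))}"
      proof (cases "s = t")
        case False
        then have "nn (Suc s) < nn (Suc t)" using s by (intro nn_less) auto
        then show ?thesis by simp
      qed simp
    qed
    show "\<forall>i\<in>{..<Suc (nn (Suc t))} - (\<lambda>s. nn (Suc s)) ` {..t}. 1 + aa i = 1"
    proof
      fix i assume i: "i \<in> {..<Suc (nn (Suc t))} - (\<lambda>s. nn (Suc s)) ` {..t}"
      have "i \<notin> nn ` {1..}"
      proof
        assume "i \<in> nn ` {1..}"
        then obtain s where s: "s \<ge> 1" "i = nn s" by auto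
        then have "\<not> s \<le> Suc t" using i by (auto simp: image_iff) (metis Suc_le_D Suc_le_mono atMost_iff)
        then have "nn (Suc t) < nn s" by (intro nn_less) auto
        then show False using i s by auto
      qed
      then show "1 + aa i = 1" by (simp add: aa_def hs_0)
    qed
  qed simp
  also have "\<dots> = (\<Prod>s\<le>t. 1 + aa (nn (Suc s)))"
    by (subst prod.reindex) (auto simp: inj_on_def nn_inj)
  finally show ?thesis .
qed

text \<open>\<open>xi\<close> is the reciprocal of the infinite product of the growth factors. The
  limit is read off at the stages just after spacers were inserted, and monotonicity extends it to
  all stages.\<close>

lemma mm_tendsto: "mm \<longlonglongrightarrow> 1"
proof -
  have P: "(\<lambda>t. \<Prod>s\<le>t. 1 + aa (nn (Suc s))) \<longlonglongrightarrow> inverse xi"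
    using convergent_prod_LIMSEQ[OF convergent_aa] by (simp add: xi_conv)
  have "(\<lambda>t. xi * (\<Prod>s\<le>t. 1 + aa (nn (Suc s)))) \<longlonglongrightarrow> xi * inverse xi"
    by (intro tendsto_mult tendsto_const P)
  then have sub: "(mm \<circ> (\<lambda>t. Suc (nn (Suc t)))) \<longlonglongrightarrow> 1"
    using xi_pos by (simp add: comp_def mm_prod prod_nn del: prod.lessThan_Suc)
  have bound: "mm n \<le> 1" for n
  proof -
    have "n \<le> Suc (nn (Suc n))" using l_nn_bounds[of "Suc n"] by simp
    then have "mm n \<le> (mm \<circ> (\<lambda>t. Suc (nn (Suc t)))) n" using mm_incseq by (simp add: incseq_def)
    also have "\<dots> \<le> 1"
    proof (rule incseq_le[OF _ sub])
      show "incseq (mm \<circ> (\<lambda>t. Suc (nn (Suc t))))"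
        using mm_incseq nn_less by (intro incseq_SucI) (simp add: incseq_def less_imp_le)
    qed
    finally show ?thesis .
  qed
  then obtain L where L: "mm \<longlonglongrightarrow> L" using mm_incseq incseq_convergent by blast
  have "strict_mono (\<lambda>t. Suc (nn (Suc t)))" using nn_less by (auto simp: strict_mono_def)
  from LIMSEQ_subseq_LIMSEQ[OF L this] sub have "L = 1" using LIMSEQ_unique by blast
  then show ?thesis using L by simp
qed

lemma mm_le_1: "mm n \<le> 1"
  using incseq_le[OF mm_incseq mm_tendsto] .

end

subsection \<open>The dynamics\<close>

context cs_sys
begin

abbreviation T :: "real \<Rightarrow> real" where "T \<equiv> cs_map W"
abbreviation M :: "real measure" where "M \<equiv> cs_measure W"

text \<open>The part of the map that tower \<open>n\<close> alone defines; on top levels it says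
  nothing.\<close>

definition stepn :: "nat \<Rightarrow> real \<Rightarrow> real \<Rightarrow> bool" where
  "stepn n x y \<longleftrightarrow> (\<exists>D\<in>set (W n). \<exists>i. Suc i < h n \<and> x \<in> level D i \<and> y = x - col_ends D ! i + col_ends D ! Suc i)"

lemma cs_step_iff: "cs_step W x y \<longleftrightarrow> (\<exists>n. stepn n x y)"
  unfolding cs_step_def stepn_def using W_facts(7) by metis

lemma stepn_Suc: "stepn n x y \<Longrightarrow> stepn (Suc n) x y"
proof -
  assume "stepn n x y"
  then obtain D i where D: "D \<in> set (W n)" "Suc i < h n" "x \<in> level D i" "y = x - col_ends D ! i + col_ends D ! Suc i"
    unfolding stepn_def by blast
  then have "x \<in> U n" unfolding U_iff using Suc_lessD by blast
  then obtain E p where E: "E \<in> set (W (Suc n))" "p < h (Suc n)" "x \<in> level E p"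
    using U_mono_Suc[of n] U_iff by blast
  from refine[OF E D(1) Suc_lessD[OF D(2)] D(3)] D(2)
  have "Suc p < h (Suc n)" "col_ends E ! Suc p - col_ends E ! p = col_ends D ! Suc i - col_ends D ! i" by auto
  then show ?thesis unfolding stepn_def using E D(4) by (intro bexI[of _ E] exI[of _ p]) auto
qed

lemma stepn_mono: "m \<le> n \<Longrightarrow> stepn m x y \<Longrightarrow> stepn n x y"
  by (induction n rule: dec_induct) (auto intro: stepn_Suc)

lemma stepn_unique: "stepn m x y \<Longrightarrow> stepn n x z \<Longrightarrow> y = z"
proof -
  assume "stepn m x y" "stepn n x z"
  then have *: "stepn (max m n) x y" "stepn (max m n) x z"
    using stepn_mono[of m "max m n"] stepn_mono[of n "max m n"] by auto
  obtain D i where D: "D \<in> set (W (max m n))" "Suc i < h (max m n)" "x \<in> level D i"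
      "y = x - col_ends D ! i + col_ends D ! Suc i"
    using *(1) unfolding stepn_def by blast
  obtain E j where E: "E \<in> set (W (max m n))" "Suc j < h (max m n)" "x \<in> level E j"
      "z = x - col_ends E ! j + col_ends E ! Suc j"
    using *(2) unfolding stepn_def by blast
  have "D = E \<and> i = j"
    using D E by (intro level_disjoint[of D "max m n" i x E j]) auto
  then show "y = z" using D(4) E(4) by simp
qed

lemma T_stepn: "stepn n x y \<Longrightarrow> T x = y"
proof -
  assume *: "stepn n x y"
  then have "cs_step W x y" using cs_step_iff by blast
  moreover have "z = y" if "cs_step W x z" for z using that * stepn_unique cs_step_iff by blast
  ultimately have "(THE z. cs_step W x z) = y" by (intro the_equality)
  then show ?thesis using \<open>cs_step W x y\<close> unfolding cs_map_def by auto
qed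

lemma T_no_step: "(\<And>n y. \<not> stepn n x y) \<Longrightarrow> T x = x"
  unfolding cs_map_def cs_step_iff by auto

lemma level_shift:
  "D \<in> set (W n) \<Longrightarrow> x \<in> level D i \<Longrightarrow> x - col_ends D ! i + col_ends D ! j \<in> level D j"
  by (auto simp: level_def)

lemma T_level:
  assumes "D \<in> set (W n)" "Suc i < h n" "x \<in> level D i"
  shows "T x \<in> level D (Suc i)"
proof -
  have "stepn n x (x - col_ends D ! i + col_ends D ! Suc i)" unfolding stepn_def using assms by blast
  then show ?thesis using T_stepn level_shift[OF assms(1,3)] by simp
qed

lemma T_pow_level:
  assumes "D \<in> set (W n)" "x \<in> level D i"
  shows "i + s < h n \<Longrightarrow> (T ^^ s) x \<in> level D (i + s)"
proof (induction s)
  case (Suc s)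
  then show ?case using T_level[OF assms(1), of "i + s"] by simp
qed (use assms in simp)

section \<open>Measurability and invariance of the measure\<close>

text \<open>Finite unions of levels of tower \<open>n\<close>. Along a column of this or any later
  tower, membership in such a set depends on the level only, so a column carries a word of
  bits.\<close>

definition resp :: "nat \<Rightarrow> real set \<Rightarrow> bool" where
  "resp n A \<longleftrightarrow> A \<subseteq> U n \<and> (\<forall>D\<in>set (W n). \<forall>i<h n. level D i \<subseteq> A \<or> level D i \<inter> A = {})"

lemma resp_Suc: "resp n A \<Longrightarrow> resp (Suc n) A"
proof -
  assume A: "resp n A"
  have "level D p \<subseteq> A \<or> level D p \<inter> A = {}" if D: "D \<in> set (W (Suc n))" "p < h (Suc n)" for D p
  proof (cases "level D p \<inter> A = {}")
    case False
    then obtain x where x: "x \<in> level D p" "x \<in> A" by blast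
    then obtain E i where E: "E \<in> set (W n)" "i < h n" "x \<in> level E i" using A U_iff unfolding resp_def by blast
    then have "level E i \<subseteq> A" using A x unfolding resp_def by blast
    then show ?thesis using refine[OF D x(1) E] by blast
  qed simp
  then show ?thesis using A U_mono_Suc[of n] unfolding resp_def by blast
qed

lemma resp_mono: "m \<le> n \<Longrightarrow> resp m A \<Longrightarrow> resp n A"
  by (induction n rule: dec_induct) (auto intro: resp_Suc)

lemma resp_level: "D \<in> set (W n) \<Longrightarrow> i < h n \<Longrightarrow> resp n (level D i)"
  unfolding resp_def using level_disjoint U_iff by blast

lemma resp_Int: "resp n A \<Longrightarrow> resp n B \<Longrightarrow> resp n (A \<inter> B)"
  unfolding resp_def by blast

lemma resp_Un: "resp n A \<Longrightarrow> resp n B \<Longrightarrow> resp n (A \<union> B)"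
  unfolding resp_def by blast

lemma resp_empty: "resp n {}"
  unfolding resp_def by blast

lemma resp_UN: "finite I \<Longrightarrow> (\<And>i. i \<in> I \<Longrightarrow> resp n (A i)) \<Longrightarrow> resp n (\<Union>i\<in>I. A i)"
  by (induction I rule: finite_induct) (auto intro: resp_empty resp_Un)

lemma resp_compl: "resp n A \<Longrightarrow> resp n (U n - A)"
  unfolding resp_def using U_iff[of _ n] by blast

lemma resp_U: "resp n (U n)"
  unfolding resp_def using U_iff by blast

lemma resp_conv: "resp n A \<Longrightarrow> A = (\<Union>(D, i)\<in>{(D, i). D \<in> set (W n) \<and> i < h n \<and> level D i \<subseteq> A}. level D i)"
  unfolding resp_def using U_iff[of _ n] by fastforce

lemma gen_subset: "(\<Union>n. tower_levels (W n)) \<subseteq> Pow {0..<1}"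
  using W_facts(3) unfolding U_def by blast

lemma space_M [simp]: "space M = {0..<1}"
  unfolding cs_measure_def using gen_subset by (rule space_measure_of)

lemma sets_M: "sets M = sigma_sets {0..<1} (\<Union>n. tower_levels (W n))"
  unfolding cs_measure_def using gen_subset by (rule sets_measure_of)

lemma tower_levels_W: "tower_levels (W n) = {level D i | D i. D \<in> set (W n) \<and> i < h n}"
  unfolding tower_levels_def by (rule Collect_cong) (simp add: W_facts(7) cong: conj_cong)

lemma level_in_gen: "D \<in> set (W n) \<Longrightarrow> i < h n \<Longrightarrow> level D i \<in> (\<Union>n. tower_levels (W n))"
  unfolding tower_levels_W by blast

lemma gen_iff: "B \<in> (\<Union>n. tower_levels (W n)) \<longleftrightarrow> (\<exists>n. \<exists>D\<in>set (W n). \<exists>i<h n. B = level D i)"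
  unfolding tower_levels_W by blast

lemma level_sets: "D \<in> set (W n) \<Longrightarrow> i < h n \<Longrightarrow> level D i \<in> sets M"
  unfolding sets_M by (intro sigma_sets.Basic level_in_gen)

lemma resp_sets: "resp n A \<Longrightarrow> A \<in> sets M"
proof -
  assume A: "resp n A"
  have "finite {(D, i). D \<in> set (W n) \<and> i < h n \<and> level D i \<subseteq> A}"
    by (rule finite_subset[of _ "set (W n) \<times> {..<h n}"]) auto
  then have "(\<Union>(D, i)\<in>{(D, i). D \<in> set (W n) \<and> i < h n \<and> level D i \<subseteq> A}. level D i) \<in> sets M"
    using level_sets by (intro sets.finite_UN) auto
  then show ?thesis using resp_conv[OF A] by simp
qed

lemma sets_M_borel: "A \<in> sets M \<Longrightarrow> A \<in> sets lborel"
proof -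
  assume "A \<in> sets M"
  then have "A \<in> sigma_sets {0..<1} (\<Union>n. tower_levels (W n))" by (simp add: sets_M)
  then show ?thesis
  proof induction
    case (Basic a)
    then show ?case by (auto simp: tower_levels_def level_def)
  qed auto
qed

lemma emeasure_M: "A \<in> sets M \<Longrightarrow> emeasure M A = emeasure lborel A"
proof (rule emeasure_measure_of[OF cs_measure_def gen_subset])
  show "positive (sets M) (emeasure lborel)" by (simp add: positive_def)
  show "countably_additive (sets M) (emeasure lborel)"
    unfolding countably_additive_def
    using sets_M_borel by (auto intro!: suminf_emeasure simp: image_subset_iff)
qed

lemma measure_M: "A \<in> sets M \<Longrightarrow> measure M A = measure lborel A"
  by (simp add: measure_def emeasure_M)

lemma prob_space_M: "prob_space M"
proof
  have "space M \<in> sets M" by (rule sets.top)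
  then show "emeasure M (space M) = 1" by (simp add: emeasure_M)
qed

sublocale M: prob_space M by (rule prob_space_M)

lemma measure_level: "D \<in> set (W n) \<Longrightarrow> i < h n \<Longrightarrow> measure M (level D i) = v n"
  using W_facts(4)[of n] W_facts(6)[of D n] by (simp add: measure_M level_sets) (simp add: level_def)

lemma measure_levels:
  assumes "S \<subseteq> set (W n) \<times> {..<h n}"
  shows "(\<Union>(D, i)\<in>S. level D i) \<in> sets M" "measure M (\<Union>(D, i)\<in>S. level D i) = real (card S) * v n"
proof -
  have fin: "finite S" using assms by (rule finite_subset) simp
  have sets: "(case p of (D, i) \<Rightarrow> level D i) \<in> sets M" if "p \<in> S" for p
    using that assms level_sets by (auto split: prod.split)
  then show "(\<Union>(D, i)\<in>S. level D i) \<in> sets M" using fin by (intro sets.finite_UN) auto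
  have "measure M (\<Union>p\<in>S. case p of (D, i) \<Rightarrow> level D i) = (\<Sum>p\<in>S. measure M (case p of (D, i) \<Rightarrow> level D i))"
  proof (rule M.finite_measure_finite_Union[OF fin])
    show "disjoint_family_on (\<lambda>p. case p of (D, i) \<Rightarrow> level D i) S"
      unfolding disjoint_family_on_def
    proof (intro ballI impI)
      fix p q assume pq: "p \<in> S" "q \<in> S" "p \<noteq> q"
      obtain D i E j where *: "p = (D, i)" "q = (E, j)" by (metis surj_pair)
      have "x \<notin> level D i \<inter> level E j" for x
      proof
        assume "x \<in> level D i \<inter> level E j"
        then have "D = E \<and> i = j" using pq assms unfolding * by (intro level_disjoint[of D n i x E j]) auto
        then show False using pq(3) * by simp
      qed
      then show "(case p of (D, i) \<Rightarrow> level D i) \<inter> (case q of (D, i) \<Rightarrow> level D i) = {}"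
        unfolding * by auto
    qed
  qed (use sets in blast)
  also have "\<dots> = (\<Sum>p\<in>S. v n)"
    using assms measure_level by (intro sum.cong refl) (auto split: prod.split)
  finally show "measure M (\<Union>(D, i)\<in>S. level D i) = real (card S) * v n" by simp
qed

lemma measure_U: "measure M (U n) = mm n"
proof -
  have "U n = (\<Union>(D, i)\<in>set (W n) \<times> {..<h n}. level D i)"
    by (rule set_eqI) (simp add: U_iff, blast)
  then show ?thesis
    using measure_levels(2)[OF order_refl, of n] by (simp add: card_cartesian_product card_set_W mm_def)
qed

definition dom :: "real set" where
  "dom = (\<Union>n. \<Union>(D, i)\<in>{(D, i). D \<in> set (W n) \<and> Suc i < h n}. level D i)"

definition pre :: "nat \<Rightarrow> real set \<Rightarrow> real set" where
  "pre n B = (\<Union>(D, i)\<in>{(D, i). D \<in> set (W n) \<and> Suc i < h n \<and> level D (Suc i) \<subseteq> B}. level D i)"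

lemma dom_iff: "x \<in> dom \<longleftrightarrow> (\<exists>n y. stepn n x y)"
  unfolding dom_def stepn_def by auto

lemma dom_sets: "dom \<in> sets M"
proof -
  have "(\<Union>(D, i)\<in>{(D, i). D \<in> set (W n) \<and> Suc i < h n}. level D i) \<in> sets M" for n
    by (rule measure_levels(1)) auto
  then show ?thesis unfolding dom_def by blast
qed

lemma pre_sets: "pre n B \<in> sets M"
  unfolding pre_def by (rule measure_levels(1)) auto

text \<open>Where the map is defined, some tower of stage at least \<open>n\<close> witnesses it,
  and \<open>B\<close> is a union of levels there. Outside \<open>dom\<close> the map is the
  identity, which accounts for \<open>B - dom\<close>.\<close>

lemma vimage_T:
  assumes B: "resp n B"
  shows "T -` B \<inter> space M = (\<Union>N\<in>{n..}. pre N B) \<union> (B - dom)"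
proof (intro set_eqI iffI)
  fix x assume x: "x \<in> T -` B \<inter> space M"
  show "x \<in> (\<Union>N\<in>{n..}. pre N B) \<union> (B - dom)"
  proof (cases "x \<in> dom")
    case True
    then obtain m y where m: "stepn m x y" using dom_iff by blast
    let ?N = "max m n"
    have sN: "stepn ?N x y" using stepn_mono[OF _ m] by simp
    then obtain D i where D: "D \<in> set (W ?N)" "Suc i < h ?N" "x \<in> level D i"
      "y = x - col_ends D ! i + col_ends D ! Suc i" unfolding stepn_def by blast
    have "y \<in> B" using T_stepn[OF sN] x by simp
    moreover have "y \<in> level D (Suc i)" unfolding D(4) by (rule level_shift[OF D(1,3)])
    moreover have "resp ?N B" using resp_mono[OF _ B] by simp
    ultimately have "level D (Suc i) \<subseteq> B" using D(1,2) unfolding resp_def by blast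
    then have "x \<in> pre ?N B" unfolding pre_def using D by blast
    then show ?thesis by auto
  next
    case False
    then have "T x = x" using T_no_step dom_iff by blast
    then show ?thesis using x False by simp
  qed
next
  fix x assume "x \<in> (\<Union>N\<in>{n..}. pre N B) \<union> (B - dom)"
  then show "x \<in> T -` B \<inter> space M"
  proof
    assume "x \<in> (\<Union>N\<in>{n..}. pre N B)"
    then obtain N D i where D: "D \<in> set (W N)" "Suc i < h N" "level D (Suc i) \<subseteq> B" "x \<in> level D i"
      unfolding pre_def by blast
    have "T x \<in> B" using T_level[OF D(1,2,4)] D(3) by blast
    moreover have "x \<in> space M"
      using sets.sets_into_space[OF level_sets[OF D(1) Suc_lessD[OF D(2)]]] D(4) by blast
    ultimately show ?thesis by simp
  next
    assume x: "x \<in> B - dom"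
    then have "T x = x" using T_no_step dom_iff by blast
    moreover have "x \<in> space M" using x sets.sets_into_space[OF resp_sets[OF B]] by blast
    ultimately show ?thesis using x by simp
  qed
qed

lemma T_space: "x \<in> space M \<Longrightarrow> T x \<in> space M"
proof (cases "x \<in> dom")
  case True
  assume "x \<in> space M"
  obtain n y where s: "stepn n x y" using True dom_iff by blast
  then obtain D i where D: "D \<in> set (W n)" "Suc i < h n" "x \<in> level D i" unfolding stepn_def by blast
  show ?thesis using T_level[OF D] sets.sets_into_space[OF level_sets[OF D(1,2)]] by blast
next
  case False
  assume "x \<in> space M"
  then show ?thesis using T_no_step[of x] False dom_iff by auto
qed

lemma T_measurable: "T \<in> measurable M M"
proof -
  have "T \<in> measurable M (measure_of {0..<1} (\<Union>n. tower_levels (W n)) (emeasure lborel))"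
  proof (rule measurable_measure_of[OF gen_subset])
    show "T \<in> space M \<rightarrow> {0..<1}" using T_space by auto
    fix B assume "B \<in> (\<Union>n. tower_levels (W n))"
    then have "\<exists>n. resp n B" unfolding gen_iff using resp_level by blast
    then obtain n where B: "resp n B" by blast
    show "T -` B \<inter> space M \<in> sets M"
      unfolding vimage_T[OF B] using pre_sets resp_sets[OF B] dom_sets by auto
  qed
  then show ?thesis by (simp add: cs_measure_def)
qed

text \<open>Every level in \<open>B\<close> other than a bottom level has the level below it in its
  preimage, of the same measure. The bottom levels have measure \<open>c N * v N\<close> in
  total.\<close>

lemma measure_vimage_ge:
  assumes B: "resp n B" and "n \<le> N"
  shows "measure M B - real (c N) * v N \<le> measure M (T -` B \<inter> space M)"
proof -
  let ?S = "{(D, i). D \<in> set (W N) \<and> i < h N \<and> level D i \<subseteq> B}"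
  let ?S' = "{(D, i). D \<in> set (W N) \<and> Suc i < h N \<and> level D (Suc i) \<subseteq> B}"
  have fin: "finite ?S" by (rule finite_subset[of _ "set (W N) \<times> {..<h N}"]) auto
  have fin': "finite ?S'" by (rule finite_subset[of _ "set (W N) \<times> {..<h N}"]) auto
  have mB: "measure M B = real (card ?S) * v N"
    using measure_levels(2)[of ?S N] resp_conv[OF resp_mono[OF assms(2,1)]] by auto
  have mp: "measure M (pre N B) = real (card ?S') * v N"
    unfolding pre_def by (rule measure_levels(2)) auto
  have "?S \<subseteq> (\<lambda>D. (D, 0)) ` set (W N) \<union> (\<lambda>(D, i). (D, Suc i)) ` ?S'"
  proof
    fix p assume p: "p \<in> ?S"
    then obtain D i where "p = (D, i)" "D \<in> set (W N)" "i < h N" "level D i \<subseteq> B" by blast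
    then show "p \<in> (\<lambda>D. (D, 0)) ` set (W N) \<union> (\<lambda>(D, i). (D, Suc i)) ` ?S'"
      by (cases i) (auto simp: image_iff)
  qed
  then have "card ?S \<le> card ((\<lambda>D. (D, 0::nat)) ` set (W N) \<union> (\<lambda>(D, i). (D, Suc i)) ` ?S')"
    using fin' by (intro card_mono) auto
  also have "\<dots> \<le> card ((\<lambda>D. (D, 0::nat)) ` set (W N)) + card ((\<lambda>(D, i). (D, Suc i)) ` ?S')"
    by (rule card_Un_le)
  also have "\<dots> \<le> c N + card ?S'"
    using card_image_le[of "set (W N)" "\<lambda>D. (D, 0::nat)"] card_image_le[OF fin', of "\<lambda>(D, i). (D, Suc i)"]
    by (simp add: card_set_W)
  finally have "real (card ?S) * v N \<le> (real (c N) + real (card ?S')) * v N"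
    using W_facts(4)[of N] by (intro mult_right_mono) auto
  then have "measure M B - real (c N) * v N \<le> measure M (pre N B)"
    unfolding mB mp by (simp add: algebra_simps)
  also have "\<dots> \<le> measure M (T -` B \<inter> space M)"
  proof (rule M.finite_measure_mono)
    show "pre N B \<subseteq> T -` B \<inter> space M" unfolding vimage_T[OF B] using assms(2) by auto
    show "T -` B \<inter> space M \<in> sets M" using measurable_sets[OF T_measurable resp_sets[OF B]] .
  qed
  finally show ?thesis .
qed

lemma cv_tendsto: "(\<lambda>n. real (c n) * v n) \<longlonglongrightarrow> 0"
proof (rule tendsto_sandwich[of "\<lambda>_. 0"])
  show "\<forall>\<^sub>F n in sequentially. 0 \<le> real (c n) * v n" using W_facts(4) by (simp add: less_imp_le)
  show "\<forall>\<^sub>F n in sequentially. real (c n) * v n \<le> inverse (real (Suc n))"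
  proof (intro always_eventually allI)
    fix n
    have "real (c n) * v n = mm n / real (h n)" using h_pos[of n] by (simp add: mm_def)
    also have "\<dots> \<le> 1 / real (h n)" using mm_le_1[of n] by (intro divide_right_mono) auto
    also have "\<dots> \<le> 1 / real (Suc n)" using h_gt[of n] by (intro divide_left_mono) auto
    finally show "real (c n) * v n \<le> inverse (real (Suc n))" by (simp add: inverse_eq_divide)
  qed
  show "(\<lambda>n. inverse (real (Suc n))) \<longlonglongrightarrow> 0" by (rule LIMSEQ_inverse_real_of_nat)
qed auto

lemma measure_vimage_ge':
  assumes B: "resp n B"
  shows "measure M B \<le> measure M (T -` B \<inter> space M)"
proof -
  have "(\<lambda>N. measure M B - real (c N) * v N) \<longlonglongrightarrow> measure M B - 0"
    by (intro tendsto_diff tendsto_const cv_tendsto)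
  then have "measure M B - 0 \<le> measure M (T -` B \<inter> space M)"
    by (rule LIMSEQ_le_const2) (use measure_vimage_ge[OF B] in blast)
  then show ?thesis by simp
qed

text \<open>The inequality for the complement \<open>U N - B\<close> yields the reverse inequality
  up to \<open>1 - mm N\<close>, which tends to 0.\<close>

lemma measure_vimage_eq:
  assumes B: "resp n B"
  shows "measure M (T -` B \<inter> space M) = measure M B"
proof (rule antisym)
  have "measure M (T -` B \<inter> space M) \<le> measure M B + (1 - mm N)" if N: "n \<le> N" for N
  proof -
    have B': "resp N B" by (rule resp_mono[OF N B])
    have s: "T -` B \<inter> space M \<in> sets M" "T -` (U N - B) \<inter> space M \<in> sets M"
      using measurable_sets[OF T_measurable] resp_sets[OF B] resp_sets[OF resp_compl[OF B']] by blast+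
    have "measure M (T -` B \<inter> space M) + measure M (T -` (U N - B) \<inter> space M)
       = measure M ((T -` B \<inter> space M) \<union> (T -` (U N - B) \<inter> space M))"
      using s by (intro M.finite_measure_Union[symmetric]) auto
    also have "\<dots> \<le> 1" by simp
    finally have "measure M (T -` B \<inter> space M) \<le> 1 - measure M (U N - B)"
      using measure_vimage_ge'[OF resp_compl[OF B']] by linarith
    also have "measure M (U N - B) = mm N - measure M B"
      using resp_sets[OF B] resp_sets[OF resp_U] B'
      by (subst M.finite_measure_Diff) (auto simp: measure_U resp_def)
    finally show ?thesis by simp
  qed
  moreover have "(\<lambda>N. measure M B + (1 - mm N)) \<longlonglongrightarrow> measure M B + (1 - 1)"
    by (intro tendsto_intros mm_tendsto)
  ultimately have "measure M (T -` B \<inter> space M) \<le> measure M B + (1 - 1)"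
    by (intro LIMSEQ_le_const) auto
  then show "measure M (T -` B \<inter> space M) \<le> measure M B" by simp
qed (rule measure_vimage_ge'[OF B])

lemma T_preserves: "distr M M T = M"
proof -
  \<comment> \<open>One stage need not cover the interval, so the whole interval is adjoined to have
    a covering within the generator.\<close>
  let ?E = "insert {0..<1} {B. \<exists>n. resp n B}"
  have sub: "?E \<subseteq> sets M" using resp_sets sets.top[of M] by auto
  have sig: "sets M = sigma_sets {0..<1} ?E"
  proof
    show "sets M \<subseteq> sigma_sets {0..<1} ?E"
      unfolding sets_M
    proof (rule sigma_sets_mono)
      show "(\<Union>n. tower_levels (W n)) \<subseteq> sigma_sets {0..<1} ?E"
      proof
        fix B assume "B \<in> (\<Union>n. tower_levels (W n))"
        then have "\<exists>n. resp n B" unfolding gen_iff using resp_level by blast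
        then show "B \<in> sigma_sets {0..<1} ?E" by (intro sigma_sets.Basic) blast
      qed
    qed
    show "sigma_sets {0..<1} ?E \<subseteq> sets M"
      using sets.sigma_sets_subset[OF sub] by simp
  qed
  show ?thesis
  proof (rule measure_eqI_generator_eq)
    show "Int_stable ?E"
    proof (rule Int_stableI)
      fix A B assume A: "A \<in> ?E" and B: "B \<in> ?E"
      have "A \<subseteq> {0..<1}" "B \<subseteq> {0..<1}" using A B sub sets.sets_into_space[of _ M] by auto
      moreover have "\<exists>n. resp n (A \<inter> B)" if "resp m A" "resp n B" for m n
        using resp_Int[OF resp_mono[OF _ that(1)] resp_mono[OF _ that(2)]] by (meson max.cobounded1 max.cobounded2)
      ultimately show "A \<inter> B \<in> ?E" using A B by (auto simp: Int_absorb1 Int_absorb2)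
    qed
    show "?E \<subseteq> Pow {0..<1}" using sub sets.sets_into_space[of _ M] by auto
    fix B assume B: "B \<in> ?E"
    show "emeasure (distr M M T) B = emeasure M B"
    proof (cases "B = {0..<1}")
      case True
      have "T -` {0..<1} \<inter> space M = space M" using T_space by auto
      then show ?thesis using True B sub by (subst emeasure_distr[OF T_measurable]) auto
    next
      case False
      then obtain n where n: "resp n B" using B by blast
      show ?thesis
        using measure_vimage_eq[OF n] resp_sets[OF n] measurable_sets[OF T_measurable resp_sets[OF n]]
        by (simp add: emeasure_distr[OF T_measurable] M.emeasure_eq_measure)
    qed
  next
    show "range (\<lambda>_::nat. {0..<1}) \<subseteq> ?E" by auto
    show "(\<Union>i::nat. {0..<1}) = {0..<1::real}" by simp
    show "emeasure (distr M M T) {0..<1} \<noteq> \<infinity>" for i :: nat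
      using prob_space.prob_space_distr[OF prob_space_M T_measurable]
      by (metis ennreal_one_neq_top infinity_ennreal_def prob_space.emeasure_space_1 space_M space_distr)
  qed (simp_all add: sig)
qed

sublocale S: pmp M T
  by unfold_locales (rule T_measurable, rule T_preserves)

text \<open>The sets that can be approximated arbitrarily well form a sigma-algebra. Complements are
  taken inside \<open>U N\<close>, for \<open>N\<close> so large that the rest of the interval is
  small.\<close>

lemma approx:
  assumes "A \<in> sets M"
  shows "0 < \<epsilon> \<Longrightarrow> \<exists>n B. resp n B \<and> measure M (sym_diff A B) < \<epsilon>"
proof -
  have "A \<in> sigma_sets {0..<1} (\<Union>n. tower_levels (W n))" using assms by (simp add: sets_M)
  then show "0 < \<epsilon> \<Longrightarrow> \<exists>n B. resp n B \<and> measure M (sym_diff A B) < \<epsilon>"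
  proof (induction arbitrary: \<epsilon>)
    case (Basic A)
    then have "\<exists>n. resp n A" unfolding gen_iff using resp_level by blast
    then obtain n where "resp n A" by blast
    then show ?case using Basic.prems by (intro exI[of _ n] exI[of _ A]) simp
  next
    case Empty
    then show ?case by (intro exI[of _ 0] exI[of _ "{}"]) (simp add: resp_empty)
  next
    case (Compl A)
    have A: "A \<in> sets M" using Compl.hyps by (simp add: sets_M)
    obtain n B where B: "resp n B" "measure M (sym_diff A B) < \<epsilon> / 2"
      using Compl.IH[of "\<epsilon> / 2"] Compl.prems by auto
    have "\<forall>\<^sub>F N in sequentially. 1 - \<epsilon> / 2 < mm N"
      using order_tendstoD(1)[OF mm_tendsto, of "1 - \<epsilon> / 2"] Compl.prems by simp
    then obtain N where N: "n \<le> N" "1 - \<epsilon> / 2 < mm N"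
      unfolding eventually_sequentially by (metis linorder_linear)
    have BN: "resp N B" by (rule resp_mono[OF N(1) B(1)])
    have s: "sym_diff A B \<in> sets M" "space M - U N \<in> sets M"
      using A resp_sets[OF B(1)] sets.compl_sets[OF resp_sets[OF resp_U[of N]]] by auto
    have "measure M (sym_diff ({0..<1} - A) (U N - B)) \<le> measure M (sym_diff A B \<union> (space M - U N))"
      using s sets.sets_into_space[OF A] resp_sets[OF B(1), THEN sets.sets_into_space] W_facts(3)[of N]
      by (intro M.finite_measure_mono) auto
    also have "\<dots> \<le> measure M (sym_diff A B) + measure M (space M - U N)"
      using s by (intro measure_Un_le)
    also have "measure M (space M - U N) = 1 - mm N"
      using M.prob_compl[OF resp_sets[OF resp_U[of N]]] by (simp add: measure_U)
    finally have "measure M (sym_diff ({0..<1} - A) (U N - B)) < \<epsilon>" using B(2) N(2) by linarith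
    then show ?case using resp_compl[OF BN] by blast
  next
    case (Union A)
    have A: "A i \<in> sets M" for i using Union.hyps by (simp add: sets_M)
    have "(\<lambda>k. measure M (\<Union>i<k. A i)) \<longlonglongrightarrow> measure M (\<Union>k. \<Union>i<k. A i)"
    proof (rule M.finite_Lim_measure_incseq)
      show "incseq (\<lambda>k. \<Union>i<k. A i)" by (rule incseq_SucI) (auto simp: less_Suc_eq)
    qed (use A in auto)
    moreover have "(\<Union>k. \<Union>i<k. A i) = (\<Union>i. A i)" by auto
    ultimately have "\<forall>\<^sub>F k in sequentially. measure M (\<Union>i. A i) - \<epsilon> / 2 < measure M (\<Union>i<k. A i)"
      using order_tendstoD(1)[of _ "measure M (\<Union>i. A i)" sequentially "measure M (\<Union>i. A i) - \<epsilon> / 2"] Union.prems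
      by simp
    then obtain k where k: "measure M (\<Union>i. A i) - \<epsilon> / 2 < measure M (\<Union>i<k. A i)"
      unfolding eventually_sequentially by blast
    have "\<exists>n B. resp n B \<and> measure M (sym_diff (A i) B) < \<epsilon> / (2 * real (Suc k))" for i
      using Union.IH[of "\<epsilon> / (2 * real (Suc k))" i] Union.prems by simp
    then obtain n B where nB: "\<And>i. resp (n i) (B i)" "\<And>i. measure M (sym_diff (A i) (B i)) < \<epsilon> / (2 * real (Suc k))"
      by metis
    define m where "m = Max (n ` {..<Suc k})"
    have "resp m (\<Union>i<k. B i)"
      by (rule resp_UN) (auto simp: m_def intro!: resp_mono[OF _ nB(1)] Max_ge)
    moreover have "measure M (sym_diff (\<Union>i. A i) (\<Union>i<k. B i)) < \<epsilon>"
    proof -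
      have sB: "B i \<in> sets M" for i using resp_sets[OF nB(1)] .
      have "measure M (sym_diff (\<Union>i. A i) (\<Union>i<k. B i))
         \<le> measure M (((\<Union>i. A i) - (\<Union>i<k. A i)) \<union> (\<Union>i<k. sym_diff (A i) (B i)))"
        using A sB by (intro M.finite_measure_mono) auto
      also have "\<dots> \<le> measure M ((\<Union>i. A i) - (\<Union>i<k. A i)) + measure M (\<Union>i<k. sym_diff (A i) (B i))"
        using A sB by (intro measure_Un_le) auto
      also have "measure M ((\<Union>i. A i) - (\<Union>i<k. A i)) = measure M (\<Union>i. A i) - measure M (\<Union>i<k. A i)"
        using A by (intro M.finite_measure_Diff) auto
      also have "measure M (\<Union>i<k. sym_diff (A i) (B i)) \<le> (\<Sum>i<k. measure M (sym_diff (A i) (B i)))"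
        using A sB by (intro measure_UNION_le) auto
      also have "\<dots> \<le> (\<Sum>i<k. \<epsilon> / (2 * real (Suc k)))"
        using nB(2) by (intro sum_mono) (simp add: less_imp_le)
      also have "\<dots> \<le> \<epsilon> / 2" using Union.prems by (simp add: field_simps)
      finally show ?thesis using k by linarith
    qed
    ultimately show ?case by blast
  qed
qed

end

subsection \<open>Entropy along tuples of independent blocks\<close>

lemma tuples_Suc: "tuples c (Suc e) = (\<lambda>(a, J). a # J) ` ({1..c} \<times> tuples c e)"
proof (intro set_eqI iffI)
  fix J assume "J \<in> tuples c (Suc e)"
  then show "J \<in> (\<lambda>(a, J). a # J) ` ({1..c} \<times> tuples c e)"
    by (cases J) (auto simp: tuples_def image_iff)
qed (auto simp: tuples_def)

lemma sum_tuples_Suc: "(\<Sum>J\<in>tuples c (Suc e). f J) = (\<Sum>a\<in>{1..c}. \<Sum>J\<in>tuples c e. f (a # J))"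
proof -
  have "(\<Sum>J\<in>tuples c (Suc e). f J) = (\<Sum>x\<in>{1..c} \<times> tuples c e. f (fst x # snd x))"
    unfolding tuples_Suc by (subst sum.reindex) (auto simp: inj_on_def split_def comp_def)
  then show ?thesis by (simp add: sum.cartesian_product split_def)
qed

lemma fent_tuples_Suc: "fent (tuples c (Suc e)) f = fent ({1..c} \<times> tuples c e) (\<lambda>x. f (fst x # snd x))"
proof -
  have "fent ({1..c} \<times> tuples c e) (f \<circ> (\<lambda>(a, J). a # J)) = fent (tuples c (Suc e)) f"
  proof (rule fent_reindex[where k = 1])
    show "finite ({1..c} \<times> tuples c e)" using finite_tuples by simp
    show "(\<lambda>(a, J). a # J) ` ({1..c} \<times> tuples c e) = tuples c (Suc e)" by (simp add: tuples_Suc)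
    fix J assume "J \<in> tuples c (Suc e)"
    then obtain a I where "J = a # I" "a \<in> {1..c}" "I \<in> tuples c e" unfolding tuples_Suc by auto
    then have "{x \<in> {1..c} \<times> tuples c e. (case x of (a, J) \<Rightarrow> a # J) = J} = {(a, I)}" by auto
    then show "card {x \<in> {1..c} \<times> tuples c e. (case x of (a, J) \<Rightarrow> a # J) = J} = 1" by simp
  qed simp
  then show ?thesis by (simp add: comp_def split_def)
qed

lemma tuples_ne: "0 < c \<Longrightarrow> tuples c e \<noteq> {}"
  using card_tuples[of c e] by (metis card.empty less_irrefl zero_less_power)

text \<open>Induction from the front: the first entry influences symbol 0 only, and all other
  symbols are functions of the tail. Given the tail the first entry is uniform, so
  \<open>fent_chain\<close> adds one entropy, and averaging over tails leaves the average over the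
  second entry \<open>a'\<close>.\<close>

lemma fent_tuples_aux:
  fixes g :: "nat \<Rightarrow> nat \<Rightarrow> 'd"
  assumes c: "0 < c" and "K \<subseteq> {..<e}"
  defines "G \<equiv> \<lambda>K J k. if k \<in> K then Some (g (J ! k) (J ! Suc k)) else None"
  shows "real (card K) * ((\<Sum>a'\<in>{1..c}. fent {1..c} (\<lambda>a. g a a')) / real c) \<le> fent (tuples c (Suc e)) (G K)"
  using assms(2)
proof (induction e arbitrary: K)
  case 0
  then show ?case using fent_nonneg[OF finite_tuples] by simp
next
  case (Suc e)
  let ?A = "{1..c}" and ?B = "tuples c (Suc e)"
  let ?avg = "(\<Sum>a'\<in>?A. fent ?A (\<lambda>a. g a a')) / real c"
  define K' where "K' = {k. Suc k \<in> K}"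
  have finK: "finite K" using Suc.prems by (rule finite_subset) simp
  have K'sub: "K' \<subseteq> {..<e}" using Suc.prems by (auto simp: K'_def)
  then have finK': "finite K'" by (rule finite_subset) simp
  define F where "F = (\<lambda>b a. if 0 \<in> K then Some (g a (b ! 0)) else None)"
  have h1: "fent ?B (G K') + (\<Sum>b\<in>?B. fent ?A (F b)) / real (card ?B) \<le> fent (?A \<times> ?B) (\<lambda>x. G K (fst x # snd x))"
  proof (rule fent_chain)
    show "finite ?B" "?B \<noteq> {}" using finite_tuples tuples_ne[OF c] by auto
    show "finite ?A" "?A \<noteq> {}" using c by auto
    fix a b a' b' assume *: "G K (fst (a, b) # snd (a, b)) = G K (fst (a', b') # snd (a', b'))"
    have "G K' b k = G K' b' k" for k
      using fun_cong[OF *, of "Suc k"] by (auto simp: G_def K'_def split: if_splits)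
    moreover have "F b a = F b' a'" using fun_cong[OF *, of 0] by (auto simp: F_def G_def split: if_splits)
    ultimately show "G K' b = G K' b' \<and> F b a = F b' a'" by blast
  qed
  have h2: "real (card K') * ?avg \<le> fent ?B (G K')" by (rule Suc.IH[OF K'sub])
  have h3: "(if 0 \<in> K then 1 else 0) * ?avg \<le> (\<Sum>b\<in>?B. fent ?A (F b)) / real (card ?B)"
  proof (cases "0 \<in> K")
    case True
    have "fent ?A (F b) = fent ?A (\<lambda>a. g a (b ! 0))" for b
      using True by (intro antisym fent_mono) (auto simp: F_def)
    then have "(\<Sum>b\<in>?B. fent ?A (F b)) = real (card (tuples c e)) * (\<Sum>a'\<in>?A. fent ?A (\<lambda>a. g a a'))"
      unfolding sum_tuples_Suc by (simp add: sum_distrib_left)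
    then show ?thesis using True c by (simp add: card_tuples)
  next
    case False
    then show ?thesis by (auto intro!: divide_nonneg_nonneg sum_nonneg fent_nonneg)
  qed
  have h4: "card K = card K' + (if 0 \<in> K then 1 else 0)"
  proof -
    have "K = Suc ` K' \<union> (if 0 \<in> K then {0} else {})"
    proof (intro set_eqI iffI)
      fix k assume "k \<in> K" then show "k \<in> Suc ` K' \<union> (if 0 \<in> K then {0} else {})"
        by (cases k) (auto simp: K'_def)
    qed (auto simp: K'_def split: if_splits)
    then have "card K = card (Suc ` K' \<union> (if 0 \<in> K then {0} else {}))" by simp
    also have "\<dots> = card K' + (if 0 \<in> K then 1 else 0)"
      using finK' by (subst card_Un_disjoint) (auto simp: card_image)
    finally show ?thesis .
  qed
  have "real (card K) * ?avg = real (card K') * ?avg + (if 0 \<in> K then 1 else 0) * ?avg"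
    unfolding h4 of_nat_add distrib_right by simp
  then show ?case unfolding fent_tuples_Suc[of c "Suc e"] using h1 h2 h3 by linarith
qed

lemma fent_tuples:
  assumes c: "0 < c" and "K \<subseteq> {..<e}"
    and "\<And>J J' k. J \<in> tuples c (Suc e) \<Longrightarrow> J' \<in> tuples c (Suc e) \<Longrightarrow> f J = f J' \<Longrightarrow> k \<in> K
      \<Longrightarrow> g (J ! k) (J ! Suc k) = g (J' ! k) (J' ! Suc k)"
  shows "real (card K) * ((\<Sum>a'\<in>{1..c}. fent {1..c} (\<lambda>a. g a a')) / real c) \<le> fent (tuples c (Suc e)) f"
proof -
  have "fent (tuples c (Suc e)) (\<lambda>J k. if k \<in> K then Some (g (J ! k) (J ! Suc k)) else None)
      \<le> fent (tuples c (Suc e)) f"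
  proof (rule fent_mono[OF finite_tuples], rule ext)
    fix J J' k assume "J \<in> tuples c (Suc e)" "J' \<in> tuples c (Suc e)" "f J = f J'"
    from assms(3)[OF this, of k]
    show "(if k \<in> K then Some (g (J ! k) (J ! Suc k)) else None)
        = (if k \<in> K then Some (g (J' ! k) (J' ! Suc k)) else None)" by simp
  qed
  then show ?thesis by (rule order_trans[OF fent_tuples_aux[OF c assms(2), of g]])
qed

lemma sum_tuples_hd:
  "0 < c \<Longrightarrow> (\<Sum>J\<in>tuples c (Suc e). f (J ! 0)) / real c ^ Suc e = (\<Sum>a\<in>{1..c}. (f a :: real)) / real c"
  by (simp add: sum_tuples_Suc card_tuples sum_distrib_left[symmetric])

text \<open>Two neighbouring entries of a uniform tuple are independent and uniform.\<close>

lemma sum_tuples_pair: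
  assumes c: "0 < c"
  shows "k < e \<Longrightarrow> (\<Sum>J\<in>tuples c (Suc e). f (J ! k) (J ! Suc k)) / real c ^ Suc e
     = (\<Sum>a\<in>{1..c}. \<Sum>a'\<in>{1..c}. (f a a' :: real)) / (real c * real c)"
proof (induction e arbitrary: k)
  case (Suc e)
  show ?case
  proof (cases k)
    case 0
    have "(\<Sum>J\<in>tuples c (Suc (Suc e)). f (J ! k) (J ! Suc k)) / real c ^ Suc (Suc e)
        = (\<Sum>a\<in>{1..c}. (\<Sum>J\<in>tuples c (Suc e). f a (J ! 0)) / real c ^ Suc e) / real c"
      unfolding sum_tuples_Suc[where c = c and e = "Suc e"] 0 by (simp add: sum_divide_distrib[symmetric] field_simps)
    also have "\<dots> = (\<Sum>a\<in>{1..c}. (\<Sum>a'\<in>{1..c}. f a a') / real c) / real c"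
      by (simp only: sum_tuples_hd[OF c])
    finally show ?thesis by (simp add: sum_divide_distrib[symmetric])
  next
    case (Suc k')
    have "(\<Sum>J\<in>tuples c (Suc (Suc e)). f (J ! k) (J ! Suc k)) / real c ^ Suc (Suc e)
        = (real c * (\<Sum>J\<in>tuples c (Suc e). f (J ! k') (J ! Suc k'))) / real c ^ Suc (Suc e)"
      unfolding sum_tuples_Suc[where c = c and e = "Suc e"] Suc by simp
    also have "\<dots> = (\<Sum>J\<in>tuples c (Suc e). f (J ! k') (J ! Suc k')) / real c ^ Suc e"
      using c by simp
    finally show ?thesis using Suc.IH[of k'] Suc.prems \<open>k = Suc k'\<close> by simp
  qed
qed simp

section \<open>Sums of periodic functions and offsets\<close>

lemma sum_periodic_window:
  fixes f :: "nat \<Rightarrow> real"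
  assumes "\<And>x. f (x + h) = f x"
  shows "(\<Sum>q\<in>{a..<a + h}. f q) = (\<Sum>q<h. f q)"
proof (induction a)
  case (Suc a)
  have "(\<Sum>q\<in>{Suc a..<Suc a + h}. f q) + f a = (\<Sum>q\<in>{a..<Suc (a + h)}. f q)"
    by (subst (2) sum.atLeast_Suc_lessThan) auto
  also have "\<dots> = (\<Sum>q\<in>{a..<a + h}. f q) + f (a + h)" by simp
  finally show ?case using Suc assms by simp
qed (simp add: atLeast0LessThan)

lemma sum_periodic:
  fixes f :: "nat \<Rightarrow> real"
  assumes "\<And>x. f (x + h) = f x"
  shows "(\<Sum>q\<in>{a..<a + m * h}. f q) = real m * (\<Sum>q<h. f q)"
proof (induction m)
  case (Suc m)
  have "(\<Sum>q\<in>{a..<a + Suc m * h}. f q) = (\<Sum>q\<in>{a..<a + m * h}. f q) + (\<Sum>q\<in>{a + m * h..<a + m * h + h}. f q)"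
    by (subst sum.atLeastLessThan_concat) (auto simp: algebra_simps)
  then show ?case using Suc sum_periodic_window[where f = f and h = h and a = "a + m * h", OF assms] by (simp add: algebra_simps)
qed simp

lemma sum_reflect_mod:
  fixes f :: "nat \<Rightarrow> real"
  assumes "0 < h" "h \<le> q"
  shows "(\<Sum>a<h. f ((q - a) mod h)) = (\<Sum>i<h. f i)"
proof -
  have "(\<Sum>a<h. f ((q - a) mod h)) = (\<Sum>x\<in>{Suc q - h..<Suc q - h + h}. f (x mod h))"
    using assms
    by (intro sum.reindex_bij_witness[of _ "\<lambda>x. q - x" "\<lambda>a. q - a"]) auto
  also have "\<dots> = (\<Sum>q<h. f (q mod h))" by (rule sum_periodic_window) simp
  finally show ?thesis by simp
qed

text \<open>Every residue modulo \<open>h\<close> occurs at least \<open>c div h\<close> times among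
  \<open>1, ..., c\<close>, and \<open>c div h \<ge> c / (2 * h)\<close> because
  \<open>h \<le> c\<close>. Thus every phase receives at least half of its fair share.\<close>

lemma sum_offset_ge:
  fixes f :: "nat \<Rightarrow> real"
  assumes h: "0 < h" "h \<le> q" "h \<le> c" and f: "\<And>i. 0 \<le> f i"
  shows "real c / 2 * ((\<Sum>i<h. f i) / real h) \<le> (\<Sum>a\<in>{1..c}. f ((q - a mod h) mod h))"
proof -
  define m where "m = c div h"
  have m: "m * h \<le> c" "c \<le> 2 * (m * h)"
  proof -
    have "c = m * h + c mod h" by (simp add: m_def)
    moreover have "c mod h < h" using h(1) by simp
    moreover have "1 \<le> m" using h by (simp add: m_def div_greater_zero_iff Suc_le_eq)
    then have "h \<le> m * h" by simp
    ultimately show "m * h \<le> c" "c \<le> 2 * (m * h)" by linarith+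
  qed
  have "(\<Sum>a\<in>{1..<1 + m * h}. f ((q - a mod h) mod h)) = real m * (\<Sum>a<h. f ((q - a mod h) mod h))"
    by (rule sum_periodic) simp
  also have "(\<Sum>a<h. f ((q - a mod h) mod h)) = (\<Sum>a<h. f ((q - a) mod h))"
    by (rule sum.cong) auto
  also have "\<dots> = (\<Sum>i<h. f i)" by (rule sum_reflect_mod[OF h(1,2)])
  finally have 1: "(\<Sum>a\<in>{1..<1 + m * h}. f ((q - a mod h) mod h)) = real m * (\<Sum>i<h. f i)" .
  have "real c / 2 * ((\<Sum>i<h. f i) / real h) \<le> real (m * h) * ((\<Sum>i<h. f i) / real h)"
  proof (rule mult_right_mono)
    have "real c \<le> real (2 * (m * h))" using m(2) by (simp only: of_nat_le_iff)
    then show "real c / 2 \<le> real (m * h)" by simp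
  qed (auto intro!: divide_nonneg_nonneg sum_nonneg f)
  also have "\<dots> = real m * (\<Sum>i<h. f i)" using h(1) by simp
  also have "\<dots> \<le> (\<Sum>a\<in>{1..c}. f ((q - a mod h) mod h))"
    unfolding 1[symmetric] using m(1) f by (intro sum_mono2) auto
  finally show ?thesis .
qed

lemma nth_concat_uniform:
  "(\<And>xs. xs \<in> set xss \<Longrightarrow> length xs = L) \<Longrightarrow> k < length xss \<Longrightarrow> q < L \<Longrightarrow> concat xss ! (k * L + q) = xss ! k ! q"
proof (induction xss arbitrary: k)
  case (Cons xs xss)
  have L: "length xs = L" using Cons.prems by simp
  show ?case
  proof (cases k)
    case 0
    then show ?thesis using L Cons.prems by (simp add: nth_append)
  next
    case (Suc k')
    then show ?thesis using L Cons.IH[of k'] Cons.prems by (simp add: nth_append)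
  qed
qed simp

lemma nth_concat_replicate: "0 < length u \<Longrightarrow> q < r * length u \<Longrightarrow> concat (replicate r u) ! q = u ! (q mod length u)"
proof -
  assume u: "0 < length u" and q: "q < r * length u"
  then have "q div length u < r" by (simp add: div_less_iff_less_mult)
  then have "concat (replicate r u) ! (q div length u * length u + q mod length u)
      = replicate r u ! (q div length u) ! (q mod length u)"
    using u by (intro nth_concat_uniform) auto
  then show ?thesis using \<open>q div length u < r\<close> by simp
qed

lemma built_bits:
  assumes "built v Z its E" "0 < v" "\<And>x. x \<in> Z \<Longrightarrow> x \<notin> B"
    and "\<And>D i y. Some D \<in> set its \<Longrightarrow> i < col_height D \<Longrightarrow> y \<in> level D i \<Longrightarrow> y \<in> B \<longleftrightarrow> col_ends D ! i \<in> B"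
  shows "map (\<lambda>a. a \<in> B) E
     = concat (map (\<lambda>it. case it of None \<Rightarrow> [False] | Some D \<Rightarrow> map (\<lambda>a. a \<in> B) (col_ends D)) its)"
  using assms
proof (induction rule: built.induct)
  case (Some its E d D)
  have "map (\<lambda>a. a + d \<in> B) (col_ends D) = map (\<lambda>a. a \<in> B) (col_ends D)"
  proof (rule nth_equalityI)
    fix i assume "i < length (map (\<lambda>a. a + d \<in> B) (col_ends D))"
    then have i: "i < col_height D" by simp
    have "col_ends D ! i + d \<in> level D i" using Some.hyps Some.prems(1) by (auto simp: level_def)
    then show "map (\<lambda>a. a + d \<in> B) (col_ends D) ! i = map (\<lambda>a. a \<in> B) (col_ends D) ! i"
      using Some.prems(3)[of D i] i by auto
  qed simp
  then show ?case using Some.IH Some.prems by (simp add: comp_def)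
next
  case (None its E a)
  have "a \<in> Z" using None by auto
  then show ?case using None by simp
qed simp

context cs_sys
begin

subsection \<open>Names of columns\<close>

text \<open>The name is read cyclically. It is the itinerary of an actual point only as long as
  \<open>p + s < h n\<close>; the wrap makes a change of the starting position a mere
  rotation.\<close>

definition obs :: "real set \<Rightarrow> nat \<Rightarrow> nat set \<Rightarrow> nat \<Rightarrow> column \<Rightarrow> nat set" where
  "obs B n N p D = {s\<in>N. col_ends D ! ((p + s) mod h n) \<in> B}"

definition frac :: "real set \<Rightarrow> nat \<Rightarrow> nat \<Rightarrow> real" where
  "frac B n p = real (card {D\<in>set (W n). col_ends D ! p \<in> B}) / real (c n)"

definition En :: "real set \<Rightarrow> nat \<Rightarrow> nat set \<Rightarrow> nat \<Rightarrow> real" where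
  "En B n N p = fent (set (W n)) (obs B n N p)"

definition Es :: "real set \<Rightarrow> nat \<Rightarrow> nat set \<Rightarrow> real" where
  "Es B n N = (\<Sum>p<h n. En B n N p)"

lemma obs_periodic: "obs B n N (p + h n) = obs B n N p"
proof -
  have "(p + h n + s) mod h n = (p + s) mod h n" for s
    using mod_add_self2[of "p + s" "h n"] by (simp only: ac_simps)
  then show ?thesis unfolding obs_def by simp
qed

lemma En_periodic: "En B n N (p + h n) = En B n N p"
  by (simp add: En_def obs_periodic)

lemma En_nonneg: "0 \<le> En B n N p"
  unfolding En_def by (rule fent_nonneg) simp

lemma Es_nonneg: "0 \<le> Es B n N"
  unfolding Es_def by (intro sum_nonneg En_nonneg)

lemma resp_bit: "resp n B \<Longrightarrow> D \<in> set (W n) \<Longrightarrow> i < h n \<Longrightarrow> x \<in> level D i \<Longrightarrow> x \<in> B \<longleftrightarrow> col_ends D ! i \<in> B"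
proof -
  assume *: "resp n B" "D \<in> set (W n)" "i < h n" "x \<in> level D i"
  have "col_ends D ! i \<in> level D i" using W_facts(4)[of n] W_facts(6)[OF *(2)] by (simp add: level_def)
  then show ?thesis using * unfolding resp_def by blast
qed

lemma W_index_bij: "bij_betw (\<lambda>i. W n ! (i - 1)) {1..c n} (set (W n))"
proof (rule bij_betw_imageI)
  show "inj_on (\<lambda>i. W n ! (i - 1)) {1..c n}"
    using distinct_W[of n] by (auto simp: inj_on_def c_def nth_eq_iff_index_eq)
  show "(\<lambda>i. W n ! (i - 1)) ` {1..c n} = set (W n)"
  proof (intro set_eqI iffI)
    fix D assume "D \<in> set (W n)"
    then obtain i where "i < c n" "D = W n ! i" by (auto simp: in_set_conv_nth c_def)
    then show "D \<in> (\<lambda>i. W n ! (i - 1)) ` {1..c n}" by (intro image_eqI[of _ _ "Suc i"]) auto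
  qed (auto simp: c_def)
qed

lemma fent_index: "fent {1..c n} (\<lambda>i. f (W n ! (i - 1))) = fent (set (W n)) f"
proof -
  have "fent {1..c n} (f \<circ> (\<lambda>i. W n ! (i - 1))) = fent (set (W n)) f"
  proof (rule fent_reindex[where k = 1])
    show "(\<lambda>i. W n ! (i - 1)) ` {1..c n} = set (W n)" using W_index_bij by (rule bij_betw_imp_surj_on)
    fix D assume "D \<in> set (W n)"
    then obtain i where i: "i \<in> {1..c n}" "D = W n ! (i - 1)"
      using W_index_bij[of n] by (metis (no_types, lifting) bij_betw_imp_surj_on imageE)
    have "{x \<in> {1..c n}. W n ! (x - 1) = D} = {i}"
      using i W_index_bij[of n] unfolding bij_betw_def inj_on_def by blast
    then show "card {x \<in> {1..c n}. W n ! (x - 1) = D} = 1" by simp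
  qed auto
  then show ?thesis by (simp add: comp_def)
qed

lemma frac_index: "(\<Sum>a\<in>{1..c n}. of_bool (col_ends (W n ! (a - 1)) ! p \<in> B)) / real (c n) = frac B n p"
proof -
  have "(\<Sum>a\<in>{1..c n}. of_bool (col_ends (W n ! (a - 1)) ! p \<in> B) :: real)
      = (\<Sum>D\<in>set (W n). of_bool (col_ends D ! p \<in> B))"
    by (rule sum.reindex_bij_betw[OF W_index_bij])
  also have "\<dots> = real (card {D\<in>set (W n). col_ends D ! p \<in> B})"
    by (simp add: of_bool_def sum.If_cases Int_def)
  finally show ?thesis by (simp add: frac_def)
qed

definition word :: "real set \<Rightarrow> column \<Rightarrow> bool list" where
  "word B D = map (\<lambda>a. a \<in> B) (col_ends D)"

lemma TT_nth: "J \<in> TT n \<Longrightarrow> k < e n \<Longrightarrow> W n ! (J ! k - 1) \<in> set (W n)"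
proof -
  assume J: "J \<in> TT n" and k: "k < e n"
  have "J ! k \<in> set J" using J k by (auto simp: TT_def tuples_def)
  then have "J ! k \<in> {1..c n}" using J by (auto simp: TT_def tuples_def)
  then show ?thesis unfolding c_def by (intro nth_mem) auto
qed

lemma off_le: "off (hs n) i \<le> hs n"
  by (auto simp: off_def less_imp_le)

lemma word_plan:
  assumes B: "resp n B" and J: "J \<in> TT n"
    and b: "built (v (Suc n)) ({0..<1} - U n) (pln n J) E"
  shows "map (\<lambda>a. a \<in> B) E = concat (map (\<lambda>k. replicate (off (hs n) (J ! Suc k)) False
      @ concat (replicate (rr n) (word B (W n ! (J ! k - 1))))
      @ replicate (hs n - off (hs n) (J ! Suc k)) False) [0..<e n])"
proof -
  let ?bits = "\<lambda>it. case it of None \<Rightarrow> [False] | Some D \<Rightarrow> map (\<lambda>a. a \<in> B) (col_ends D)"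
  have mem: "D \<in> set (W n)" if "Some D \<in> set (pln n J)" for D
    using plan_items[of J "W n" "e n"] J that unfolding TT_def pln_def c_def by blast
  have "map (\<lambda>a. a \<in> B) E = concat (map ?bits (pln n J))"
  proof (rule built_bits[OF b])
    show "0 < v (Suc n)" by (rule W_facts(4))
    show "x \<notin> B" if "x \<in> {0..<1} - U n" for x using that B unfolding resp_def by blast
    show "y \<in> B \<longleftrightarrow> col_ends D ! i \<in> B" if "Some D \<in> set (pln n J)" "i < col_height D" "y \<in> level D i" for D i y
      using resp_bit[OF B mem[OF that(1)] _ that(3)] that(2) W_facts(7)[OF mem[OF that(1)]] by simp
  qed
  also have "\<dots> = concat (map (\<lambda>k. concat (map ?bits (seg_items (W n) (rr n) (hs n) (J ! k) (J ! Suc k)))) [0..<e n])"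
    unfolding pln_def plan_def map_concat concat_concat_map by (simp add: comp_def)
  finally have E: "map (\<lambda>a. a \<in> B) E = \<dots>" .
  have concN: "concat (map ?bits (replicate j None)) = replicate j False" for j
    by (induction j) auto
  have concS: "concat (map ?bits (replicate j (Some D))) = concat (replicate j (word B D))" for j D
    by (simp add: word_def)
  show ?thesis unfolding E seg_items_def map_append concat_append concN concS ..
qed

lemma length_word: "D \<in> set (W n) \<Longrightarrow> length (word B D) = h n"
  by (simp add: word_def W_facts(7))

text \<open>Inside the repeated part of block \<open>k\<close> a bit depends on the tuple through
  entries \<open>k\<close> and \<open>k + 1\<close> only.\<close>

lemma nth_plan:
  assumes B: "resp n B" and J: "J \<in> TT n"
    and b: "built (v (Suc n)) ({0..<1} - U n) (pln n J) E"
    and k: "k < e n" and q: "q < w n" "off (hs n) (J ! Suc k) \<le> q" "q < off (hs n) (J ! Suc k) + rr n * h n"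
  shows "E ! (k * w n + q) \<in> B \<longleftrightarrow> col_ends (W n ! (J ! k - 1)) ! ((q - off (hs n) (J ! Suc k)) mod h n) \<in> B"
proof -
  let ?o = "off (hs n) (J ! Suc k)"
  let ?u = "word B (W n ! (J ! k - 1))"
  let ?seg = "\<lambda>k. replicate (off (hs n) (J ! Suc k)) False
      @ concat (replicate (rr n) (word B (W n ! (J ! k - 1))))
      @ replicate (hs n - off (hs n) (J ! Suc k)) False"
  note E = word_plan[OF B J b]
  note lenu = length_word[OF TT_nth[OF J], of _ B]
  have lenseg: "length (?seg k) = w n" if "k < e n" for k
    using lenu[OF that] off_le[of n "J ! Suc k"]
    by (simp add: length_concat sum_list_replicate w_conv mult.commute)
  have kw: "k * w n + q < e n * w n"
  proof -
    have "Suc k * w n \<le> e n * w n" using k by (intro mult_right_mono) auto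
    then show ?thesis using q(1) by simp
  qed
  have lenE: "length E = e n * w n"
  proof -
    have "length E = length (concat (map ?seg [0..<e n]))" using arg_cong[OF E, of length] by simp
    also have "\<dots> = (\<Sum>k\<leftarrow>[0..<e n]. length (?seg k))" by (simp add: length_concat comp_def)
    also have "\<dots> = (\<Sum>k\<leftarrow>[0..<e n]. w n)"
      by (intro arg_cong[where f=sum_list] map_cong refl lenseg) auto
    finally show ?thesis by (simp add: sum_list_triv)
  qed
  have "(E ! (k * w n + q) \<in> B) = map (\<lambda>a. a \<in> B) E ! (k * w n + q)"
    using kw lenE by simp
  also have "\<dots> = map ?seg [0..<e n] ! k ! q"
    unfolding E using k q(1) lenseg by (intro nth_concat_uniform) auto
  also have "\<dots> = ?seg k ! q" using k by simp
  also have "\<dots> = concat (replicate (rr n) ?u) ! (q - ?o)"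
    using q lenu[OF k] by (auto simp: nth_append length_concat sum_list_replicate)
  also have "\<dots> = ?u ! ((q - ?o) mod h n)"
  proof -
    have "q - ?o < rr n * h n" using q(2,3) by simp
    then have "concat (replicate (rr n) ?u) ! (q - ?o) = ?u ! ((q - ?o) mod length ?u)"
      unfolding lenu[OF k, symmetric] using h_pos[of n] lenu[OF k] by (intro nth_concat_replicate) auto
    then show ?thesis by (simp only: lenu[OF k])
  qed
  also have "\<dots> = (col_ends (W n ! (J ! k - 1)) ! ((q - ?o) mod h n) \<in> B)"
    using h_pos[of n] W_facts(7)[OF TT_nth[OF J k]] by (simp add: word_def)
  finally show ?thesis .
qed

text \<open>Entries \<open>k\<close> and \<open>k + 1\<close> are independent: averaging over the
  first turns the bit into \<open>frac\<close>, and averaging over the second remains as an average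
  over offsets. The bounds on \<open>q\<close> keep the position in the repeated part for every
  offset.\<close>

lemma frac_Suc:
  assumes B: "resp n B" and k: "k < e n" and q: "hs n \<le> q" "q < rr n * h n"
  shows "frac B (Suc n) (k * w n + q) = (\<Sum>a'\<in>{1..c n}. frac B n ((q - off (hs n) a') mod h n)) / real (c n)"
proof -
  obtain P \<kappa> where P: "\<kappa> > 0" "P ` TT n = set (W (Suc n))"
    "\<And>D. D \<in> set (W (Suc n)) \<Longrightarrow> card {J\<in>TT n. P J = D} = \<kappa>"
    "\<And>J. J \<in> TT n \<Longrightarrow> built (v (Suc n)) ({0..<1} - U n) (pln n J) (col_ends (P J))"
    by (rule step_rel_obtain[of n]) blast
  have c: "0 < c n" by (rule W_facts(5))
  have fin: "finite (TT n)" unfolding TT_def by (rule finite_tuples)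
  have fib: "(\<Sum>J\<in>TT n. f (P J)) = real \<kappa> * (\<Sum>D\<in>set (W (Suc n)). f D)" for f :: "column \<Rightarrow> real"
  proof -
    have "(\<Sum>J\<in>TT n. f (P J)) = (\<Sum>D\<in>set (W (Suc n)). \<Sum>J\<in>{J\<in>TT n. P J = D}. f (P J))"
      using sum.image_gen[OF fin, of "\<lambda>J. f (P J)" P] P(2) by simp
    also have "\<dots> = (\<Sum>D\<in>set (W (Suc n)). real \<kappa> * f D)"
    proof (rule sum.cong[OF refl])
      fix D assume D: "D \<in> set (W (Suc n))"
      have "(\<Sum>J\<in>{J\<in>TT n. P J = D}. f (P J)) = (\<Sum>J\<in>{J\<in>TT n. P J = D}. f D)"
        by (rule sum.cong) auto
      then show "(\<Sum>J\<in>{J\<in>TT n. P J = D}. f (P J)) = real \<kappa> * f D" by (simp add: P(3)[OF D])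
    qed
    finally show ?thesis by (simp add: sum_distrib_left)
  qed
  have cT: "real (card (TT n)) = real \<kappa> * real (c (Suc n))"
    using fib[of "\<lambda>_. 1"] card_set_W[of "Suc n"] by simp
  have TT0: "0 < real (card (TT n))" unfolding TT_def using c by (simp add: card_tuples)
  have "frac B (Suc n) (k * w n + q) = (\<Sum>D\<in>set (W (Suc n)). of_bool (col_ends D ! (k * w n + q) \<in> B)) / real (c (Suc n))"
    by (simp add: frac_def of_bool_def sum.If_cases Int_def)
  also have "\<dots> = (\<Sum>J\<in>TT n. of_bool (col_ends (P J) ! (k * w n + q) \<in> B)) / real (card (TT n))"
    unfolding cT using fib[of "\<lambda>D. of_bool (col_ends D ! (k * w n + q) \<in> B)"] P(1) by simp
  also have "\<dots> = (\<Sum>J\<in>TT n. of_bool (col_ends (W n ! (J ! k - 1)) ! ((q - off (hs n) (J ! Suc k)) mod h n) \<in> B))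
       / real (card (TT n))"
  proof -
    have "(col_ends (P J) ! (k * w n + q) \<in> B)
        = (col_ends (W n ! (J ! k - 1)) ! ((q - off (hs n) (J ! Suc k)) mod h n) \<in> B)" if "J \<in> TT n" for J
      using nth_plan[OF B that P(4)[OF that] k, of q] off_le[of n "J ! Suc k"] q
      by (simp add: w_conv mult.commute)
    then show ?thesis by (simp cong: sum.cong)
  qed
  also have "\<dots> = (\<Sum>a\<in>{1..c n}. \<Sum>a'\<in>{1..c n}. of_bool (col_ends (W n ! (a - 1)) ! ((q - off (hs n) a') mod h n) \<in> B))
       / (real (c n) * real (c n))"
    using sum_tuples_pair[OF c k, of "\<lambda>a a'. of_bool (col_ends (W n ! (a - 1)) ! ((q - off (hs n) a') mod h n) \<in> B)"]
    unfolding TT_def card_tuples of_nat_power .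
  also have "\<dots> = (\<Sum>a'\<in>{1..c n}. frac B n ((q - off (hs n) a') mod h n)) / real (c n)"
    unfolding frac_index[symmetric] sum_divide_distrib[symmetric] by (subst sum.swap) (simp add: field_simps)
  finally show ?thesis .
qed

text \<open>Started at \<open>k * w n + q\<close>, time \<open>j * w n + s\<close> leads to place
  \<open>q + s\<close> of block \<open>(k + j) mod e n\<close>. The bounds on \<open>q\<close> keep
  this in the repeated part for every offset, and the \<open>m \<le> e n\<close> blocks visited are
  distinct, so \<open>fent_tuples\<close> adds up \<open>m\<close> entropies, each averaged over the
  offset.\<close>

lemma En_Suc:
  assumes B: "resp n B" and N: "N \<subseteq> {..<h n}" and k: "k < e n" and q: "hs n \<le> q" "q + h n \<le> rr n * h n"
    and m: "m \<le> e n"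
  shows "real m * ((\<Sum>a'\<in>{1..c n}. En B n N (q - off (hs n) a')) / real (c n))
    \<le> En B (Suc n) (\<Union>j<m. (\<lambda>s. j * w n + s) ` N) (k * w n + q)"
proof -
  let ?N = "\<Union>j<m. (\<lambda>s. j * w n + s) ` N"
  obtain P \<kappa> where P: "\<kappa> > 0" "P ` TT n = set (W (Suc n))"
    "\<And>D. D \<in> set (W (Suc n)) \<Longrightarrow> card {J\<in>TT n. P J = D} = \<kappa>"
    "\<And>J. J \<in> TT n \<Longrightarrow> built (v (Suc n)) ({0..<1} - U n) (pln n J) (col_ends (P J))"
    by (rule step_rel_obtain[of n]) blast
  have fin: "finite (TT n)" unfolding TT_def by (rule finite_tuples)
  define K where "K = (\<lambda>j. (k + j) mod e n) ` {..<m}"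
  have e0: "0 < e n" using e_ge_1[of n] by simp
  have inj: "inj_on (\<lambda>j. (k + j) mod e n) {..<m}"
  proof (rule inj_onI)
    fix i j assume ij: "i \<in> {..<m}" "j \<in> {..<m}" "(k + i) mod e n = (k + j) mod e n"
    have *: "i = j" if "i \<le> j" "j < m" "(k + i) mod e n = (k + j) mod e n" for i j
    proof -
      have "e n dvd j - i" using mod_eq_dvd_iff_nat[of "k + i" "k + j" "e n"] that by simp
      then show ?thesis using that(1,2) m nat_dvd_not_less[of "j - i" "e n"] by linarith
    qed
    show "i = j"
    proof (cases "i \<le> j")
      case True
      then show ?thesis by (rule *[OF _ _ ij(3)]) (use ij(2) in simp)
    next
      case False
      then have "j = i" by (intro *[OF _ _ ij(3)[symmetric]]) (use ij(1) in simp_all)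
      then show ?thesis by simp
    qed
  qed
  have cardK: "card K = m" unfolding K_def by (simp add: card_image[OF inj])
  have K: "K \<subseteq> {..<e n}" unfolding K_def using e0 by auto
  have bit: "col_ends (P J) ! ((k * w n + q + (j * w n + s)) mod h (Suc n)) \<in> B
      \<longleftrightarrow> s \<in> obs B n N (q - off (hs n) (J ! Suc ((k + j) mod e n))) (W n ! (J ! ((k + j) mod e n) - 1))"
    if J: "J \<in> TT n" and j: "j < m" and s: "s \<in> N" for J j s
  proof -
    let ?k = "(k + j) mod e n"
    let ?o = "off (hs n) (J ! Suc ?k)"
    have s': "s < h n" using N s by auto
    have qs: "q + s < rr n * h n" using q(2) s' by linarith
    have o: "?o \<le> q" using off_le[of n "J ! Suc ?k"] q(1) by linarith
    have qw: "q + s < w n" using qs by (simp add: w_conv mult.commute)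
    have t: "k * w n + q + (j * w n + s) = (k + j) * w n + (q + s)" by (simp add: algebra_simps)
    have dm: "((k + j) * w n + (q + s)) div w n = k + j" "((k + j) * w n + (q + s)) mod w n = q + s"
      using qw w_pos[of n] by simp_all
    have "(k * w n + q + (j * w n + s)) mod h (Suc n) = ?k * w n + (q + s)"
      unfolding t h_Suc mod_mult2_eq dm by (simp add: mult.commute)
    \<comment> \<open>Since \<open>h (Suc n) = w n * e n\<close>, reducing modulo the height wraps
      the block number and keeps the place within the block.\<close>
    moreover have "col_ends (P J) ! (?k * w n + (q + s)) \<in> B
       \<longleftrightarrow> col_ends (W n ! (J ! ?k - 1)) ! ((q + s - ?o) mod h n) \<in> B"
      using nth_plan[OF B J P(4)[OF J], of ?k "q + s"] e0 qw qs o by simp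
    moreover have "q + s - ?o = q - ?o + s" using o by simp
    ultimately show ?thesis using s by (simp add: obs_def)
  qed
  have "real (card K) * ((\<Sum>a'\<in>{1..c n}. fent {1..c n} (\<lambda>a. obs B n N (q - off (hs n) a') (W n ! (a - 1)))) / real (c n))
     \<le> fent (tuples (c n) (Suc (e n))) (obs B (Suc n) ?N (k * w n + q) \<circ> P)"
  proof (rule fent_tuples[OF W_facts(5) K])
    fix J J' k' assume J: "J \<in> tuples (c n) (Suc (e n))" "J' \<in> tuples (c n) (Suc (e n))"
      and eq: "(obs B (Suc n) ?N (k * w n + q) \<circ> P) J = (obs B (Suc n) ?N (k * w n + q) \<circ> P) J'" and "k' \<in> K"
    then obtain j where j: "j < m" "k' = (k + j) mod e n" by (auto simp: K_def)
    have J': "J \<in> TT n" "J' \<in> TT n" using J by (auto simp: TT_def)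
    have "s \<in> obs B n N (q - off (hs n) (J ! Suc k')) (W n ! (J ! k' - 1))
      \<longleftrightarrow> s \<in> obs B n N (q - off (hs n) (J' ! Suc k')) (W n ! (J' ! k' - 1))" for s
    proof (cases "s \<in> N")
      case True
      have "j * w n + s \<in> ?N" using True j(1) by blast
      moreover have "j * w n + s \<in> obs B (Suc n) ?N (k * w n + q) (P J)
         \<longleftrightarrow> j * w n + s \<in> obs B (Suc n) ?N (k * w n + q) (P J')" using eq by simp
      ultimately have "col_ends (P J) ! ((k * w n + q + (j * w n + s)) mod h (Suc n)) \<in> B
         \<longleftrightarrow> col_ends (P J') ! ((k * w n + q + (j * w n + s)) mod h (Suc n)) \<in> B" by (simp add: obs_def)
      then show ?thesis using bit[OF J'(1) j(1) True] bit[OF J'(2) j(1) True] unfolding j(2) by blast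
    next
      case False
      then show ?thesis by (simp add: obs_def)
    qed
    then show "obs B n N (q - off (hs n) (J ! Suc k')) (W n ! (J ! k' - 1))
        = obs B n N (q - off (hs n) (J' ! Suc k')) (W n ! (J' ! k' - 1))" by blast
  qed
  also have "fent (tuples (c n) (Suc (e n))) (obs B (Suc n) ?N (k * w n + q) \<circ> P) = En B (Suc n) ?N (k * w n + q)"
    unfolding En_def TT_def[symmetric] by (rule fent_reindex[OF fin P(1,2,3)])
  finally show ?thesis unfolding cardK by (simp only: fent_index En_def)
qed

text \<open>Starting positions from which the next \<open>h n\<close> places stay in the repeated
  part of the block, whatever its offset.\<close>

definition good_pos :: "nat \<Rightarrow> nat set" where
  "good_pos n = (\<lambda>(k, q). k * w n + q) ` ({..<e n} \<times> {hs n..<rr n * h n - h n})"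

lemma inj_pos: "inj_on (\<lambda>(k, q). k * w n + q) ({..<e n} \<times> {..<w n})"
proof (rule inj_onI, clarify)
  fix k q k' q' assume *: "q < w n" "q' < w n" "k * w n + q = k' * w n + q'"
  have "(k * w n + q) div w n = k" "(k' * w n + q') div w n = k'" using *(1,2) w_pos[of n] by simp_all
  moreover have "(k * w n + q) mod w n = q" "(k' * w n + q') mod w n = q'" using *(1,2) by simp_all
  ultimately show "k = k' \<and> q = q'" using *(3) by metis
qed

lemma q_less_w: "q < rr n * h n \<Longrightarrow> q < w n"
  by (simp add: w_conv mult.commute)

lemma q_less_w': "q < rr n * h n - h n \<Longrightarrow> q < w n"
  by (rule q_less_w) simp

lemma inj_good: "inj_on (\<lambda>(k, q). k * w n + q) ({..<e n} \<times> {hs n..<rr n * h n - h n})"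
  by (rule inj_on_subset[OF inj_pos]) (auto intro: q_less_w')

lemma pos_less: "k < e n \<Longrightarrow> q < w n \<Longrightarrow> k * w n + q < h (Suc n)"
proof -
  assume "k < e n" "q < w n"
  then have "Suc k * w n \<le> e n * w n" by (intro mult_right_mono) auto
  then show ?thesis using \<open>q < w n\<close> by (simp add: h_Suc mult.commute)
qed

lemma good_pos_sub: "good_pos n \<subseteq> {..<h (Suc n)}"
  unfolding good_pos_def by (auto intro!: pos_less q_less_w')

text \<open>For each offset the admissible \<open>q\<close> contain \<open>rr n - 2\<close> full
  periods of \<open>En\<close>, each summing to \<open>Es B n N\<close>. One copy is lost to the
  spacers, as \<open>hs n \<le> h n\<close>, and one to the length of the window.\<close>

lemma En_good_sum:
  assumes B: "resp n B" and N: "N \<subseteq> {..<h n}" and m: "m \<le> e n"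
  shows "real (e n) * real m * (real (rr n) - 2) * Es B n N
    \<le> (\<Sum>p\<in>good_pos n. En B (Suc n) (\<Union>j<m. (\<lambda>s. j * w n + s) ` N) p)"
proof -
  let ?N = "\<Union>j<m. (\<lambda>s. j * w n + s) ` N"
  let ?Q = "{hs n..<rr n * h n - h n}"
  have c: "0 < c n" by (rule W_facts(5))
  have win: "(real (rr n) - 2) * Es B n N \<le> (\<Sum>q\<in>?Q. En B n N (q - off (hs n) a'))" for a'
  proof (cases "2 \<le> rr n")
    case True
    let ?o = "off (hs n) a'"
    obtain r where r: "rr n = r + 2" using True by (metis add.commute le_Suc_ex)
    have len: "hs n + r * h n \<le> rr n * h n - h n" using hs_le[of n] by (simp add: r algebra_simps)
    have "(real (rr n) - 2) * Es B n N = (\<Sum>q\<in>{hs n - ?o..<hs n - ?o + r * h n}. En B n N q)"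
      unfolding Es_def by (subst sum_periodic[where h = "h n"]) (auto simp: En_periodic r)
    also have "\<dots> = (\<Sum>q\<in>{hs n..<hs n + r * h n}. En B n N (q - ?o))"
      using off_le[of n a']
      by (intro sum.reindex_bij_witness[of _ "\<lambda>q. q - ?o" "\<lambda>q. q + ?o"]) auto
    also have "\<dots> \<le> (\<Sum>q\<in>?Q. En B n N (q - ?o))"
      using len by (intro sum_mono2) (auto intro: En_nonneg)
    finally show ?thesis .
  next
    case False
    have "(real (rr n) - 2) * Es B n N \<le> 0" using False Es_nonneg by (intro mult_nonpos_nonneg) auto
    also have "0 \<le> (\<Sum>q\<in>?Q. En B n N (q - off (hs n) a'))" by (intro sum_nonneg En_nonneg)
    finally show ?thesis .
  qed
  have "real (e n) * real m * (real (rr n) - 2) * Es B n N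
      = (\<Sum>k<e n. real m * ((\<Sum>a'\<in>{1..c n}. (real (rr n) - 2) * Es B n N) / real (c n)))"
    using c by simp
  also have "\<dots> \<le> (\<Sum>k<e n. real m * ((\<Sum>a'\<in>{1..c n}. \<Sum>q\<in>?Q. En B n N (q - off (hs n) a')) / real (c n)))"
    using win by (intro sum_mono mult_left_mono divide_right_mono) auto
  also have "\<dots> = (\<Sum>k<e n. \<Sum>q\<in>?Q. real m * ((\<Sum>a'\<in>{1..c n}. En B n N (q - off (hs n) a')) / real (c n)))"
    by (subst sum.swap) (simp add: sum_distrib_left sum_divide_distrib)
  also have "\<dots> \<le> (\<Sum>k<e n. \<Sum>q\<in>?Q. En B (Suc n) ?N (k * w n + q))"
    using En_Suc[OF B N _ _ _ m] by (intro sum_mono) auto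
  also have "\<dots> = (\<Sum>p\<in>good_pos n. En B (Suc n) ?N p)"
    unfolding good_pos_def by (subst sum.reindex[OF inj_good]) (simp add: sum.cartesian_product split_def comp_def)
  finally show ?thesis .
qed

lemma Es_Suc:
  assumes "resp n B" "N \<subseteq> {..<h n}" "m \<le> e n"
  shows "real (e n) * real m * (real (rr n) - 2) * Es B n N
    \<le> Es B (Suc n) (\<Union>j<m. (\<lambda>s. j * w n + s) ` N)"
proof -
  have "(\<Sum>p\<in>good_pos n. En B (Suc n) (\<Union>j<m. (\<lambda>s. j * w n + s) ` N) p)
      \<le> Es B (Suc n) (\<Union>j<m. (\<lambda>s. j * w n + s) ` N)"
    unfolding Es_def using good_pos_sub by (intro sum_mono2) (auto intro: En_nonneg)
  then show ?thesis using En_good_sum[OF assms] by linarith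
qed

text \<open>From a good position of stage \<open>Suc n\<close> the times in \<open>N\<close> do not
  leave the column, so \<open>obs\<close> gives the true itinerary and the law of
  \<open>hits\<close> dominates a mixture in which every good position has mass
  \<open>c (Suc n) * v (Suc n)\<close>. The entropies are those of \<open>En_good_sum\<close> with
  \<open>m = 1\<close>.\<close>

lemma ment_hits_ge:
  assumes B: "resp n B" and N: "N \<subseteq> {..<h n}"
  shows "real (c (Suc n)) * v (Suc n) * (real (e n) * (real (rr n) - 2) * Es B n N) \<le> ment M (hits T B N)"
proof -
  have B': "resp (Suc n) B" by (rule resp_Suc[OF B])
  have finN: "finite N" using N by (rule finite_subset) simp
  have cv: "0 < real (c (Suc n)) * v (Suc n)" using W_facts(4,5) by simp
  have fing: "finite (good_pos n)" using good_pos_sub by (rule finite_subset) simp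
  have ps: "p + s < h (Suc n)" if "p \<in> good_pos n" "s \<in> N" for p s
  proof -
    obtain k q where kq: "k < e n" "q < rr n * h n - h n" "p = k * w n + q"
      using \<open>p \<in> good_pos n\<close> by (auto simp: good_pos_def)
    have "q + s < rr n * h n" using kq(2) N that(2) by fastforce
    then show ?thesis using pos_less[OF kq(1) q_less_w, of "q + s"] by (simp add: kq(3) add.assoc)
  qed
  have "real (e n) * real (1::nat) * (real (rr n) - 2) * Es B n N
      \<le> (\<Sum>p\<in>good_pos n. En B (Suc n) (\<Union>j<1. (\<lambda>s. j * w n + s) ` N) p)"
    using e_ge_1[of n] by (intro En_good_sum[OF B N]) simp
  moreover have "(\<Union>j<(1::nat). (\<lambda>s. j * w n + s) ` N) = N" by auto
  ultimately have "real (e n) * (real (rr n) - 2) * Es B n N \<le> (\<Sum>p\<in>good_pos n. En B (Suc n) N p)" by simp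
  then have "real (c (Suc n)) * v (Suc n) * (real (e n) * (real (rr n) - 2) * Es B n N)
     \<le> real (c (Suc n)) * v (Suc n) * (\<Sum>p\<in>good_pos n. fent (set (W (Suc n))) (obs B (Suc n) N p))"
    using cv unfolding En_def by (intro mult_left_mono) auto
  also have "\<dots> \<le> ment M (hits T B N)"
  proof (rule S.ment_hits_ge_mixture[OF resp_sets[OF B] finN _ fing])
    fix y assume y: "y \<subseteq> N"
    let ?S = "{(D, p). D \<in> set (W (Suc n)) \<and> p \<in> good_pos n \<and> obs B (Suc n) N p D = y}"
    have S: "?S \<subseteq> set (W (Suc n)) \<times> {..<h (Suc n)}" using good_pos_sub by auto
    have "?S = (\<Union>p\<in>good_pos n. (\<lambda>D. (D, p)) ` {D\<in>set (W (Suc n)). obs B (Suc n) N p D = y})" by auto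
    then have "card ?S = card (\<Union>p\<in>good_pos n. (\<lambda>D. (D, p)) ` {D\<in>set (W (Suc n)). obs B (Suc n) N p D = y})"
      by (rule arg_cong)
    also have "\<dots> = (\<Sum>p\<in>good_pos n. card ((\<lambda>D. (D, p)) ` {D\<in>set (W (Suc n)). obs B (Suc n) N p D = y}))"
      using fing by (intro card_UN_disjoint) auto
    also have "\<dots> = (\<Sum>p\<in>good_pos n. card {D\<in>set (W (Suc n)). obs B (Suc n) N p D = y})"
      by (intro sum.cong refl card_image) (auto simp: inj_on_def)
    finally have cS: "real (card ?S) = (\<Sum>p\<in>good_pos n. real (card {D\<in>set (W (Suc n)). obs B (Suc n) N p D = y}))"
      by simp
    have "real (c (Suc n)) * v (Suc n) * (\<Sum>p\<in>good_pos n. real (card {D\<in>set (W (Suc n)). obs B (Suc n) N p D = y}) / real (card (set (W (Suc n)))))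
      = real (card ?S) * v (Suc n)"
      using W_facts(5)[of "Suc n"] unfolding cS card_set_W sum_divide_distrib[symmetric] by simp
    also have "\<dots> = measure M (\<Union>(D, i)\<in>?S. level D i)" using measure_levels(2)[OF S] by simp
    also have "\<dots> \<le> measure M (hits T B N -` {y} \<inter> space M)"
    proof (rule M.finite_measure_mono)
      show "hits T B N -` {y} \<inter> space M \<in> sets M"
        using S.simple_hits[OF resp_sets[OF B] finN] by (rule simple_functionD(2))
      show "(\<Union>(D, i)\<in>?S. level D i) \<subseteq> hits T B N -` {y} \<inter> space M"
      proof
        fix x assume "x \<in> (\<Union>(D, i)\<in>?S. level D i)"
        then obtain D p where D: "D \<in> set (W (Suc n))" "p \<in> good_pos n" "obs B (Suc n) N p D = y" "x \<in> level D p"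
          by blast
        have p: "p < h (Suc n)" using D(2) good_pos_sub by auto
        have "(T ^^ s) x \<in> B \<longleftrightarrow> col_ends D ! ((p + s) mod h (Suc n)) \<in> B" if "s \<in> N" for s
          using resp_bit[OF B' D(1) ps[OF D(2) that] T_pow_level[OF D(1,4) ps[OF D(2) that]]] ps[OF D(2) that]
          by simp
        then have "hits T B N x = y" unfolding D(3)[symmetric] hits_def obs_def by blast
        moreover have "x \<in> space M" using sets.sets_into_space[OF level_sets[OF D(1) p]] D(4) by blast
        ultimately show "x \<in> hits T B N -` {y} \<inter> space M" by simp
      qed
    qed
    finally show "real (c (Suc n)) * v (Suc n) * (\<Sum>i\<in>good_pos n. real (card {x \<in> set (W (Suc n)). obs B (Suc n) N i x = y}) / real (card (set (W (Suc n)))))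
         \<le> measure M (hits T B N -` {y} \<inter> space M)" .
  qed (use cv in \<open>auto simp: obs_def\<close>)
  finally show ?thesis .
qed

end

context cs_sys
begin

subsection \<open>The lower bound\<close>

lemma frac_bounds: "0 \<le> frac B n p" "frac B n p \<le> 1"
proof -
  have "card {D\<in>set (W n). col_ends D ! p \<in> B} \<le> c n"
    unfolding card_set_W[symmetric] by (rule card_mono) auto
  then show "frac B n p \<le> 1" using W_facts(5)[of n] by (simp add: frac_def)
qed (simp add: frac_def)

lemma w_decompose: "p < h (Suc n) \<Longrightarrow> \<exists>k q. k < e n \<and> q < w n \<and> p = k * w n + q"
proof -
  assume "p < h (Suc n)"
  then have "p div w n < e n" by (simp add: h_Suc div_less_iff_less_mult w_pos mult.commute)
  then show ?thesis using w_pos[of n] by (intro exI[of _ "p div w n"] exI[of _ "p mod w n"]) simp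
qed

text \<open>Without spacers all copies of columns of stage \<open>m\<close> stay in phase, so the
  position modulo \<open>h m\<close> decides which of their levels is seen.\<close>

lemma frac_no_spacers:
  assumes "m \<le> n" and B: "resp m B" and hs: "\<And>i. m \<le> i \<Longrightarrow> i < n \<Longrightarrow> hs i = 0"
  shows "h m dvd h n \<and> (\<forall>p<h n. frac B n p = frac B m (p mod h m))"
  using assms(1,3)
proof (induction n rule: dec_induct)
  case (step n)
  have IH: "h m dvd h n" "\<And>p. p < h n \<Longrightarrow> frac B n p = frac B m (p mod h m)" using step by auto
  have hs: "hs n = 0" using step by simp
  have w: "w n = rr n * h n" using hs by (simp add: w_conv mult.commute)
  have dvd: "h m dvd w n" using IH(1) by (simp add: w)
  have "frac B (Suc n) p = frac B m (p mod h m)" if p: "p < h (Suc n)" for p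
  proof -
    obtain k q where kq: "k < e n" "q < w n" "p = k * w n + q" using w_decompose[OF p] by blast
    have "frac B (Suc n) p = (\<Sum>a'\<in>{1..c n}. frac B n ((q - off (hs n) a') mod h n)) / real (c n)"
      unfolding kq(3) using kq(2) hs w by (intro frac_Suc resp_mono[OF _ B] kq(1) step.hyps) auto
    also have "\<dots> = frac B n (q mod h n)" using W_facts(5)[of n] by (simp add: hs off_def)
    also have "\<dots> = frac B m (q mod h n mod h m)" using h_pos[of n] by (intro IH(2)) simp
    also have "q mod h n mod h m = q mod h m" using IH(1) by (rule mod_mod_cancel)
    also have "\<dots> = p mod h m"
    proof -
      have "k * w n mod h m = 0" using dvd by simp
      then show ?thesis unfolding kq(3) by (metis add_0 mod_add_left_eq)
    qed
    finally show ?thesis .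
  qed
  moreover have "h m dvd h (Suc n)" using dvd by (simp add: h_Suc)
  ultimately show ?case by blast
qed simp

lemma hs_between: "t \<ge> 1 \<Longrightarrow> l t \<le> i \<Longrightarrow> i < nn t \<Longrightarrow> hs i = 0"
proof (rule hs_0)
  assume *: "t \<ge> 1" "l t \<le> i" "i < nn t"
  show "i \<notin> nn ` {1..}"
  proof
    assume "i \<in> nn ` {1..}"
    then obtain s where s: "s \<ge> 1" "i = nn s" by auto
    have "s < t"
    proof (rule ccontr)
      assume "\<not> s < t"
      then have "nn t \<le> nn s" using nn_less[of t s] * by (cases "s = t") auto
      then show False using * s by simp
    qed
    then obtain u where u: "t = Suc u" "s \<le> u" by (cases t) auto
    then have "nn s \<le> nn u" using nn_less[OF s(1), of u] by (cases "s = u") auto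
    also have "nn u < l t" using par(4)[of u] u s(1) by simp
    finally have "nn s < l t" .
    then show False using * s by simp
  qed
qed

lemma frac_average:
  assumes "resp n B"
  shows "(\<Sum>i<h n. frac B n i) / real (h n) = measure M B / mm n"
proof -
  let ?S = "{(D, i). D \<in> set (W n) \<and> i < h n \<and> level D i \<subseteq> B}"
  have S: "?S \<subseteq> set (W n) \<times> {..<h n}" by auto
  have eq: "?S = (\<Union>i\<in>{..<h n}. (\<lambda>D. (D, i)) ` {D\<in>set (W n). col_ends D ! i \<in> B})"
  proof -
    have "level D i \<subseteq> B \<longleftrightarrow> col_ends D ! i \<in> B" if "D \<in> set (W n)" "i < h n" for D i
    proof -
      have "col_ends D ! i \<in> level D i" using W_facts(4)[of n] W_facts(6)[OF that(1)] by (simp add: level_def)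
      then show ?thesis using assms that resp_bit[OF assms that] by blast
    qed
    then show ?thesis by auto
  qed
  have "card ?S = (\<Sum>i<h n. card ((\<lambda>D. (D, i)) ` {D\<in>set (W n). col_ends D ! i \<in> B}))"
    unfolding eq by (intro card_UN_disjoint) auto
  also have "\<dots> = (\<Sum>i<h n. card {D\<in>set (W n). col_ends D ! i \<in> B})"
    by (intro sum.cong refl card_image) (auto simp: inj_on_def)
  finally have "real (card ?S) = real (c n) * (\<Sum>i<h n. frac B n i)"
    using W_facts(5)[of n] by (simp add: frac_def sum_divide_distrib[symmetric])
  moreover have "measure M B = real (card ?S) * v n"
    using measure_levels(2)[OF S] resp_conv[OF assms] by simp
  ultimately show ?thesis
    using W_facts(4,5)[of n] h_pos[of n] by (simp add: mm_def field_simps)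
qed

text \<open>Up to stage \<open>nn t\<close> everything has period \<open>h (l t)\<close>, and this
  is also the number of spacers per segment. The offset therefore runs through full periods, nearly
  uniformly because there are at least \<open>h (l t)\<close> columns; a factor 2 is lost to the
  incomplete last period.\<close>

lemma frac_nn:
  assumes t: "t \<ge> 1" and B: "resp (l t) B" and c: "h (l t) \<le> c (nn t)"
    and k: "k < e (nn t)" and q: "hs (nn t) \<le> q" "q < rr (nn t) * h (nn t)"
  defines "a \<equiv> measure M B / mm (l t)"
  shows "a / 2 \<le> frac B (Suc (nn t)) (k * w (nn t) + q)"
    "(1 - a) / 2 \<le> 1 - frac B (Suc (nn t)) (k * w (nn t) + q)"
proof -
  let ?n = "nn t" and ?l = "l t"
  have ln: "?l \<le> ?n" using par(3)[OF t] by simp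
  have hsn: "hs ?n = h ?l" by (rule hs_nn[OF t])
  have nsp: "h ?l dvd h ?n" "\<And>p. p < h ?n \<Longrightarrow> frac B ?n p = frac B ?l (p mod h ?l)"
    using frac_no_spacers[OF ln B hs_between[OF t]] by auto
  have cpos: "0 < real (c ?n)" using W_facts(5) by simp
  have hp: "0 < h ?l" by (rule h_pos)
  have "frac B ?n ((q - off (hs ?n) a') mod h ?n) = frac B ?l ((q - a' mod h ?l) mod h ?l)" for a'
    using nsp h_pos[of ?n] hp by (simp add: off_def hsn mod_mod_cancel)
  then have f: "frac B (Suc ?n) (k * w ?n + q)
     = (\<Sum>a'\<in>{1..c ?n}. frac B ?l ((q - a' mod h ?l) mod h ?l)) / real (c ?n)"
    using frac_Suc[OF resp_mono[OF ln B] k q] by simp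
  have a: "a = (\<Sum>i<h ?l. frac B ?l i) / real (h ?l)" unfolding a_def by (rule frac_average[OF B, symmetric])
  have "real (c ?n) / 2 * a \<le> (\<Sum>a'\<in>{1..c ?n}. frac B ?l ((q - a' mod h ?l) mod h ?l))"
    unfolding a by (rule sum_offset_ge[OF hp _ c]) (use q(1) hsn frac_bounds in auto)
  then have "real (c ?n) / 2 * a / real (c ?n) \<le> frac B (Suc ?n) (k * w ?n + q)"
    unfolding f by (intro divide_right_mono) auto
  then show "a / 2 \<le> frac B (Suc ?n) (k * w ?n + q)" using cpos by simp
  have "real (c ?n) / 2 * ((\<Sum>i<h ?l. 1 - frac B ?l i) / real (h ?l))
     \<le> (\<Sum>a'\<in>{1..c ?n}. 1 - frac B ?l ((q - a' mod h ?l) mod h ?l))"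
    by (rule sum_offset_ge[OF hp _ c]) (use q(1) hsn frac_bounds in auto)
  moreover have "(\<Sum>i<h ?l. 1 - frac B ?l i) / real (h ?l) = 1 - a"
    unfolding a using hp by (simp add: sum_subtractf diff_divide_distrib)
  ultimately have "real (c ?n) / 2 * (1 - a) / real (c ?n)
    \<le> (\<Sum>a'\<in>{1..c ?n}. 1 - frac B ?l ((q - a' mod h ?l) mod h ?l)) / real (c ?n)"
    by (intro divide_right_mono) auto
  also have "\<dots> = 1 - frac B (Suc ?n) (k * w ?n + q)"
    unfolding f using cpos by (simp add: sum_subtractf diff_divide_distrib)
  finally show "(1 - a) / 2 \<le> 1 - frac B (Suc ?n) (k * w ?n + q)" using cpos by simp
qed

lemma En_singleton_ge: "2 * frac B n ((p + 1) mod h n) * (1 - frac B n ((p + 1) mod h n)) \<le> En B n {1} p"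
proof -
  let ?P = "\<lambda>D. col_ends D ! ((p + 1) mod h n) \<in> B"
  have c: "0 < c n" by (rule W_facts(5))
  have "card {D\<in>set (W n). ?P D} + card {D\<in>set (W n). \<not> ?P D} = card ({D\<in>set (W n). ?P D} \<union> {D\<in>set (W n). \<not> ?P D})"
    by (rule card_Un_disjoint[symmetric]) auto
  also have "{D\<in>set (W n). ?P D} \<union> {D\<in>set (W n). \<not> ?P D} = set (W n)" by auto
  finally have "real (card {D\<in>set (W n). \<not> ?P D}) = real (c n) - real (card {D\<in>set (W n). ?P D})"
    by (simp add: card_set_W)
  then have f: "real (card {D\<in>set (W n). \<not> ?P D}) / real (card (set (W n))) = 1 - frac B n ((p + 1) mod h n)"
    using c by (simp add: card_set_W frac_def diff_divide_distrib)
  have "2 * (real (card {D\<in>set (W n). ?P D}) / real (card (set (W n))))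
     * (real (card {D\<in>set (W n). \<not> ?P D}) / real (card (set (W n)))) \<le> fent (set (W n)) (obs B n {1} p)"
  proof (rule fent_binary)
    show "set (W n) \<noteq> {}" using c by (auto simp: c_def)
    fix D E assume "obs B n {1} p D = obs B n {1} p E"
    then have "1 \<in> obs B n {1} p D \<longleftrightarrow> 1 \<in> obs B n {1} p E" by simp
    then show "?P D = ?P E" by (simp add: obs_def)
  qed simp
  then show ?thesis unfolding f En_def by (simp add: frac_def card_set_W)
qed

text \<open>At least a third of the positions lie in the repeated parts at places
  \<open>\<ge> hs\<close>, and there the two values of the bit have frequencies at least
  \<open>a / 2\<close> and \<open>(1 - a) / 2\<close>. By \<open>fent_binary\<close> each such
  position is worth \<open>a * (1 - a) / 2\<close>.\<close>

lemma Es_base: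
  assumes t: "t \<ge> 1" and B: "resp (l t) B" and c: "h (l t) \<le> c (nn t)"
  defines "a \<equiv> measure M B / mm (l t)"
  assumes a: "0 \<le> a" "a \<le> 1"
  shows "real (h (Suc (nn t))) * (a * (1 - a) / 6) \<le> Es B (Suc (nn t)) {1}"
proof -
  let ?n = "nn t"
  let ?g = "\<lambda>p. 2 * frac B (Suc ?n) (p mod h (Suc ?n)) * (1 - frac B (Suc ?n) (p mod h (Suc ?n)))"
  let ?Q = "{..<e ?n} \<times> {hs ?n..<rr ?n * h ?n}"
  have n: "2 \<le> ?n" using l_nn_bounds[OF t] t by simp
  have g0: "0 \<le> ?g p" for p using frac_bounds by simp
  have inj: "inj_on (\<lambda>(k, q). k * w ?n + q) ?Q"
    by (rule inj_on_subset[OF inj_pos]) (auto intro: q_less_w)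
  have sub: "(\<lambda>(k, q). k * w ?n + q) ` ?Q \<subseteq> {..<h (Suc ?n)}" by (auto intro!: pos_less q_less_w)
  have gl: "a * (1 - a) / 2 \<le> ?g p" if p: "p \<in> (\<lambda>(k, q). k * w ?n + q) ` ?Q" for p
  proof -
    obtain k q where kq: "k < e ?n" "hs ?n \<le> q" "q < rr ?n * h ?n" "p = k * w ?n + q" using p by auto
    have pm: "p mod h (Suc ?n) = p" using sub p by (intro mod_less) auto
    note f = frac_nn[OF t B c kq(1-3), folded a_def, folded kq(4)]
    have "(a / 2) * ((1 - a) / 2) \<le> frac B (Suc ?n) p * (1 - frac B (Suc ?n) p)"
      using f a frac_bounds[of B "Suc ?n" p] by (intro mult_mono) auto
    then have "2 * ((a / 2) * ((1 - a) / 2)) \<le> 2 * (frac B (Suc ?n) p * (1 - frac B (Suc ?n) p))"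
      by (rule mult_left_mono) simp
    moreover have "a * (1 - a) / 2 = 2 * ((a / 2) * ((1 - a) / 2))" by simp
    ultimately show ?thesis unfolding pm by (simp only: mult.assoc)
  qed
  have C4: "3 \<le> rr ?n"
  proof -
    have "1 * 2 ^ 2 \<le> C * ?n ^ 2" using n C_ge_2 by (intro mult_mono power_mono) auto
    then show ?thesis using n by (simp add: rr_def)
  qed
  have card: "real (h (Suc ?n)) / 3 \<le> real (card ?Q)"
  proof -
    have "w ?n \<le> 3 * (rr ?n * h ?n - hs ?n)"
    proof -
      have "3 * h ?n \<le> rr ?n * h ?n" using C4 by (rule mult_le_mono1)
      then show ?thesis using hs_le[of ?n] unfolding w_conv[of ?n] mult.commute[of "h ?n"] by linarith
    qed
    then have "w ?n * e ?n \<le> 3 * (rr ?n * h ?n - hs ?n) * e ?n" by (rule mult_le_mono1)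
    then have "real (h (Suc ?n)) \<le> real (3 * (rr ?n * h ?n - hs ?n) * e ?n)" unfolding h_Suc by (simp only: of_nat_le_iff)
    also have "\<dots> = 3 * real (card ?Q)" by (simp add: card_cartesian_product mult.commute)
    finally show ?thesis by simp
  qed
  have "real (h (Suc ?n)) * (a * (1 - a) / 6) = real (h (Suc ?n)) / 3 * (a * (1 - a) / 2)" by simp
  also have "\<dots> \<le> real (card ?Q) * (a * (1 - a) / 2)" using card a by (intro mult_right_mono) auto
  also have "\<dots> = (\<Sum>p\<in>(\<lambda>(k, q). k * w ?n + q) ` ?Q. a * (1 - a) / 2)" by (simp add: card_image[OF inj])
  also have "\<dots> \<le> (\<Sum>p\<in>(\<lambda>(k, q). k * w ?n + q) ` ?Q. ?g p)" by (intro sum_mono gl)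
  also have "\<dots> \<le> (\<Sum>p<h (Suc ?n). ?g p)" by (intro sum_mono2 g0 sub) simp
  \<comment> \<open>The observation time is 1, so all positions shift by one; the sum does not
    change because of the cyclic reading.\<close>
  also have "\<dots> = (\<Sum>p\<in>{1..<1 + h (Suc ?n)}. ?g p)" by (rule sum_periodic_window[symmetric]) simp
  also have "\<dots> = (\<Sum>p<h (Suc ?n). ?g (p + 1))"
    by (rule sum.reindex_bij_witness[of _ "\<lambda>p. p + 1" "\<lambda>p. p - 1"]) auto
  also have "\<dots> \<le> Es B (Suc ?n) {1}"
    unfolding Es_def by (intro sum_mono En_singleton_ge)
  finally show ?thesis .
qed

section \<open>The entropy generating sequence\<close>

definition blocks :: "nat \<Rightarrow> nat set \<Rightarrow> nat \<Rightarrow> nat set" where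
  "blocks n N m = (\<Union>j<m. (\<lambda>s. j * w n + s) ` N)"

lemma finite_blocks: "finite N \<Longrightarrow> finite (blocks n N m)"
  by (simp add: blocks_def)

lemma blocks_less: "N \<subseteq> {..<h n} \<Longrightarrow> blocks n N m \<subseteq> {..<m * w n}"
proof
  fix x assume N: "N \<subseteq> {..<h n}" and "x \<in> blocks n N m"
  then obtain j s where js: "j < m" "s \<in> N" "x = j * w n + s" by (auto simp: blocks_def)
  have "Suc j * w n \<le> m * w n" using js(1) by (intro mult_le_mono1) simp
  moreover have "s < w n" using N js(2) h_le_w[of n] by fastforce
  ultimately show "x \<in> {..<m * w n}" by (simp add: js(3))
qed

lemma card_blocks: "N \<subseteq> {..<h n} \<Longrightarrow> card (blocks n N m) = m * card N"
proof -
  assume N: "N \<subseteq> {..<h n}"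
  then have finN: "finite N" by (rule finite_subset) simp
  have N': "s < w n" if "s \<in> N" for s using N that h_le_w[of n] by fastforce
  have "card (blocks n N m) = (\<Sum>j<m. card ((\<lambda>s. j * w n + s) ` N))"
    unfolding blocks_def
  proof (rule card_UN_disjoint)
    show "\<forall>i\<in>{..<m}. \<forall>j\<in>{..<m}. i \<noteq> j \<longrightarrow> (\<lambda>s. i * w n + s) ` N \<inter> (\<lambda>s. j * w n + s) ` N = {}"
    proof (intro ballI impI)
      fix i j :: nat assume "i \<noteq> j"
      have "i * w n + s \<noteq> j * w n + s'" if "s \<in> N" "s' \<in> N" for s s'
      proof
        assume eq: "i * w n + s = j * w n + s'"
        have "(i * w n + s) div w n = i" "(j * w n + s') div w n = j" using N'[OF that(1)] N'[OF that(2)] by auto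
        then show False using eq \<open>i \<noteq> j\<close> by metis
      qed
      then show "(\<lambda>s. i * w n + s) ` N \<inter> (\<lambda>s. j * w n + s) ` N = {}" by blast
    qed
  qed (use finN in auto)
  also have "\<dots> = (\<Sum>j<m. card N)" by (intro sum.cong refl card_image) (auto simp: inj_on_def)
  finally show ?thesis by simp
qed

lemma blocks_mono: "m \<le> m' \<Longrightarrow> blocks n N m \<subseteq> blocks n N m'"
  unfolding blocks_def by (intro UN_mono) auto

lemma blocks_ge:
  assumes "1 \<le> m"
  shows "N \<subseteq> blocks n N m"
proof
  fix x assume "x \<in> N"
  then have "0 * w n + x \<in> blocks n N m"
    unfolding blocks_def by (intro UN_I[of 0] imageI) (use assms in auto)
  then show "x \<in> blocks n N m" by simp
qed

text \<open>Starting with \<open>{1}\<close> rather than \<open>{0}\<close> keeps every time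
  positive, as \<open>increasing_seq\<close> demands.\<close>

fun SS :: "nat \<Rightarrow> nat \<Rightarrow> nat set" where
  "SS n0 0 = {1}"
| "SS n0 (Suc k) = blocks (n0 + k) (SS n0 k) (e (n0 + k))"

lemma SS_bounds: "1 \<le> n0 \<Longrightarrow> SS n0 k \<subseteq> {1..<h (n0 + k)}"
proof (induction k)
  case 0
  have "2 ^ 1 \<le> (2::nat) ^ n0" using 0 by (intro power_increasing) auto
  then show ?case using h_ge[of n0] by simp
next
  case (Suc k)
  have "SS n0 k \<subseteq> {..<h (n0 + k)}" using Suc by auto
  from blocks_less[OF this, of "e (n0 + k)"]
  have "SS n0 (Suc k) \<subseteq> {..<h (n0 + Suc k)}" by (simp add: h_Suc mult.commute)
  moreover have "0 \<notin> SS n0 (Suc k)" using Suc by (auto simp: blocks_def)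
  ultimately show ?case
  proof (intro subsetI)
    fix x assume sub: "SS n0 (Suc k) \<subseteq> {..<h (n0 + Suc k)}" "0 \<notin> SS n0 (Suc k)" and x: "x \<in> SS n0 (Suc k)"
    then have "x < h (n0 + Suc k)" "x \<noteq> 0" by (blast, metis)
    then show "x \<in> {1..<h (n0 + Suc k)}" by simp
  qed
qed

lemma SS_less: "1 \<le> n0 \<Longrightarrow> SS n0 k \<subseteq> {..<h (n0 + k)}"
  using SS_bounds[of n0 k] by auto

lemma finite_SS: "finite (SS n0 k)"
  by (induction k) (auto intro: finite_blocks)

lemma card_SS: "1 \<le> n0 \<Longrightarrow> card (SS n0 k) = (\<Prod>i<k. e (n0 + i))"
  by (induction k) (auto simp: card_blocks[OF SS_less] mult.commute)

lemma card_SS_EE: "1 \<le> n0 \<Longrightarrow> card (SS n0 k) * EE n0 = EE (n0 + k)"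
  unfolding card_SS by (induction k) (simp_all add: EE_Suc mult_ac)

lemma SS_mono_Suc: "SS n0 k \<subseteq> SS n0 (Suc k)"
  using blocks_ge[OF e_ge_1] by simp

definition SSall :: "nat \<Rightarrow> nat set" where "SSall n0 = (\<Union>k. SS n0 k)"

text \<open>A nonzero digit at a later stage \<open>k'\<close> makes the time at least
  \<open>w (n0 + k')\<close>, hence at least \<open>h (n0 + k)\<close>. So every
  \<open>SS n0 k\<close> is an initial segment of the whole set.\<close>

lemma SS_low: "k \<le> k' \<Longrightarrow> 1 \<le> n0 \<Longrightarrow> SS n0 k' \<inter> {..<h (n0 + k)} \<subseteq> SS n0 k"
proof (induction k' rule: dec_induct)
  case (step k')
  show ?case
  proof
    fix x assume x: "x \<in> SS n0 (Suc k') \<inter> {..<h (n0 + k)}"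
    then obtain j s where js: "s \<in> SS n0 k'" "x = j * w (n0 + k') + s" by (auto simp: blocks_def)
    have "x < h (n0 + k)" using x by simp
    also have "\<dots> \<le> h (n0 + k')" using step by (intro h_mono) simp
    also have "\<dots> \<le> w (n0 + k')" by (rule h_le_w)
    finally have "j = 0" unfolding js(2) by (cases j) auto
    then have "x \<in> SS n0 k' \<inter> {..<h (n0 + k)}" using js x by simp
    then show "x \<in> SS n0 k" using step by blast
  qed
qed auto

lemma SSall_low: "1 \<le> n0 \<Longrightarrow> m \<le> e (n0 + k) \<Longrightarrow> SSall n0 \<inter> {..<m * w (n0 + k)} \<subseteq> blocks (n0 + k) (SS n0 k) m"
proof
  fix x assume n0: "1 \<le> n0" and m: "m \<le> e (n0 + k)" and x: "x \<in> SSall n0 \<inter> {..<m * w (n0 + k)}"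
  then obtain k' where k': "x \<in> SS n0 k'" by (auto simp: SSall_def)
  have xm: "x < m * w (n0 + k)" using x by simp
  also have "\<dots> \<le> h (n0 + Suc k)" using m by (simp add: h_Suc mult.commute)
  finally have xh: "x < h (n0 + Suc k)" .
  have "SS n0 k' \<subseteq> SS n0 (max k' (Suc k))"
    by (rule lift_Suc_mono_le[of "SS n0"]) (use SS_mono_Suc in auto)
  then have "x \<in> SS n0 (Suc k)" using SS_low[OF _ n0, of "Suc k" "max k' (Suc k)"] k' xh by auto
  then obtain j s where js: "j < e (n0 + k)" "s \<in> SS n0 k" "x = j * w (n0 + k) + s" by (auto simp: blocks_def)
  have "j * w (n0 + k) < m * w (n0 + k)" using js(3) xm by linarith
  then have "j < m" by simp
  then show "x \<in> blocks (n0 + k) (SS n0 k) m" using js by (auto simp: blocks_def)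
qed

lemma blocks_SS_sub: "m \<le> e (n0 + k) \<Longrightarrow> blocks (n0 + k) (SS n0 k) m \<subseteq> SSall n0"
proof -
  assume "m \<le> e (n0 + k)"
  then have "blocks (n0 + k) (SS n0 k) m \<subseteq> SS n0 (Suc k)" using blocks_mono by simp
  then show ?thesis unfolding SSall_def by blast
qed

lemma infinite_SSall: "1 \<le> n0 \<Longrightarrow> infinite (SSall n0)"
proof
  assume n0: "1 \<le> n0" and fin: "finite (SSall n0)"
  have "2 ^ k \<le> card (SS n0 k)" for k
    unfolding card_SS[OF n0] using e_ge_2 by (induction k) (auto simp: mult.commute intro!: mult_le_mono)
  moreover have "card (SS n0 k) \<le> card (SSall n0)" for k
    by (rule card_mono[OF fin]) (auto simp: SSall_def)
  ultimately have "2 ^ card (SSall n0) \<le> card (SSall n0)" using order_trans by blast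
  then show False using less_exp[of "card (SSall n0)"] by simp
qed

text \<open>\<open>X\<close> is all of \<open>A\<close> below \<open>b\<close>. A member of index
  beyond \<open>K\<close> would, with its predecessors, give more than \<open>card X\<close>
  elements of \<open>X\<close>.\<close>

lemma initial_segment:
  fixes s :: "nat \<Rightarrow> nat"
  assumes s: "strict_mono_on {1..} s" "s ` {1..} = A" and "X \<subseteq> A" "finite X" "A \<inter> {..<b} \<subseteq> X" "X \<subseteq> {..<b}"
    and K: "card X \<le> K"
  shows "X \<subseteq> s ` {1..K}"
proof
  fix x assume x: "x \<in> X"
  then have "x \<in> s ` {1..}" using s(2) assms(3) by blast
  then obtain i where i: "1 \<le> i" "x = s i" by auto
  show "x \<in> s ` {1..K}"
  proof (cases "i \<le> K")
    case False
    have "s ` {1..i} \<subseteq> X"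
    proof
      fix y assume "y \<in> s ` {1..i}"
      then obtain j where j: "1 \<le> j" "j \<le> i" "y = s j" by auto
      have "s j \<le> s i" using s(1) j i by (cases "j = i") (auto simp: strict_mono_on_def less_imp_le)
      then have "y < b" using x i assms(6) j(3) by fastforce
      moreover have "y \<in> A" using s(2) j by auto
      ultimately show "y \<in> X" using assms(5) by blast
    qed
    then have "card (s ` {1..i}) \<le> card X" by (rule card_mono[OF assms(4)])
    moreover have "inj_on s {1..i}"
      by (rule inj_on_subset[OF strict_mono_on_imp_inj_on[OF s(1)]]) auto
    then have "card (s ` {1..i}) = i" by (simp add: card_image)
    ultimately show ?thesis using K False by simp
  qed (use i in auto)
qed

text \<open>The fraction of the positions of a block that survives in
  \<open>En_good_sum\<close>.\<close>

definition theta :: "nat \<Rightarrow> real" where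
  "theta n = (real (rr n) - 2) * real (h n) / real (w n)"

lemma rr_ge: "1 \<le> n \<Longrightarrow> 2 * n\<^sup>2 \<le> rr n"
  using C_ge_2 by (simp add: rr_def)

lemma theta_nonneg: "1 \<le> n \<Longrightarrow> 0 \<le> theta n"
proof -
  assume n: "1 \<le> n"
  then have "1 \<le> n\<^sup>2" by simp
  then have "2 \<le> rr n" using rr_ge[OF n] by linarith
  then show ?thesis unfolding theta_def by simp
qed

text \<open>As \<open>w n \<le> (rr n + 1) * h n\<close>, the loss is at most
  \<open>3 / (rr n + 1)\<close>, and \<open>rr n \<ge> 2 * n^2\<close>.\<close>

lemma theta_ge: "1 \<le> n \<Longrightarrow> 1 - 3 / (2 * (real n)\<^sup>2) \<le> theta n"
proof -
  assume n: "1 \<le> n"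
  have r: "2 * (real n)\<^sup>2 \<le> real (rr n)"
    using rr_ge[OF n] by (metis of_nat_le_iff of_nat_mult of_nat_numeral of_nat_power)
  have n2: "0 < (real n)\<^sup>2" using n by simp
  have hp: "0 < real (h n)" using h_pos[of n] by simp
  have w: "real (w n) \<le> (real (rr n) + 1) * real (h n)"
    using hs_le[of n] by (simp add: w_conv algebra_simps)
  have "3 / (real (rr n) + 1) \<le> 3 / (2 * (real n)\<^sup>2)" using r n2 by (intro divide_left_mono) auto
  then have "1 - 3 / (2 * (real n)\<^sup>2) \<le> 1 - 3 / (real (rr n) + 1)" by simp
  also have "\<dots> = (real (rr n) - 2) * real (h n) / ((real (rr n) + 1) * real (h n))"
  proof -
    have "1 - 3 / (real (rr n) + 1) = (real (rr n) - 2) / (real (rr n) + 1)"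
      by (simp add: diff_divide_eq_iff)
    then show ?thesis using hp by simp
  qed
  also have "\<dots> \<le> theta n"
    unfolding theta_def
  proof (rule divide_left_mono[OF w])
    have "2 * 1 \<le> 2 * (real n)\<^sup>2" using n by (intro mult_left_mono) auto
    then show "0 \<le> (real (rr n) - 2) * real (h n)" using r hp by (intro mult_nonneg_nonneg) auto
  qed (use hp w_pos[of n] in auto)
  finally show ?thesis .
qed

lemma one_minus_mult: "0 \<le> a \<Longrightarrow> 0 \<le> b \<Longrightarrow> 1 - a - b \<le> (1 - a) * (1 - b)" for a b :: real
  by (simp add: algebra_simps)

text \<open>The losses telescope: with \<open>f x = 3 / (2 * (x - 1))\<close> one has
  \<open>3 / (2 * x^2) \<le> f x - f (x + 1)\<close>, and \<open>f n0 \<le> 1 / 2\<close> for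
  \<open>n0 \<ge> 4\<close>.\<close>

lemma prod_theta_ge:
  assumes n0: "4 \<le> n0"
  shows "1 / 2 \<le> (\<Prod>i<k. theta (n0 + i))"
proof -
  define f where "f x = 3 / 2 * (1 / (real x - 1))" for x :: nat
  have f0: "f n0 \<le> 1 / 2"
  proof -
    have "1 / (real n0 - 1) \<le> 1 / 3" using n0 by (intro divide_left_mono) auto
    then have "3 / 2 * (1 / (real n0 - 1)) \<le> 3 / 2 * (1 / 3)" by (rule mult_left_mono) simp
    then show ?thesis by (simp add: f_def)
  qed
  have fpos: "0 \<le> f (n0 + k)" for k using n0 by (simp add: f_def)
  have fmono: "f (n0 + k) \<le> f n0" for k
    unfolding f_def using n0 by (intro mult_left_mono divide_left_mono) auto
  have "1 - (f n0 - f (n0 + k)) \<le> (\<Prod>i<k. theta (n0 + i))"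
  proof (induction k)
    case (Suc k)
    let ?m = "real (n0 + k)"
    let ?b = "3 / (2 * ?m\<^sup>2)"
    have m: "4 \<le> ?m" using n0 by simp
    have a: "0 \<le> f n0 - f (n0 + k)" "f n0 - f (n0 + k) \<le> 1" using f0 fpos[of k] fmono[of k] by linarith+
    have b: "0 \<le> ?b" "?b \<le> 1"
    proof -
      have "4 * 4 \<le> ?m\<^sup>2" unfolding power2_eq_square using m by (intro mult_mono) auto
      then show "?b \<le> 1" by (simp add: divide_le_eq)
    qed simp
    have tele: "?b \<le> f (n0 + k) - f (n0 + Suc k)"
    proof -
      have "1 / (?m * ?m) \<le> 1 / ((?m - 1) * ?m)"
        using m by (intro divide_left_mono mult_right_mono mult_pos_pos) auto
      also have "\<dots> = 1 / (?m - 1) - 1 / ?m" using m by (simp add: divide_simps)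
      finally have "3 / 2 * (1 / (?m * ?m)) \<le> 3 / 2 * (1 / (?m - 1) - 1 / ?m)" by (rule mult_left_mono) simp
      then show ?thesis by (simp add: f_def power2_eq_square right_diff_distrib)
    qed
    have "1 - (f n0 - f (n0 + Suc k)) \<le> 1 - (f n0 - f (n0 + k)) - ?b" using tele by linarith
    also have "\<dots> \<le> (1 - (f n0 - f (n0 + k))) * (1 - ?b)" using a b by (intro one_minus_mult)
    also have "\<dots> \<le> (\<Prod>i<k. theta (n0 + i)) * theta (n0 + k)"
      using Suc a b theta_ge[of "n0 + k"] n0
      by (intro mult_mono) (auto intro!: prod_nonneg theta_nonneg)
    finally show ?case by simp
  qed simp
  then show ?thesis using f0 fpos[of k] by linarith
qed

lemma Es_step_theta:
  assumes "resp n B" "N \<subseteq> {..<h n}" "m \<le> e n" and G: "real (h n) * y \<le> Es B n N"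
    and n: "1 \<le> n"
  shows "real (h (Suc n)) * (real m * theta n * y) \<le> Es B (Suc n) (blocks n N m)"
proof -
  have wp: "0 < real (w n)" using w_pos[of n] by simp
  have r: "2 \<le> rr n"
  proof -
    have "1 \<le> n\<^sup>2" using n by simp
    then show ?thesis using rr_ge[OF n] by linarith
  qed
  have "real (h (Suc n)) * (real m * theta n * y) = real (e n) * real m * (real (rr n) - 2) * (real (h n) * y)"
    using wp by (simp add: theta_def h_Suc)
  also have "\<dots> \<le> real (e n) * real m * (real (rr n) - 2) * Es B n N"
    using G r by (intro mult_left_mono) auto
  also have "\<dots> \<le> Es B (Suc n) (blocks n N m)" unfolding blocks_def by (rule Es_Suc[OF assms(1-3)])
  finally show ?thesis .
qed

lemma Es_SS:
  assumes B: "resp n0 B" and n0: "1 \<le> n0" and G: "real (h n0) * G \<le> Es B n0 {1}"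
  shows "real (h (n0 + k)) * (real (card (SS n0 k)) * (\<Prod>i<k. theta (n0 + i)) * G) \<le> Es B (n0 + k) (SS n0 k)"
proof (induction k)
  case (Suc k)
  have "real (h (Suc (n0 + k))) * (real (e (n0 + k)) * theta (n0 + k) * (real (card (SS n0 k)) * (\<Prod>i<k. theta (n0 + i)) * G))
     \<le> Es B (Suc (n0 + k)) (blocks (n0 + k) (SS n0 k) (e (n0 + k)))"
    using n0 by (intro Es_step_theta[OF resp_mono[OF _ B] SS_less[OF n0] _ Suc]) auto
  moreover have "card (SS n0 (Suc k)) = e (n0 + k) * card (SS n0 k)"
    by (simp add: card_blocks[OF SS_less[OF n0]])
  ultimately show ?case by (simp add: mult_ac del: SS.simps) (simp add: mult_ac)
qed (use G in simp)

text \<open>Choose \<open>k\<close> with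
  \<open>card (SS n0 k) \<le> K < card (SS n0 (Suc k))\<close>; the first \<open>K\<close> times
  contain \<open>m = K div card (SS n0 k)\<close> complete translates of \<open>SS n0 k\<close>. The
  8 collects three factors of 2, from the incomplete translate, the product of the
  \<open>theta\<close>, and the measure covered by the tower.\<close>

lemma ent_lower:
  assumes B: "resp n0 B" and n0: "4 \<le> n0" and G: "real (h n0) * G \<le> Es B n0 {1}" "0 \<le> G"
    and mm: "1 / 2 \<le> mm n0" and s: "strict_mono_on {1..} s" "s ` {1..} = SSall n0" and K: "1 \<le> K"
  shows "real K * G / 8 \<le> ment M (hits T B (s ` {1..K}))"
proof -
  have n1: "1 \<le> n0" using n0 by simp
  have "\<exists>k. card (SS n0 k) \<le> K \<and> K < card (SS n0 (Suc k))"
  proof -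
    have g: "2 ^ k \<le> card (SS n0 k)" for k
      unfolding card_SS[OF n1] using e_ge_2 by (induction k) (auto simp: mult.commute intro!: mult_le_mono)
    have "K < card (SS n0 K)" by (rule less_le_trans[OF less_exp g])
    then have "\<exists>k. K < card (SS n0 k)" by blast
    then obtain k where k: "K < card (SS n0 k)" "\<And>i. i < k \<Longrightarrow> \<not> K < card (SS n0 i)"
      unfolding exists_least_iff[of "\<lambda>k. K < card (SS n0 k)"] by blast
    have "k \<noteq> 0" using K k(1) by (cases k) auto
    then obtain k' where "k = Suc k'" by (cases k) auto
    then show ?thesis using k(1) k(2)[of k'] by (intro exI[of _ k']) (simp del: SS.simps)
  qed
  then obtain k where k: "card (SS n0 k) \<le> K" "K < card (SS n0 (Suc k))" by blast
  let ?c = "card (SS n0 k)" and ?n = "n0 + k"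
  define m where "m = K div ?c"
  have cpos: "0 < ?c" using card_SS[OF n1, of k] e_ge_1 by (auto intro!: prod_pos simp: Suc_le_eq)
  have cS: "card (SS n0 (Suc k)) = e ?n * ?c" by (simp add: card_blocks[OF SS_less[OF n1]])
  have m: "1 \<le> m" "m \<le> e ?n" "m * ?c \<le> K" "K \<le> 2 * (m * ?c)"
  proof -
    show m1: "1 \<le> m" using k(1) cpos by (simp add: m_def div_greater_zero_iff Suc_le_eq)
    show "m * ?c \<le> K" by (simp add: m_def)
    have "m < e ?n" using k(2) cpos unfolding cS m_def by (simp add: div_less_iff_less_mult)
    then show "m \<le> e ?n" by simp
    have "K = m * ?c + K mod ?c" by (simp add: m_def)
    moreover have "K mod ?c < ?c" using cpos by simp
    moreover have "?c \<le> m * ?c" using m1 by simp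
    ultimately show "K \<le> 2 * (m * ?c)" by linarith
  qed
  let ?N = "blocks ?n (SS n0 k) m"
  have resp1: "resp ?n B" "resp (Suc ?n) B" using resp_mono[OF _ B] by simp_all
  have Nsub: "?N \<subseteq> {..<m * w ?n}" by (rule blocks_less[OF SS_less[OF n1]])
  have Nh: "?N \<subseteq> {..<h (Suc ?n)}"
  proof -
    have "m * w ?n \<le> h (Suc ?n)" using m(2) by (simp add: h_Suc mult.commute)
    then show ?thesis using Nsub by fastforce
  qed
  have finN: "finite ?N" by (intro finite_blocks finite_SS)
  have "?N \<subseteq> s ` {1..K}"
    using initial_segment[OF s blocks_SS_sub[OF m(2)] finN SSall_low[OF n1 m(2)] Nsub] m(3)
    by (simp add: card_blocks[OF SS_less[OF n1]])
  then have ge: "ment M (hits T B ?N) \<le> ment M (hits T B (s ` {1..K}))"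
    using resp_sets[OF B] by (intro S.ment_hits_subset) auto
  have E1: "real (h (Suc ?n)) * (real m * theta ?n * (real ?c * (\<Prod>i<k. theta (n0 + i)) * G)) \<le> Es B (Suc ?n) ?N"
    using n0 by (intro Es_step_theta[OF resp1(1) SS_less[OF n1] m(2) Es_SS[OF B n1 G(1)]]) simp
  \<comment> \<open>The times \<open>?N\<close> lie below the height of stage \<open>?n'\<close>.
    One more stage is needed to pass from columns to the measure, since only there do they fit
    without wrapping.\<close>
  let ?n' = "Suc ?n"
  let ?cv = "real (c (Suc ?n')) * v (Suc ?n')"
  have thp: "0 \<le> theta ?n'" "0 < real (w ?n')" using theta_nonneg[of ?n'] w_pos[of ?n'] by auto
  have r2: "0 \<le> real (rr ?n') - 2"
  proof -
    have "1 \<le> ?n'\<^sup>2" by simp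
    then have "2 \<le> rr ?n'" using rr_ge[of ?n'] by linarith
    then show ?thesis by simp
  qed
  have c0: "0 < ?cv" using W_facts(4,5) by simp
  have "mm (Suc ?n') * (theta ?n' * (real m * theta ?n * (real ?c * (\<Prod>i<k. theta (n0 + i)) * G)))
     = ?cv * (real (e ?n') * (real (rr ?n') - 2) * (real (h ?n') * (real m * theta ?n * (real ?c * (\<Prod>i<k. theta (n0 + i)) * G))))"
    using thp(2) unfolding mm_def theta_def[of ?n'] h_Suc[of ?n'] by (simp add: field_simps)
  also have "\<dots> \<le> ?cv * (real (e ?n') * (real (rr ?n') - 2) * Es B ?n' ?N)"
    using E1 c0 r2 by (intro mult_left_mono) auto
  also have "\<dots> \<le> ment M (hits T B ?N)" by (rule ment_hits_ge[OF resp1(2) Nh])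
  finally have 1: "mm (Suc ?n') * (theta ?n' * (real m * theta ?n * (real ?c * (\<Prod>i<k. theta (n0 + i)) * G)))
     \<le> ment M (hits T B ?N)" .
  have "1 / 2 \<le> (\<Prod>i<Suc (Suc k). theta (n0 + i))" by (rule prod_theta_ge[OF n0])
  also have "\<dots> = theta ?n' * theta ?n * (\<Prod>i<k. theta (n0 + i))" by (simp add: mult_ac)
  finally have P: "1 / 2 \<le> theta ?n' * theta ?n * (\<Prod>i<k. theta (n0 + i))" .
  have m2: "1 / 2 \<le> mm (Suc ?n')" using mm mm_incseq[THEN incseqD, of n0 "Suc ?n'"] by simp
  have "real K * G / 8 \<le> (2 * real (m * ?c)) * G / 8"
    using m(4) G(2) by (intro divide_right_mono mult_right_mono) (simp_all flip: of_nat_mult)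
  also have "\<dots> = (1 / 2) * (1 / 2) * (real m * real ?c * G)" by simp
  also have "\<dots> \<le> mm (Suc ?n') * (theta ?n' * theta ?n * (\<Prod>i<k. theta (n0 + i))) * (real m * real ?c * G)"
    using P m2 G(2) by (intro mult_right_mono mult_mono) auto
  also have "\<dots> = mm (Suc ?n') * (theta ?n' * (real m * theta ?n * (real ?c * (\<Prod>i<k. theta (n0 + i)) * G)))"
    by (simp add: mult_ac)
  finally show ?thesis using 1 ge by linarith
qed

end

subsection \<open>Counting names\<close>

text \<open>A window of a concatenation of spacers and of copies of \<open>concat (replicate r (u D))\<close>,
  each of length \<open>H\<close>, is described by the list of the copies meeting it, each copy given by the
  position of its right end relative to the window and by \<open>D\<close>.\<close>

inductive spaced :: "'a set \<Rightarrow> ('a \<Rightarrow> bool list) \<Rightarrow> bool list \<Rightarrow> bool" for S g where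
  Nil: "spaced S g []"
| Spacer: "spaced S g x \<Longrightarrow> spaced S g (False # x)"
| Block: "spaced S g x \<Longrightarrow> D \<in> S \<Longrightarrow> spaced S g (g D @ x)"

lemma spaced_append: "spaced S g x \<Longrightarrow> spaced S g y \<Longrightarrow> spaced S g (x @ y)"
  by (induction rule: spaced.induct) (auto intro: spaced.intros)

lemma spaced_concat: "(\<And>x. x \<in> set xs \<Longrightarrow> spaced S g x) \<Longrightarrow> spaced S g (concat xs)"
  by (induction xs) (auto intro: spaced.Nil spaced_append)

lemma spaced_replicate_False: "spaced S g (replicate k False)"
  by (induction k) (auto intro: spaced.intros)

text \<open>A copy with right end \<open>a\<close> begins at \<open>a - H\<close>, possibly before
  the window, and \<open>s + H - a\<close> is the index of \<open>s\<close> inside it. Recording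
  right ends avoids negative positions.\<close>

definition dec :: "nat \<Rightarrow> ('a \<Rightarrow> bool list) \<Rightarrow> (nat \<times> 'a) list \<Rightarrow> nat set" where
  "dec H g \<theta> = {s. \<exists>(a, D)\<in>set \<theta>. s < a \<and> a \<le> s + H \<and> g D ! (s + H - a)}"

lemma dec_Cons: "dec H g ((a, D) # \<theta>) = {s. s < a \<and> a \<le> s + H \<and> g D ! (s + H - a)} \<union> dec H g \<theta>"
  by (auto simp: dec_def)

lemma dec_shift:
  assumes "\<And>a D. (a, D) \<in> set \<theta> \<Longrightarrow> H \<le> a"
  shows "dec H g (map (\<lambda>(a, D). (a + d, D)) \<theta>) = (\<lambda>s. s + d) ` dec H g \<theta>"
proof (intro set_eqI iffI)
  fix s assume "s \<in> dec H g (map (\<lambda>(a, D). (a + d, D)) \<theta>)"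
  then obtain a D where aD: "(a, D) \<in> set \<theta>" "s < a + d" "a + d \<le> s + H" "g D ! (s + H - (a + d))"
    by (auto simp: dec_def)
  have "d \<le> s" using assms[OF aD(1)] aD(3) by simp
  then have "s - d \<in> dec H g \<theta>" unfolding dec_def
    using aD by (intro CollectI bexI[of _ "(a, D)"]) (auto simp: algebra_simps)
  then show "s \<in> (\<lambda>s. s + d) ` dec H g \<theta>" using \<open>d \<le> s\<close> by (intro image_eqI[of _ _ "s - d"]) auto
next
  fix s assume "s \<in> (\<lambda>s. s + d) ` dec H g \<theta>"
  then obtain s' where "s' \<in> dec H g \<theta>" "s = s' + d" by auto
  then show "s \<in> dec H g (map (\<lambda>(a, D). (a + d, D)) \<theta>)" unfolding dec_def
    by (auto simp: image_iff algebra_simps intro!: bexI)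
qed

text \<open>A window that starts at a boundary cuts no copy on its left, so all right ends are at
  least \<open>H\<close>; this is what allows a description to be shifted in the induction.\<close>

lemma spaced_prefix:
  assumes "spaced S g x" and H: "0 < H" and g: "\<And>D. D \<in> S \<Longrightarrow> length (g D) = H"
  shows "L \<le> length x \<Longrightarrow> \<exists>\<theta>. length \<theta> \<le> L div H + 1 \<and> (\<forall>(a, D)\<in>set \<theta>. H \<le> a \<and> a < L + H \<and> D \<in> S)
     \<and> {s. s < L \<and> x ! s} = {..<L} \<inter> dec H g \<theta>"
  using assms(1)
proof (induction arbitrary: L rule: spaced.induct)
  case Nil
  then show ?case by (intro exI[of _ "[]"]) auto
next
  case (Spacer x)
  show ?case
  proof (cases L)
    case 0
    then show ?thesis by (intro exI[of _ "[]"]) auto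
  next
    case (Suc L')
    then obtain \<theta> where th: "length \<theta> \<le> L' div H + 1" "\<forall>(a, D)\<in>set \<theta>. H \<le> a \<and> a < L' + H \<and> D \<in> S"
      "{s. s < L' \<and> x ! s} = {..<L'} \<inter> dec H g \<theta>" using Spacer.IH[of L'] Spacer.prems by auto
    let ?th = "map (\<lambda>(a, D). (a + 1, D)) \<theta>"
    have d: "dec H g ?th = (\<lambda>s. s + 1) ` dec H g \<theta>" using th(2) by (intro dec_shift) auto
    have "{s. s < L \<and> (False # x) ! s} = (\<lambda>s. s + 1) ` {s. s < L' \<and> x ! s}"
    proof (intro set_eqI iffI)
      fix s assume "s \<in> {s. s < L \<and> (False # x) ! s}"
      then show "s \<in> (\<lambda>s. s + 1) ` {s. s < L' \<and> x ! s}" using Suc by (cases s) auto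
    qed (use Suc in auto)
    also have "\<dots> = {..<L} \<inter> dec H g ?th" unfolding th(3) d using Suc by auto
    finally have "{s. s < L \<and> (False # x) ! s} = {..<L} \<inter> dec H g ?th" .
    moreover have "length ?th \<le> L div H + 1"
    proof -
      have "L' div H \<le> L div H" by (rule div_le_mono) (simp add: Suc)
      then show ?thesis using th(1) by simp
    qed
    moreover have "\<forall>(a, D)\<in>set ?th. H \<le> a \<and> a < L + H \<and> D \<in> S" using th(2) Suc by auto
    ultimately show ?thesis by blast
  qed
next
  case (Block x D)
  have lg: "length (g D) = H" by (rule g[OF Block.hyps(2)])
  show ?case
  proof (cases "L \<le> H")
    case True
    have "{s. s < L \<and> (g D @ x) ! s} = {..<L} \<inter> dec H g [(H, D)]"
      using True lg by (auto simp: dec_def nth_append)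
    then show ?thesis using Block.hyps(2)
    proof (cases "L = 0")
      case False
      then show ?thesis using \<open>{s. s < L \<and> (g D @ x) ! s} = _\<close> Block.hyps(2) by (intro exI[of _ "[(H, D)]"]) auto
    qed (intro exI[of _ "[]"], auto)
  next
    case False
    let ?L = "L - H"
    have "?L \<le> length x" using Block.prems lg by simp
    from Block.IH[OF this]
    obtain \<theta> where th: "length \<theta> \<le> ?L div H + 1" "\<forall>(a, D)\<in>set \<theta>. H \<le> a \<and> a < ?L + H \<and> D \<in> S"
      "{s. s < ?L \<and> x ! s} = {..<?L} \<inter> dec H g \<theta>" by blast
    let ?th = "(H, D) # map (\<lambda>(a, D). (a + H, D)) \<theta>"
    have d: "dec H g (map (\<lambda>(a, D). (a + H, D)) \<theta>) = (\<lambda>s. s + H) ` dec H g \<theta>" using th(2) by (intro dec_shift) auto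
    have "{s. s < L \<and> (g D @ x) ! s} = {s. s < H \<and> g D ! s} \<union> (\<lambda>s. s + H) ` {s. s < ?L \<and> x ! s}"
    proof (intro set_eqI iffI)
      fix s assume s: "s \<in> {s. s < L \<and> (g D @ x) ! s}"
      show "s \<in> {s. s < H \<and> g D ! s} \<union> (\<lambda>s. s + H) ` {s. s < ?L \<and> x ! s}"
      proof (cases "s < H")
        case False
        then have "s - H < ?L" "x ! (s - H)" using s lg by (auto simp: nth_append)
        then have "s - H + H \<in> (\<lambda>s. s + H) ` {s. s < ?L \<and> x ! s}" by blast
        then show ?thesis using False by simp
      qed (use s lg in \<open>auto simp: nth_append\<close>)
    qed (use lg False in \<open>auto simp: nth_append\<close>)
    also have "\<dots> = {..<L} \<inter> dec H g ?th"
      unfolding th(3) dec_Cons d using False by auto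
    finally have "{s. s < L \<and> (g D @ x) ! s} = {..<L} \<inter> dec H g ?th" .
    moreover have "length ?th \<le> L div H + 1"
      using th(1) False H by (simp add: le_div_geq)
    moreover have "\<forall>(a, D)\<in>set ?th. H \<le> a \<and> a < L + H \<and> D \<in> S" using th(2) False Block.hyps(2) by auto
    ultimately show ?thesis by blast
  qed
qed

text \<open>Once the pieces before the window are removed, at most one copy is cut by its left end;
  the rest is a window that starts at a boundary.\<close>

lemma spaced_window:
  assumes "spaced S g x" and H: "0 < H" and g: "\<And>D. D \<in> S \<Longrightarrow> length (g D) = H"
  shows "p + L \<le> length x \<Longrightarrow> \<exists>\<theta>. length \<theta> \<le> L div H + 2 \<and> (\<forall>(a, D)\<in>set \<theta>. a < L + H \<and> D \<in> S)
     \<and> {s. s < L \<and> x ! (p + s)} = {..<L} \<inter> dec H g \<theta>"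
  using assms(1)
proof (induction arbitrary: p rule: spaced.induct)
  case Nil
  then show ?case by (intro exI[of _ "[]"]) auto
next
  case (Spacer x)
  show ?case
  proof (cases p)
    case 0
    obtain \<theta> where "length \<theta> \<le> L div H + 1" "\<forall>(a, D)\<in>set \<theta>. H \<le> a \<and> a < L + H \<and> D \<in> S"
      "{s. s < L \<and> (False # x) ! s} = {..<L} \<inter> dec H g \<theta>"
      using spaced_prefix[OF spaced.Spacer[OF Spacer.hyps] H g, of L] Spacer.prems 0 by auto
    then show ?thesis using 0 by (intro exI[of _ \<theta>]) auto
  next
    case (Suc p')
    then show ?thesis using Spacer.IH[of p'] Spacer.prems by simp
  qed
next
  case (Block x D)
  have lg: "length (g D) = H" by (rule g[OF Block.hyps(2)])
  show ?case
  proof (cases "H \<le> p")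
    case True
    then have "p - H + L \<le> length x" using Block.prems lg by simp
    from Block.IH[OF this]
    obtain \<theta> where "length \<theta> \<le> L div H + 2" "\<forall>(a, D)\<in>set \<theta>. a < L + H \<and> D \<in> S"
      "{s. s < L \<and> x ! (p - H + s)} = {..<L} \<inter> dec H g \<theta>" by blast
    moreover have "(g D @ x) ! (p + s) = x ! (p - H + s)" for s using True lg by (simp add: nth_append)
    ultimately show ?thesis by (simp only:) blast
  next
    case False
    note Hp = False
    let ?d = "H - p"
    let ?L = "L - ?d"
    have "?L \<le> length x" using Block.prems lg by simp
    from spaced_prefix[OF Block.hyps(1) H g this]
    obtain \<theta> where th: "length \<theta> \<le> ?L div H + 1" "\<forall>(a, D)\<in>set \<theta>. H \<le> a \<and> a < ?L + H \<and> D \<in> S"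
      "{s. s < ?L \<and> x ! s} = {..<?L} \<inter> dec H g \<theta>" by auto
    show ?thesis
    proof (cases "L \<le> ?d")
      case True
      have "{s. s < L \<and> (g D @ x) ! (p + s)} = {..<L} \<inter> dec H g [(?d, D)]"
      proof (intro set_eqI)
        fix s
        show "s \<in> {s. s < L \<and> (g D @ x) ! (p + s)} \<longleftrightarrow> s \<in> {..<L} \<inter> dec H g [(?d, D)]"
          using True lg False by (auto simp: dec_def nth_append add.commute[of p s])
      qed
      then show ?thesis
      proof (cases "L = 0")
        case False
        then show ?thesis using \<open>{s. s < L \<and> (g D @ x) ! (p + s)} = _\<close> Block.hyps(2)
          by (intro exI[of _ "[(?d, D)]"]) auto
      qed (intro exI[of _ "[]"], auto)
    next
      case dL: False
      let ?th = "(?d, D) # map (\<lambda>(a, D). (a + ?d, D)) \<theta>"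
      have d: "dec H g (map (\<lambda>(a, D). (a + ?d, D)) \<theta>) = (\<lambda>s. s + ?d) ` dec H g \<theta>" using th(2) by (intro dec_shift) auto
      have "{s. s < L \<and> (g D @ x) ! (p + s)} = {s. s < ?d \<and> g D ! (p + s)} \<union> (\<lambda>s. s + ?d) ` {s. s < ?L \<and> x ! s}"
      proof (intro set_eqI iffI)
        fix s assume s: "s \<in> {s. s < L \<and> (g D @ x) ! (p + s)}"
        show "s \<in> {s. s < ?d \<and> g D ! (p + s)} \<union> (\<lambda>s. s + ?d) ` {s. s < ?L \<and> x ! s}"
        proof (cases "s < ?d")
          case False
          have q: "s - ?d = p + s - H" using Hp by simp
          have "(g D @ x) ! (p + s) = x ! (p + s - H)" 
          proof -
            have "\<not> p + s < H" using False by linarith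
            then show ?thesis using lg by (simp add: nth_append)
          qed
          then have "x ! (s - ?d)" unfolding q using s by simp
          moreover have "s - ?d < ?L" using s False by auto
          ultimately have "s - ?d < ?L" "x ! (s - ?d)" by blast+
          then have "s - ?d + ?d \<in> (\<lambda>s. s + ?d) ` {s. s < ?L \<and> x ! s}" by blast
          then show ?thesis using False by simp
        qed (use s lg in \<open>auto simp: nth_append\<close>)
      next
        fix s assume "s \<in> {s. s < ?d \<and> g D ! (p + s)} \<union> (\<lambda>s. s + ?d) ` {s. s < ?L \<and> x ! s}"
        then show "s \<in> {s. s < L \<and> (g D @ x) ! (p + s)}"
        proof
          assume "s \<in> (\<lambda>s. s + ?d) ` {s. s < ?L \<and> x ! s}"
          then obtain s' where s': "s = s' + ?d" "s' < ?L" "x ! s'" by blast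
          have "p + s - H = s'" using s'(1) False by simp
          then show ?thesis using s' lg False by (auto simp: nth_append)
        qed (use dL lg in \<open>auto simp: nth_append\<close>)
      qed
      also have "\<dots> = {..<L} \<inter> dec H g ?th"
      proof -
        have "{s. s < ?d \<and> g D ! (p + s)} = {s. s < ?d \<and> ?d \<le> s + H \<and> g D ! (s + H - ?d)}"
        proof (intro Collect_cong conj_cong refl)
          fix s
          have "s + H - ?d = p + s" using False by simp
          then show "g D ! (p + s) \<longleftrightarrow> ?d \<le> s + H \<and> g D ! (s + H - ?d)" by auto
        qed
        moreover have "\<dots> = {..<L} \<inter> \<dots>" using dL by auto
        moreover have "(\<lambda>s. s + ?d) ` ({..<?L} \<inter> A) = {..<L} \<inter> (\<lambda>s. s + ?d) ` A" for A
        proof (intro set_eqI iffI)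
          fix s assume "s \<in> {..<L} \<inter> (\<lambda>s. s + ?d) ` A"
          then obtain s' where s': "s' \<in> A" "s = s' + ?d" "s < L" by blast
          then have "s' < ?L" by simp
          then show "s \<in> (\<lambda>s. s + ?d) ` ({..<?L} \<inter> A)" using s' by blast
        qed (use dL in auto)
        ultimately show ?thesis unfolding th(3) dec_Cons d by (simp only: Int_Un_distrib)
      qed
      finally have "{s. s < L \<and> (g D @ x) ! (p + s)} = {..<L} \<inter> dec H g ?th" .
      moreover have "length ?th \<le> L div H + 2"
        using th(1) div_le_mono[of ?L L H] by simp
      moreover have "\<forall>(a, D)\<in>set ?th. a < L + H \<and> D \<in> S" using th(2) dL Block.hyps(2) by auto
      ultimately show ?thesis by blast
    qed
  qed
qed

context cs_sys
begin

text \<open>Spacers inserted at stage \<open>N\<close> or later lie outside \<open>U N\<close>,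
  which contains \<open>B\<close>, so all of them show \<open>False\<close>. Everything else in the
  column is a repeated column of stage \<open>N\<close>.\<close>

lemma word_spaced:
  assumes B: "resp N B" and "N < n" and D: "D \<in> set (W n)"
  shows "spaced (set (W N)) (\<lambda>D. concat (replicate (rr N) (word B D))) (word B D)"
  using assms(2) D
proof (induction n arbitrary: D)
  case (Suc n)
  let ?g = "\<lambda>D. concat (replicate (rr N) (word B D))"
  have Bn: "resp n B" using Suc.prems(1) by (intro resp_mono[OF _ B]) simp
  obtain P \<kappa> where P: "P ` TT n = set (W (Suc n))"
    "\<And>J. J \<in> TT n \<Longrightarrow> built (v (Suc n)) ({0..<1} - U n) (pln n J) (col_ends (P J))"
    by (rule step_rel_obtain[of n]) blast
  obtain J where J: "J \<in> TT n" "D = P J" using Suc.prems(2) P(1) by blast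
  have blk: "spaced (set (W N)) ?g (concat (replicate (rr n) (word B E)))" if E: "E \<in> set (W n)" for E
  proof (cases "n = N")
    case True
    show ?thesis using spaced.Block[OF spaced.Nil, of E "set (W N)" ?g] E True by simp
  next
    case False
    then have "spaced (set (W N)) ?g (word B E)" using Suc.IH[of E] Suc.prems(1) E by simp
    then show ?thesis by (intro spaced_concat) auto
  qed
  have "spaced (set (W N)) ?g (map (\<lambda>a. a \<in> B) (col_ends (P J)))"
    unfolding word_plan[OF Bn J(1) P(2)[OF J(1)]]
    using blk TT_nth[OF J(1)] by (intro spaced_concat) (auto intro!: spaced_append spaced_replicate_False)
  then show ?case unfolding J(2) word_def .
qed simp

text \<open>In tower \<open>n\<close> only the top \<open>L\<close> levels are excluded. Their
  measure is at most \<open>L * c n * v n\<close>, which tends to 0, as does the measure missed by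
  the tower.\<close>

lemma AE_window: "AE x in M. \<exists>n>N. \<exists>D\<in>set (W n). \<exists>p. p + L \<le> h n \<and> p < h n \<and> x \<in> level D p"
proof -
  define G where "G n = (\<Union>(D, p)\<in>set (W n) \<times> {..<h n - L}. level D p)" for n
  have G: "G n \<in> sets M" "mm n - real L * (real (c n) * v n) \<le> measure M (G n)" for n
  proof -
    have sub: "set (W n) \<times> {..<h n - L} \<subseteq> set (W n) \<times> {..<h n}" by auto
    show "G n \<in> sets M" unfolding G_def by (rule measure_levels(1)[OF sub])
    have "measure M (G n) = real (c n) * real (h n - L) * v n"
      unfolding G_def measure_levels(2)[OF sub] by (simp add: card_cartesian_product card_set_W)
    moreover have "real (c n) * v n * (real (h n) - real L) \<le> real (c n) * v n * real (h n - L)"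
      using W_facts(4)[of n] by (intro mult_left_mono) auto
    ultimately show "mm n - real L * (real (c n) * v n) \<le> measure M (G n)"
      by (simp add: mm_def algebra_simps)
  qed
  define Bad where "Bad = space M - (\<Union>n\<in>{N<..}. G n)"
  have GU: "(\<Union>n\<in>{N<..}. G n) \<in> sets M" by (rule sets.countable_UN') (use G(1) in auto)
  have Bad: "Bad \<in> sets M" unfolding Bad_def by (rule sets.compl_sets[OF GU])
  have "measure M Bad \<le> 1 - (mm n - real L * (real (c n) * v n))" if "N < n" for n
  proof -
    have "measure M Bad \<le> measure M (space M - G n)"
      unfolding Bad_def using that sets.compl_sets[OF G(1)[of n]] by (intro M.finite_measure_mono) auto
    then show ?thesis using G(2)[of n] M.prob_compl[OF G(1)[of n]] by linarith
  qed
  moreover have "(\<lambda>n. 1 - (mm n - real L * (real (c n) * v n))) \<longlonglongrightarrow> 1 - (1 - real L * 0)"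
    by (intro tendsto_intros mm_tendsto cv_tendsto)
  ultimately have "measure M Bad \<le> 1 - (1 - real L * 0)"
    by (intro LIMSEQ_le_const[of _ _ "measure M Bad"]) (auto intro!: exI[of _ "Suc N"])
  then have "measure M Bad = 0" by (simp add: measure_le_0_iff)
  then have "AE x in M. x \<notin> Bad" using M.prob_eq_0[OF Bad] by simp
  then show ?thesis
  proof (rule AE_mp, intro AE_I2 impI)
    fix x assume "x \<in> space M" "x \<notin> Bad"
    then obtain n where n: "N < n" "x \<in> G n" unfolding Bad_def by auto
    then obtain D p where D: "D \<in> set (W n)" "p < h n - L" "x \<in> level D p" unfolding G_def by blast
    then show "\<exists>n>N. \<exists>D\<in>set (W n). \<exists>p. p + L \<le> h n \<and> p < h n \<and> x \<in> level D p"
      using n(1) by (intro exI[of _ n] conjI bexI[of _ D] exI[of _ p]) auto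
  qed
qed

text \<open>The entropy is at most the logarithm of the number of descriptions, and a description
  lists at most \<open>L div H + 2\<close> copies, each by a position below \<open>L + H\<close> and
  a column.\<close>

lemma ment_window_le:
  assumes B: "resp N B" and L: "0 < L"
  defines "H \<equiv> rr N * h N"
  shows "ment M (hits T B {..<L}) \<le> real (L div H + 2) * (ln (real (L + H)) + ln (real (c N)))"
proof -
  let ?g = "\<lambda>D. concat (replicate (rr N) (word B D))"
  let ?Q = "{..<L + H} \<times> set (W N)"
  let ?K = "L div H + 2"
  define Y where "Y = (\<lambda>\<theta>. {..<L} \<inter> dec H ?g \<theta>) ` {\<theta>. set \<theta> \<subseteq> ?Q \<and> length \<theta> = ?K}"
  have H: "0 < H" using rr_pos[of N] h_pos[of N] by (simp add: H_def)
  have g: "length (?g D) = H" if "D \<in> set (W N)" for D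
    using length_word[OF that] by (simp add: length_concat sum_list_replicate H_def)
  have finQ: "finite ?Q" by simp
  have c: "0 < c N" by (rule W_facts(5))
  then obtain D0 where D0: "D0 \<in> set (W N)" unfolding c_def by (cases "W N") auto
  have finY: "finite Y" unfolding Y_def using finite_lists_length_eq[OF finQ] by simp
  have inY: "{s. s < L \<and> x ! (p + s)} \<in> Y" if x: "spaced (set (W N)) ?g x" "p + L \<le> length x" for x p
  proof -
    obtain \<theta> where th: "length \<theta> \<le> ?K" "\<forall>(a, D)\<in>set \<theta>. a < L + H \<and> D \<in> set (W N)"
      "{s. s < L \<and> x ! (p + s)} = {..<L} \<inter> dec H ?g \<theta>"
      using spaced_window[OF x(1) H g x(2)] by auto
    \<comment> \<open>Entries with right end 0 decode to nothing, so padding with them brings all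
      descriptions to one length.\<close>
    let ?th = "\<theta> @ replicate (?K - length \<theta>) (0, D0)"
    have "dec H ?g ?th = dec H ?g \<theta>" unfolding dec_def by auto
    moreover have "set ?th \<subseteq> ?Q" using th(2) D0 L by auto
    moreover have "length ?th = ?K" using th(1) by simp
    ultimately show ?thesis unfolding Y_def th(3) by (intro image_eqI[of _ _ ?th]) auto
  qed
  have "card Y \<le> card {\<theta>. set \<theta> \<subseteq> ?Q \<and> length \<theta> = ?K}"
    unfolding Y_def by (rule card_image_le[OF finite_lists_length_eq[OF finQ]])
  also have "\<dots> = ((L + H) * c N) ^ ?K"
    unfolding card_lists_length_eq[OF finQ] by (simp add: card_cartesian_product card_set_W)
  finally have cY: "card Y \<le> ((L + H) * c N) ^ ?K" .
  have "AE x in M. hits T B {..<L} x \<in> Y"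
    using AE_window[of N L]
  proof (rule AE_mp, intro AE_I2 impI)
    fix x assume "\<exists>n>N. \<exists>D\<in>set (W n). \<exists>p. p + L \<le> h n \<and> p < h n \<and> x \<in> level D p"
    then obtain n D p where D: "N < n" "D \<in> set (W n)" "p + L \<le> h n" "x \<in> level D p" by blast
    have Bn: "resp n B" using D(1) by (intro resp_mono[OF _ B]) simp
    have "(T ^^ s) x \<in> B \<longleftrightarrow> word B D ! (p + s)" if "s < L" for s
    proof -
      have ps: "p + s < h n" using that D(3) by simp
      have "(T ^^ s) x \<in> level D (p + s)" by (rule T_pow_level[OF D(2,4) ps])
      from resp_bit[OF Bn D(2) ps this] show ?thesis using ps W_facts(7)[OF D(2)] by (simp add: word_def)
    qed
    then have "hits T B {..<L} x = {s. s < L \<and> word B D ! (p + s)}" unfolding hits_def by blast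
    also have "\<dots> \<in> Y" using word_spaced[OF B D(1,2)] D(3) length_word[OF D(2)] by (intro inY) auto
    finally show "hits T B {..<L} x \<in> Y" .
  qed
  then have "ment M (hits T B {..<L}) \<le> ln (real (card Y))"
    using resp_sets[OF B] finY by (intro M.ment_le_ln_card S.simple_hits) auto
  also have "\<dots> \<le> ln (real (((L + H) * c N) ^ ?K))"
  proof -
    have mono: "ln (real k) \<le> ln (real k')" if "k \<le> k'" "1 \<le> k'" for k k' :: nat
      using that by (cases "k = 0") auto
    have "0 < (L + H) * c N" using L c by simp
    then have "1 \<le> ((L + H) * c N) ^ ?K" by (simp add: Suc_le_eq)
    then show ?thesis by (rule mono[OF cY])
  qed
  also have "\<dots> = real ?K * (ln (real (L + H)) + ln (real (c N)))"
  proof -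
    have "ln (real (((L + H) * c N) ^ ?K)) = real ?K * ln (real ((L + H) * c N))"
      unfolding of_nat_power by (rule ln_realpow)
    also have "ln (real ((L + H) * c N)) = ln (real (L + H)) + ln (real (c N))"
      using L c by (simp add: ln_mult del: of_nat_add)
    finally show ?thesis .
  qed
  finally show ?thesis .
qed

subsection \<open>The growth of the number of columns\<close>

text \<open>Here \<open>ln 2\<close> is \<open>ln (c 0)\<close>, and the exponential bounds the
  product of the factors \<open>1 + 1 / e (nn t)\<close>.\<close>

definition Kc :: real where
  "Kc = ln 2 * exp (\<Sum>t. real (nn (Suc t)) powr (- 2 * \<tau> / (1 - \<tau>)))"

lemma c_Suc: "c (Suc n) = c n ^ (e n + (if n \<in> nn ` {1..} then 1 else 0))"
  using next_all[of n] unfolding next_rel_def by auto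

lemma ln_c: "ln (real (c n)) = ln 2 * (\<Prod>i<n. real (e i) + (if i \<in> nn ` {1..} then 1 else 0))"
proof (induction n)
  case (Suc n)
  have "ln (real (c (Suc n))) = real (e n + (if n \<in> nn ` {1..} then 1 else 0)) * ln (real (c n))"
    using W_facts(5)[of n] unfolding c_Suc of_nat_power by (simp add: ln_realpow)
  then show ?case using Suc by (simp add: mult_ac)
qed (simp add: c_0)

text \<open>At step \<open>nn t\<close> the tuples have one additional entry, which multiplies the
  logarithm by \<open>1 + 1 / e (nn t)\<close> beyond the factor \<open>e (nn t)\<close>. The
  product of these factors is bounded by summability.\<close>

lemma ln_c_le: "ln (real (c n)) \<le> Kc * real (EE n)"
proof -
  let ?d = "\<lambda>i. if i \<in> nn ` {1..} then 1 else 0 :: real"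
  have "(\<Prod>i<n. real (e i) + ?d i) = (\<Prod>i<n. real (e i) * (1 + ?d i / real (e i)))"
    using e_ge_1 by (intro prod.cong refl) (auto simp: field_simps Suc_le_eq)
  also have "\<dots> = real (EE n) * (\<Prod>i<n. 1 + ?d i / real (e i))" by (simp add: prod.distrib EE_def)
  also have "\<dots> \<le> real (EE n) * (\<Prod>i<n. exp (?d i / real (e i)))"
    by (intro mult_left_mono prod_mono) (auto intro: exp_ge_add_one_self add_nonneg_nonneg)
  also have "(\<Prod>i<n. exp (?d i / real (e i))) = exp (\<Sum>i<n. ?d i / real (e i))" by (simp add: exp_sum)
  also have "(\<Sum>i<n. ?d i / real (e i)) = (\<Sum>i\<in>{i. i < n \<and> i \<in> nn ` {1..}}. 1 / real (e i))"
  proof -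
    have "(\<Sum>i<n. ?d i / real (e i)) = (\<Sum>i<n. if i \<in> nn ` {1..} then 1 / real (e i) else 0)"
      by (intro sum.cong) auto
    also have "\<dots> = (\<Sum>i\<in>{i\<in>{..<n}. i \<in> nn ` {1..}}. 1 / real (e i))"
      by (rule sum.inter_filter[symmetric]) simp
    finally show ?thesis by (simp only: lessThan_iff)
  qed
  also have "real (EE n) * exp \<dots> \<le> real (EE n) * exp (\<Sum>t. real (nn (Suc t)) powr (- 2 * \<tau> / (1 - \<tau>)))"
    using sum_inverse_e_le[of n] by (intro mult_left_mono) auto
  finally have "ln 2 * (\<Prod>i<n. real (e i) + ?d i) \<le> ln 2 * (real (EE n) * exp (\<Sum>t. real (nn (Suc t)) powr (- 2 * \<tau> / (1 - \<tau>))))"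
    by (intro mult_left_mono) auto
  then show ?thesis unfolding ln_c Kc_def by (simp add: mult_ac)
qed

lemma c_ge: "2 ^ EE n \<le> c n"
proof (induction n)
  case (Suc n)
  have "2 ^ EE (Suc n) = ((2::nat) ^ EE n) ^ e n" by (simp add: EE_Suc power_mult)
  also have "\<dots> \<le> c n ^ e n" by (rule power_mono[OF Suc]) simp
  also have "\<dots> \<le> c (Suc n)"
    unfolding c_Suc using W_facts(5)[of n] by (intro power_increasing) (auto simp: Suc_le_eq)
  finally show ?case .
qed (simp add: c_0)

text \<open>\<open>c n \<ge> 2 ^ EE n\<close> and \<open>EE n \<ge> h n powr \<tau> / 2\<close>, so
  \<open>c n\<close> outgrows \<open>h n\<close>. This provides enough columns for the offsets to
  run through a full period.\<close>

lemma eventually_h_le_c: "\<forall>\<^sub>F n in sequentially. h n \<le> c n"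
proof -
  have hinf: "filterlim (\<lambda>n. real (h n)) at_top sequentially"
    by (rule filterlim_at_top_mono[OF filterlim_real_sequentially])
      (use h_gt in \<open>auto intro!: always_eventually simp: less_imp_le\<close>)
  have "\<forall>\<^sub>F x in at_top. x \<le> (2::real) powr (x powr \<tau> / 2)"
    using tau by real_asymp
  then have "\<forall>\<^sub>F n in sequentially. real (h n) \<le> 2 powr (real (h n) powr \<tau> / 2)"
    using hinf by (rule eventually_compose_filterlim)
  moreover have "\<forall>\<^sub>F n in sequentially. 2 \<le> n" by (rule eventually_ge_at_top)
  ultimately show ?thesis
  proof eventually_elim
    case (elim n)
    have n1: "1 \<le> n - 1" "Suc (n - 1) = n" using elim(2) by linarith+
    have "real (h n) powr \<tau> / 2 \<le> real (EE n)" using EE_ge[OF n1(1)] unfolding n1(2) by simp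
    then have "real (h n) \<le> 2 powr real (EE n)"
      using elim(1) by (meson order_trans powr_mono one_le_numeral)
    also have "\<dots> = real (2 ^ EE n)" by (simp add: powr_realpow)
    also have "\<dots> \<le> real (c n)" using c_ge[of n] by (simp only: of_nat_le_iff)
    finally show ?case by simp
  qed
qed

lemma Kc_nonneg: "0 \<le> Kc" by (simp add: Kc_def)

text \<open>Take the stage with \<open>h N \<le> L < h (Suc N)\<close>. About
  \<open>L / (rr N * h N)\<close> copies meet the window, each costing a logarithm for its position
  and at most \<open>Kc * h N powr \<tau>\<close> for its column; \<open>h_Suc_powr\<close> turns
  the product into a multiple of \<open>L powr \<tau>\<close>. The 6 is 4 from the quotient plus 2
  from the two boundary copies.\<close>

lemma ment_window_bound:
  assumes B: "resp m B" and L: "h (max m 2) \<le> L"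
  shows "ment M (hits T B {..<L}) \<le> 6 * real L powr \<tau> * (Kc + ln (real C + 1) + 3 * ln (real L))"
proof -
  have "\<exists>N. max m 2 \<le> N \<and> h N \<le> L \<and> L < h (Suc N)"
  proof -
    have "L < h L" by (rule h_gt)
    then have "\<exists>N. L < h N" by blast
    then obtain k where k: "L < h k" "\<And>i. i < k \<Longrightarrow> \<not> L < h i"
      unfolding exists_least_iff[of "\<lambda>N. L < h N"] by blast
    have "max m 2 < k"
    proof (rule ccontr)
      assume "\<not> max m 2 < k"
      then have "h k \<le> h (max m 2)" by (rule h_mono[OF leI])
      then show False using L k(1) by simp
    qed
    then obtain N where "k = Suc N" by (cases k) auto
    then show ?thesis using k \<open>max m 2 < k\<close> by (intro exI[of _ N]) (auto simp: not_less)
  qed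
  then obtain N where N: "m \<le> N" "2 \<le> N" "h N \<le> L" "L < h (Suc N)" by auto
  let ?H = "rr N * h N"
  have hN: "1 \<le> real (h N)" using h_pos[of N] by simp
  have L1: "1 \<le> real L" using N(3) h_pos[of N] by simp
  have H: "0 < real ?H" using rr_pos[of N] h_pos[of N] by simp
  have wH: "real (w N) \<le> 2 * real ?H"
  proof -
    have "h N * 1 \<le> h N * rr N" by (intro mult_le_mono2 rr_pos)
    then have "w N \<le> 2 * ?H"
      using hs_le[of N] w_conv[of N] unfolding mult.commute[of "rr N"] by linarith
    then have "real (w N) \<le> real (2 * ?H)" by (simp only: of_nat_le_iff)
    then show ?thesis by simp
  qed
  have Lt1: "1 \<le> real L powr \<tau>" using L1 tau by (intro ge_one_powr_ge_zero) auto
  have ht: "1 \<le> real (h N) powr \<tau>" "real (h N) powr \<tau> \<le> real L powr \<tau>"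
    using hN N(3) tau by (auto intro!: ge_one_powr_ge_zero powr_mono2)
  \<comment> \<open>\<open>h_Suc_powr\<close>, with \<open>L\<close> in place of the larger
    \<open>h (Suc N)\<close>, multiplied by \<open>L powr \<tau>\<close>.\<close>
  have key: "real L / real ?H * real (h N) powr \<tau> \<le> 4 * real L powr \<tau>"
  proof -
    have "real L powr (1 - \<tau>) * real (h N) powr \<tau> \<le> real (h (Suc N)) powr (1 - \<tau>) * real (h N) powr \<tau>"
      using N(4) tau by (intro mult_right_mono powr_mono2) auto
    also have "\<dots> \<le> 2 * real (w N)" by (rule h_Suc_powr[OF N(2)])
    also have "\<dots> \<le> 4 * real ?H" using wH by linarith
    finally have "real L powr \<tau> * (real L powr (1 - \<tau>) * real (h N) powr \<tau>) \<le> real L powr \<tau> * (4 * real ?H)"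
      by (intro mult_left_mono) auto
    moreover have "real L powr \<tau> * real L powr (1 - \<tau>) = real L" using L1 by (simp flip: powr_add)
    then have "real L powr \<tau> * (real L powr (1 - \<tau>) * real (h N) powr \<tau>) = real L * real (h N) powr \<tau>"
      by (simp only: mult.assoc[symmetric])
    ultimately have "real L * real (h N) powr \<tau> \<le> 4 * real L powr \<tau> * real ?H" by linarith
    then show ?thesis using H by (simp add: divide_le_eq)
  qed
  have LH: "real L / real ?H \<le> 4 * real L powr \<tau>"
  proof -
    have "real L / real ?H * 1 \<le> real L / real ?H * real (h N) powr \<tau>"
      using ht H by (intro mult_left_mono) auto
    then show ?thesis using key by linarith
  qed
  have K: "real (L div ?H + 2) \<le> real L / real ?H + 2"
    using of_nat_div_le_of_nat[where 'a = real, of L ?H] by simp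
  \<comment> \<open>As \<open>N < h N \<le> L\<close>, the length \<open>?H\<close> of a copy is
    polynomial in \<open>L\<close>.\<close>
  have lnH: "ln (real (L + ?H)) \<le> ln (real C + 1) + 3 * ln (real L)"
  proof -
    have NL: "real N \<le> real L" using h_gt[of N] N(3) by simp
    have "real ?H = real C * real N ^ 2 * real (h N)" using N(2) by (simp add: rr_def)
    also have "\<dots> \<le> real C * real L ^ 2 * real L"
      using NL N(3) by (intro mult_mono power_mono) auto
    finally have "real ?H \<le> real C * real L ^ 3" by (simp add: power3_eq_cube power2_eq_square)
    moreover have "real L \<le> real L ^ 3" using L1 self_le_power[of "real L" 3] by simp
    ultimately have "real (L + ?H) \<le> (real C + 1) * real L ^ 3"
      unfolding of_nat_add distrib_right mult_1 by linarith
    moreover have "0 < L + ?H" using L1 by simp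
    then have "0 < real (L + ?H)" by (simp only: of_nat_0_less_iff)
    ultimately have "ln (real (L + ?H)) \<le> ln ((real C + 1) * real L ^ 3)" by (intro ln_mono) auto
    also have "\<dots> = ln (real C + 1) + 3 * ln (real L)" using L1 by (simp add: ln_mult ln_realpow)
    finally show ?thesis .
  qed
  have lnc: "ln (real (c N)) \<le> Kc * real (h N) powr \<tau>"
    using ln_c_le[of N] mult_left_mono[OF EE_le[OF N(2)] Kc_nonneg] by linarith
  have c0: "0 \<le> ln (real (c N))" using W_facts(5)[of N] by simp
  have lnL: "0 \<le> ln (real C + 1) + 3 * ln (real L)" using L1 by (intro add_nonneg_nonneg) auto
  have lnLH: "0 \<le> ln (real (L + ?H))" using L1 by (intro ln_ge_zero) (simp add: add_increasing2)
  have "0 < L" using L1 by simp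
  from ment_window_le[OF resp_mono[OF N(1) B] this]
  have "ment M (hits T B {..<L}) \<le> real (L div ?H + 2) * (ln (real (L + ?H)) + ln (real (c N)))" .
  also have "\<dots> \<le> (real L / real ?H + 2) * ((ln (real C + 1) + 3 * ln (real L)) + Kc * real (h N) powr \<tau>)"
    using K lnH lnc c0 lnL lnLH by (intro mult_mono add_mono) (auto intro!: add_nonneg_nonneg divide_nonneg_nonneg)
  also have "\<dots> = (real L / real ?H + 2) * (ln (real C + 1) + 3 * ln (real L))
      + Kc * (real L / real ?H * real (h N) powr \<tau> + 2 * real (h N) powr \<tau>)"
    by (simp add: algebra_simps)
  also have "\<dots> \<le> (6 * real L powr \<tau>) * (ln (real C + 1) + 3 * ln (real L)) + Kc * (6 * real L powr \<tau>)"
    using LH key ht Lt1 Kc_nonneg lnL by (intro add_mono mult_right_mono mult_left_mono) linarith+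
  also have "\<dots> = 6 * real L powr \<tau> * (Kc + ln (real C + 1) + 3 * ln (real L))"
    by (simp add: algebra_simps)
  finally show ?thesis .
qed

end

lemma powr_ln_div_powr_tendsto_0:
  fixes a b c e K :: real
  assumes "0 < a" "a < b"
  shows "((\<lambda>x. c * (x + 1) powr a * (K + e * ln (x + 1)) / x powr b) \<longlongrightarrow> 0) at_top"
proof -
  define d where "d = b - a"
  have d: "0 < d" using assms by (simp add: d_def)
  have "((\<lambda>x::real. ((x + 1) / x) powr a) \<longlongrightarrow> 1) at_top" by real_asymp
  moreover have "((\<lambda>x::real. (K + e * ln (x + 1)) / x powr d) \<longlongrightarrow> 0) at_top"
    using d by real_asymp
  ultimately have "((\<lambda>x::real. ((x + 1) / x) powr a * ((K + e * ln (x + 1)) / x powr d)) \<longlongrightarrow> 1 * 0) at_top"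
    by (rule tendsto_mult)
  then have "((\<lambda>x::real. c * (((x + 1) / x) powr a * ((K + e * ln (x + 1)) / x powr d))) \<longlongrightarrow> c * (1 * 0)) at_top"
    by (rule tendsto_mult[OF tendsto_const])
  moreover have "\<forall>\<^sub>F x in at_top. c * (((x + 1) / x) powr a * ((K + e * ln (x + 1)) / x powr d))
      = c * (x + 1) powr a * (K + e * ln (x + 1)) / x powr b"
    using eventually_gt_at_top[of 0]
  proof eventually_elim
    case (elim x)
    then have "x powr b = x powr a * x powr d" by (simp add: d_def powr_add[symmetric])
    then show ?case using elim by (simp add: powr_divide)
  qed
  ultimately show ?thesis using tendsto_cong by fastforce
qed

subsection \<open>Uniform entropy dimension\<close>

lemma limsup_eq_0_iff:
  fixes f :: "nat \<Rightarrow> real"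
  assumes "\<And>n. 0 \<le> f n"
  shows "limsup (\<lambda>n. ereal (f n)) = 0 \<longleftrightarrow> f \<longlonglongrightarrow> 0"
proof
  assume *: "limsup (\<lambda>n. ereal (f n)) = 0"
  show "f \<longlonglongrightarrow> 0"
  proof (rule order_tendstoI)
    fix a :: real assume "0 < a"
    then have "limsup (\<lambda>n. ereal (f n)) < ereal a" using * by simp
    then have "\<forall>\<^sub>F n in sequentially. ereal (f n) < ereal a" by (rule Limsup_lessD)
    then show "\<forall>\<^sub>F n in sequentially. f n < a" by simp
  next
    fix a :: real assume "a < 0"
    then show "\<forall>\<^sub>F n in sequentially. a < f n" using assms by (auto intro: always_eventually less_le_trans)
  qed
next
  assume "f \<longlonglongrightarrow> 0"
  then have "(\<lambda>n. ereal (f n)) \<longlonglongrightarrow> ereal 0" by (simp only: lim_ereal)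
  then have "limsup (\<lambda>n. ereal (f n)) = ereal 0" by (intro lim_imp_Limsup) auto
  then show "limsup (\<lambda>n. ereal (f n)) = 0" by (simp add: zero_ereal_def)
qed

lemma upper_dim_set_iff:
  "limsup (\<lambda>n. ereal (real n / real (s n) powr \<theta>)) = 0 \<longleftrightarrow> (\<lambda>n. real n / real (s n) powr \<theta>) \<longlonglongrightarrow> 0"
  by (rule limsup_eq_0_iff) simp

context prob_space
begin

lemma prob_diff_le:
  assumes "A \<in> events" "B \<in> events"
  shows "\<bar>prob A - prob B\<bar> \<le> prob (sym_diff A B)"
proof -
  have D: "sym_diff A B \<in> events" using assms by auto
  have "prob A \<le> prob (B \<union> sym_diff A B)" "prob B \<le> prob (A \<union> sym_diff A B)"
    using assms D by (auto intro!: finite_measure_mono)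
  moreover have "prob (B \<union> sym_diff A B) \<le> prob B + prob (sym_diff A B)"
    "prob (A \<union> sym_diff A B) \<le> prob A + prob (sym_diff A B)"
    using assms D by (auto intro!: measure_Un_le)
  ultimately show ?thesis by linarith
qed

end

lemma bin_ent_small: "0 < \<kappa> \<Longrightarrow> \<exists>\<delta>>0. \<forall>x. 0 \<le> x \<longrightarrow> x < \<delta> \<longrightarrow> bin_ent x < \<kappa>"
proof -
  assume "0 < \<kappa>"
  then have "\<forall>\<^sub>F x in at_right 0. bin_ent x < \<kappa>" by (rule order_tendstoD(2)[OF bin_ent_tendsto_0])
  then obtain \<delta> where \<delta>: "\<delta> > 0" "\<And>x. 0 < x \<Longrightarrow> x < \<delta> \<Longrightarrow> bin_ent x < \<kappa>"
    unfolding eventually_at_right_field by auto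
  moreover have "bin_ent 0 = 0" by (simp add: bin_ent_def)
  ultimately have "\<forall>x. 0 \<le> x \<longrightarrow> x < \<delta> \<longrightarrow> bin_ent x < \<kappa>"
    using \<open>0 < \<kappa>\<close> by (metis less_eq_real_def)
  then show ?thesis using \<delta>(1) by blast
qed

lemma increasing_seq_ge:
  assumes "increasing_seq s"
  shows "1 \<le> n \<Longrightarrow> n \<le> s n"
proof (induction n rule: nat_induct_at_least)
  case base
  then show ?case using assms by (simp add: increasing_seq_def)
next
  case (Suc n)
  have "s n < s (Suc n)"
    using assms Suc.hyps unfolding increasing_seq_def strict_mono_on_def by simp
  then show ?case using Suc by simp
qed

context cs_sys
begin

lemma approx_bin_ent:
  assumes A: "A \<in> sets M" and "0 < \<kappa>" "0 < \<epsilon>"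
  obtains n B where "resp n B" "measure M (sym_diff A B) < \<epsilon>" "bin_ent (measure M (sym_diff A B)) < \<kappa>"
proof -
  obtain \<delta> where \<delta>: "\<delta> > 0" "\<forall>x. 0 \<le> x \<longrightarrow> x < \<delta> \<longrightarrow> bin_ent x < \<kappa>"
    using bin_ent_small[OF assms(2)] by blast
  obtain n B where "resp n B" "measure M (sym_diff A B) < min \<delta> \<epsilon>"
    using approx[OF A, of "min \<delta> \<epsilon>"] \<delta>(1) assms(3) by auto
  then show ?thesis using that \<delta>(2) by simp
qed

lemma entropy_generating_tendsto:
  assumes A: "A \<in> sets M" and gen: "entropy_generating M T {A, space M - A} s" and \<theta>: "\<tau> < \<theta>"
  shows "(\<lambda>n. real n / real (s n) powr \<theta>) \<longlonglongrightarrow> 0"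
proof -
  have s: "increasing_seq s" using gen by (simp add: entropy_generating_def)
  have "0 < liminf (\<lambda>n. ereal (partition_entropy M (preimage_join M T {A, space M - A} s n) / real n))"
    using gen by (simp add: entropy_generating_def)
  then obtain \<delta> where \<delta>: "0 < ereal \<delta>"
    "ereal \<delta> < liminf (\<lambda>n. ereal (partition_entropy M (preimage_join M T {A, space M - A} s n) / real n))"
    using ereal_dense2 by blast
  then have d0: "0 < \<delta>" by simp
  have ev: "\<forall>\<^sub>F n in sequentially. \<delta> < ment M (hits T A (s ` {1..n})) / real n"
    using less_LiminfD[OF \<delta>(2)] S.partition_entropy_preimage_join[OF A] by simp
  \<comment> \<open>With \<open>\<delta> / 2\<close>, at least half of the entropy survives the
    replacement of \<open>A\<close> by \<open>B\<close>.\<close>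
  obtain m B where B: "resp m B" "bin_ent (measure M (sym_diff A B)) < \<delta> / 2"
    by (rule approx_bin_ent[OF A, of "\<delta> / 2" 1]) (use d0 in auto)
  define g where "g x = 6 * x powr \<tau> * (Kc + ln (real C + 1) + 3 * ln x)" for x :: real
  have slim: "filterlim s at_top sequentially"
    by (rule filterlim_at_top_mono[OF filterlim_ident])
      (use increasing_seq_ge[OF s] in \<open>auto intro!: eventually_sequentiallyI[of 1]\<close>)
  have slim': "filterlim (\<lambda>n. real (s n)) at_top sequentially"
    by (rule filterlim_compose[OF filterlim_real_sequentially slim])
  have bound: "\<forall>\<^sub>F n in sequentially. real n / real (s n) powr \<theta> \<le> 2 / \<delta> * (g (real (s n) + 1) / real (s n) powr \<theta>)"
    using ev eventually_ge_at_top[of 1] slim[unfolded filterlim_at_top, rule_format, of "h (max m 2)"]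
  proof eventually_elim
    case (elim n)
    have n: "0 < real n" using elim(2) by simp
    have sub: "s ` {1..n} \<subseteq> {..<s n + 1}"
    proof (rule image_subsetI)
      fix i assume i: "i \<in> {1..n}"
      then have "s i \<le> s n"
        using s unfolding increasing_seq_def strict_mono_on_def by (cases "i = n") (auto simp: less_imp_le)
      then show "s i \<in> {..<s n + 1}" by simp
    qed
    have "\<delta> * real n < ment M (hits T A (s ` {1..n}))"
      using elim(1) n by (simp add: field_simps)
    also have "\<dots> \<le> ment M (hits T B (s ` {1..n})) + card (s ` {1..n}) * bin_ent (measure M (sym_diff A B))"
      using A resp_sets[OF B(1)] by (intro S.ment_hits_diff) auto
    also have "\<dots> \<le> ment M (hits T B {..<s n + 1}) + real n * (\<delta> / 2)"
    proof (rule add_mono)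
      show "ment M (hits T B (s ` {1..n})) \<le> ment M (hits T B {..<s n + 1})"
        using resp_sets[OF B(1)] sub by (intro S.ment_hits_subset) auto
      have "real (card (s ` {1..n})) \<le> real n" using card_image_le[of "{1..n}" s] by simp
      then show "real (card (s ` {1..n})) * bin_ent (measure M (sym_diff A B)) \<le> real n * (\<delta> / 2)"
      proof (cases "0 \<le> bin_ent (measure M (sym_diff A B))")
        case True
        then show ?thesis using B(2) \<open>real (card (s ` {1..n})) \<le> real n\<close> by (intro mult_mono) auto
      next
        case False
        then have "real (card (s ` {1..n})) * bin_ent (measure M (sym_diff A B)) \<le> 0"
          by (intro mult_nonneg_nonpos) auto
        also have "0 \<le> real n * (\<delta> / 2)" using d0 by simp
        finally show ?thesis .
      qed
    qed
    also have "ment M (hits T B {..<s n + 1}) \<le> g (real (s n + 1))"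
      unfolding g_def using elim(3) by (intro ment_window_bound[OF B(1)]) simp
    finally have "real n * \<delta> < 2 * g (real (s n) + 1)" by (simp add: algebra_simps)
    then have "real n \<le> 2 / \<delta> * g (real (s n) + 1)" using d0 by (simp add: field_simps)
    then have "real n / real (s n) powr \<theta> \<le> 2 / \<delta> * g (real (s n) + 1) / real (s n) powr \<theta>"
      by (intro divide_right_mono) auto
    then show ?case by simp
  qed
  have "((\<lambda>x. g (x + 1) / x powr \<theta>) \<longlongrightarrow> 0) at_top"
    unfolding g_def using \<theta> tau by (intro powr_ln_div_powr_tendsto_0) auto
  then have "(\<lambda>n. g (real (s n) + 1) / real (s n) powr \<theta>) \<longlonglongrightarrow> 0"
    by (rule filterlim_compose[OF _ slim'])
  then have "(\<lambda>n. 2 / \<delta> * (g (real (s n) + 1) / real (s n) powr \<theta>)) \<longlonglongrightarrow> 2 / \<delta> * 0"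
    by (intro tendsto_mult tendsto_const)
  then have lim: "(\<lambda>n. 2 / \<delta> * (g (real (s n) + 1) / real (s n) powr \<theta>)) \<longlonglongrightarrow> 0" by simp
  show ?thesis
    by (rule tendsto_sandwich[OF _ bound tendsto_const lim]) simp
qed

lemma upper_dim_le:
  assumes A: "A \<in> sets M" and gen: "entropy_generating M T {A, space M - A} s"
  shows "upper_dim s \<le> \<tau>"
proof (rule field_le_epsilon)
  fix \<epsilon> :: real assume "0 < \<epsilon>"
  then have "\<tau> + \<epsilon> \<in> {\<theta>. 0 \<le> \<theta> \<and> limsup (\<lambda>n. ereal (real n / real (s n) powr \<theta>)) = 0}"
    using entropy_generating_tendsto[OF A gen, of "\<tau> + \<epsilon>"] tau unfolding upper_dim_set_iff by simp
  then show "upper_dim s \<le> \<tau> + \<epsilon>"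
    unfolding upper_dim_def by (intro cInf_lower) (auto intro!: bdd_belowI[of _ 0])
qed

lemma strict_mono_enumerate_SSall:
  assumes "1 \<le> n0"
  defines "s \<equiv> \<lambda>i. enumerate (SSall n0) (i - 1)"
  shows "strict_mono_on {1..} s" "s ` {1..} = SSall n0" "increasing_seq s"
proof -
  have inf: "infinite (SSall n0)" by (rule infinite_SSall[OF assms(1)])
  show sm: "strict_mono_on {1..} s"
    unfolding s_def by (intro strict_mono_onI enumerate_mono[OF _ inf]) auto
  have "s ` {1..} = range (enumerate (SSall n0))"
  proof (intro set_eqI iffI)
    fix x assume "x \<in> range (enumerate (SSall n0))"
    then obtain i where "x = enumerate (SSall n0) i" by blast
    then show "x \<in> s ` {1..}" unfolding s_def by (intro image_eqI[of _ _ "Suc i"]) auto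
  qed (auto simp: s_def)
  then show im: "s ` {1..} = SSall n0" using range_enumerate[OF inf] by simp
  have "s 1 \<in> SSall n0" using im by auto
  then have "1 \<le> s 1" unfolding SSall_def using SS_bounds[OF assms(1)] by fastforce
  then show "increasing_seq s" using sm by (simp add: increasing_seq_def)
qed

text \<open>At \<open>n = card (SS n0 k)\<close> the sequence is still below
  \<open>h (n0 + k)\<close>, while
  \<open>n * EE n0 = EE (n0 + k) \<ge> h (n0 + k) powr \<tau> / 2\<close>. Along these
  \<open>n\<close> the quotient is at least \<open>1 / (2 * EE n0)\<close>.\<close>

lemma SSall_not_tendsto:
  assumes n0: "1 \<le> n0" and s: "strict_mono_on {1..} s" "s ` {1..} = SSall n0" and \<theta>: "0 \<le> \<theta>" "\<theta> \<le> \<tau>"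
  shows "\<not> (\<lambda>n. real n / real (s n) powr \<theta>) \<longlonglongrightarrow> 0"
proof
  assume lim: "(\<lambda>n. real n / real (s n) powr \<theta>) \<longlonglongrightarrow> 0"
  let ?k = "1 / (2 * real (EE n0))"
  have "0 < ?k" using EE_pos[of n0] by simp
  then have "\<forall>\<^sub>F n in sequentially. real n / real (s n) powr \<theta> < ?k" by (rule order_tendstoD(2)[OF lim])
  then obtain N where N: "\<And>n. N \<le> n \<Longrightarrow> real n / real (s n) powr \<theta> < ?k"
    unfolding eventually_sequentially by blast
  define k where "k = Suc N"
  let ?n = "card (SS n0 k)"
  have g: "2 ^ i \<le> card (SS n0 i)" for i
    unfolding card_SS[OF n0] using e_ge_2 by (induction i) (auto simp: mult.commute intro!: mult_le_mono)
  have nN: "N \<le> ?n" "1 \<le> ?n"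
    using g[of k] less_exp[of k] by (simp_all add: k_def)
  have sub: "SS n0 k \<subseteq> s ` {1..?n}"
  proof (rule initial_segment[OF s, where b = "h (n0 + k)"])
    show "SSall n0 \<inter> {..<h (n0 + k)} \<subseteq> SS n0 k"
    proof
      fix x assume x: "x \<in> SSall n0 \<inter> {..<h (n0 + k)}"
      then obtain k' where k': "x \<in> SS n0 k'" by (auto simp: SSall_def)
      have "SS n0 k' \<subseteq> SS n0 (max k' k)"
        by (rule lift_Suc_mono_le[of "SS n0"]) (use SS_mono_Suc in auto)
      then show "x \<in> SS n0 k" using SS_low[OF _ n0, of k "max k' k"] k' x by auto
    qed
  qed (use SS_less[OF n0] finite_SS in \<open>auto simp: SSall_def\<close>)
  have "card (s ` {1..?n}) \<le> ?n" using card_image_le[of "{1..?n}" s] by simp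
  then have "SS n0 k = s ` {1..?n}" using sub by (intro card_seteq[symmetric] card_seteq) auto
  then have "s ?n \<in> SS n0 k" using nN(2) by auto
  then have sn: "s ?n < h (n0 + k)" "0 < s ?n" using SS_bounds[OF n0, of k] by auto
  have h1: "1 \<le> real (h (n0 + k))" using h_pos[of "n0 + k"] by simp
  have "real (s ?n) powr \<theta> \<le> real (h (n0 + k)) powr \<theta>"
    using sn \<theta> by (intro powr_mono2) auto
  also have "\<dots> \<le> real (h (n0 + k)) powr \<tau>" using h1 \<theta> by (intro powr_mono) auto
  also have "\<dots> \<le> 2 * real (EE (n0 + k))"
    using EE_ge[of "n0 + N"] n0 by (simp add: k_def)
  also have "real (EE (n0 + k)) = real ?n * real (EE n0)"
    using card_SS_EE[OF n0, of k] by (simp flip: of_nat_mult)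
  finally have "real (s ?n) powr \<theta> \<le> 2 * (real ?n * real (EE n0))" .
  then have "?k \<le> real ?n / real (s ?n) powr \<theta>"
    using EE_pos[of n0] sn(2) by (simp add: field_simps)
  then show False using N[OF nN(1)] by simp
qed

lemma SSall_generating:
  assumes A: "A \<in> sets M" and a: "0 < measure M A" "measure M A < 1"
  shows "\<exists>n0\<ge>1. entropy_generating M T {A, space M - A} (\<lambda>i. enumerate (SSall n0) (i - 1))"
proof -
  define a where "a = measure M A"
  have a01: "0 < a" "a < 1" using a by (simp_all add: a_def)
  \<comment> \<open>Below, \<open>G \<ge> a * (1 - a) / 24\<close>, so \<open>ent_lower\<close>
    gives at least \<open>2 * \<kappa>\<close> per time, of which the approximation takes at most
    \<open>\<kappa>\<close>.\<close>
  define \<kappa> where "\<kappa> = a * (1 - a) / 384"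
  have k0: "0 < \<kappa>" using a01 by (simp add: \<kappa>_def)
  \<comment> \<open>These margins, and a tower of measure close to 1, keep the normalised measure
    \<open>b\<close> of \<open>B\<close> between \<open>a / 2\<close> and
    \<open>1 - (1 - a) / 2\<close>.\<close>
  obtain m B where B: "resp m B" "measure M (sym_diff A B) < min (a / 2) ((1 - a) / 4)"
    "bin_ent (measure M (sym_diff A B)) < \<kappa>"
    using approx_bin_ent[OF A k0, of "min (a / 2) ((1 - a) / 4)"] a01 by auto
  have "\<bar>a - measure M B\<bar> \<le> measure M (sym_diff A B)"
    unfolding a_def by (rule M.prob_diff_le[OF A resp_sets[OF B(1)]])
  then have mB: "a / 2 \<le> measure M B" "measure M B \<le> a + (1 - a) / 4"
    using B(2) by (auto simp: field_simps)
  have "\<forall>\<^sub>F n in sequentially. max (1 / 2) (1 - (1 - a) / 4) < mm n"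
    using a01 by (intro order_tendstoD(1)[OF mm_tendsto]) auto
  then obtain n1 where n1: "\<And>n. n1 \<le> n \<Longrightarrow> max (1 / 2) (1 - (1 - a) / 4) < mm n"
    unfolding eventually_sequentially by blast
  obtain n2 where n2: "\<And>n. n2 \<le> n \<Longrightarrow> h n \<le> c n"
    using eventually_h_le_c unfolding eventually_sequentially by blast
  \<comment> \<open>The 3 ensures \<open>n0 \<ge> 4\<close>; the other terms make \<open>B\<close> a
    union of levels at stage \<open>l t\<close>, the towers nearly full, and the columns at stage
    \<open>nn t\<close> numerous enough.\<close>
  define t where "t = max 3 (max m (max n1 n2))"
  have t: "t \<ge> 1" "3 \<le> t" "m \<le> t" "n1 \<le> t" "n2 \<le> t" by (auto simp: t_def)
  have lt: "t < l t" "t < nn t" using l_nn_bounds[OF t(1)] by auto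
  define b where "b = measure M B / mm (l t)"
  have mml: "1 / 2 < mm (l t)" "1 - (1 - a) / 4 < mm (l t)" using n1[of "l t"] t lt by auto
  have b: "a / 2 \<le> b" "(1 - a) / 2 \<le> 1 - b"
  proof -
    have "measure M B * 1 \<le> measure M B / mm (l t)"
      using mm_le_1[of "l t"] mm_pos[of "l t"] by (simp add: pos_le_divide_eq mult_left_le)
    then show "a / 2 \<le> b" using mB(1) unfolding b_def by linarith
    have "(1 - a) / 2 \<le> mm (l t) - measure M B" using mml mB by (simp add: field_simps)
    also have "\<dots> \<le> (mm (l t) - measure M B) / mm (l t)"
    proof -
      have "0 \<le> mm (l t) - measure M B" using mml mB a01 by (simp add: field_simps)
      then show ?thesis
        using mm_le_1[of "l t"] mm_pos[of "l t"] by (simp add: pos_le_divide_eq mult_left_le)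
    qed
    also have "\<dots> = 1 - b" using mm_pos[of "l t"] by (simp add: b_def diff_divide_distrib)
    finally show "(1 - a) / 2 \<le> 1 - b" .
  qed
  define n0 where "n0 = Suc (nn t)"
  have n0: "4 \<le> n0" "1 \<le> n0" using lt t by (auto simp: n0_def)
  define G where "G = b * (1 - b) / 6"
  have G: "a * (1 - a) / 24 \<le> G" "0 \<le> G"
  proof -
    have "(a / 2) * ((1 - a) / 2) \<le> b * (1 - b)" using b a01 by (intro mult_mono) auto
    then show "a * (1 - a) / 24 \<le> G" by (simp add: G_def)
    then show "0 \<le> G" using a01 by (meson order_trans divide_nonneg_nonneg mult_nonneg_nonneg
        diff_ge_0_iff_ge less_imp_le zero_le_numeral)
  qed
  have Bl: "resp (l t) B" using t lt by (intro resp_mono[OF _ B(1)]) simp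
  have hc: "h (l t) \<le> c (nn t)"
    using n2[of "nn t"] h_mono[of "l t" "nn t"] par(3)[OF t(1)] t lt by simp
  have Es: "real (h n0) * G \<le> Es B n0 {1}"
    unfolding n0_def G_def b_def
    by (rule Es_base[OF t(1) Bl hc]) (use b a01 in \<open>auto simp: b_def[symmetric]\<close>)
  have Bn0: "resp n0 B" using t lt by (intro resp_mono[OF _ B(1)]) (simp add: n0_def)
  have mmn0: "1 / 2 \<le> mm n0" using n1[of n0] t lt by (simp add: n0_def)
  define s where "s = (\<lambda>i. enumerate (SSall n0) (i - 1))"
  note s = strict_mono_enumerate_SSall[OF n0(2), folded s_def]
  have "\<kappa> \<le> partition_entropy M (preimage_join M T {A, space M - A} s n) / real n" if n: "1 \<le> n" for n
  proof -
    have inj: "inj_on s {1..n}"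
      by (rule inj_on_subset[OF strict_mono_on_imp_inj_on[OF s(1)]]) auto
    have "real n * G / 8 \<le> ment M (hits T B (s ` {1..n}))"
      by (rule ent_lower[OF Bn0 n0(1) Es G(2) mmn0 s(1,2) n])
    also have "\<dots> \<le> ment M (hits T A (s ` {1..n})) + card (s ` {1..n}) * bin_ent (measure M (sym_diff B A))"
      using A resp_sets[OF B(1)] by (intro S.ment_hits_diff) auto
    also have "card (s ` {1..n}) * bin_ent (measure M (sym_diff B A)) \<le> real n * \<kappa>"
    proof -
      have "sym_diff B A = sym_diff A B" by auto
      moreover have "card (s ` {1..n}) = n" using card_image[OF inj] by simp
      ultimately show ?thesis using B(3) by (simp only:) (intro mult_left_mono, auto)
    qed
    finally have 1: "real n * G / 8 \<le> ment M (hits T A (s ` {1..n})) + real n * \<kappa>" by simp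
    have "real n * (2 * \<kappa>) \<le> real n * (G / 8)" using G(1) by (intro mult_left_mono) (auto simp: \<kappa>_def)
    then have "real n * \<kappa> \<le> ment M (hits T A (s ` {1..n}))" using 1 by linarith
    then show ?thesis
      using n unfolding S.partition_entropy_preimage_join[OF A] by (simp add: pos_le_divide_eq mult.commute)
  qed
  then have "\<forall>\<^sub>F n in sequentially. ereal \<kappa> \<le> ereal (partition_entropy M (preimage_join M T {A, space M - A} s n) / real n)"
    by (intro eventually_sequentiallyI[of 1]) simp
  then have "ereal \<kappa> \<le> liminf (\<lambda>n. ereal (partition_entropy M (preimage_join M T {A, space M - A} s n) / real n))"
    by (rule Liminf_bounded)
  then have "0 < liminf (\<lambda>n. ereal (partition_entropy M (preimage_join M T {A, space M - A} s n) / real n))"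
    using k0 by (metis ereal_less(2) less_le_trans)
  then have "entropy_generating M T {A, space M - A} s" using s(3) by (simp add: entropy_generating_def)
  then show ?thesis using n0(2) unfolding s_def by blast
qed

lemma upper_entropy_dim_eq:
  assumes A: "A \<in> sets M" "0 < measure M A" "measure M A < 1"
  shows "upper_entropy_dim M T {A, space M - A} = \<tau>"
proof -
  obtain n0 where n0: "1 \<le> n0"
    and gen: "entropy_generating M T {A, space M - A} (\<lambda>i. enumerate (SSall n0) (i - 1))"
    using SSall_generating[OF A] by blast
  define s where "s = (\<lambda>i. enumerate (SSall n0) (i - 1))"
  note s = strict_mono_enumerate_SSall[OF n0, folded s_def]
  have gen': "entropy_generating M T {A, space M - A} s" using gen by (simp add: s_def)
  have "\<tau> \<le> upper_dim s"
    unfolding upper_dim_def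
  proof (rule cInf_greatest)
    have "\<tau> + 1 \<in> {\<theta>. 0 \<le> \<theta> \<and> limsup (\<lambda>n. ereal (real n / real (s n) powr \<theta>)) = 0}"
      using entropy_generating_tendsto[OF A(1) gen', of "\<tau> + 1"] tau unfolding upper_dim_set_iff by simp
    then show "{\<theta>. 0 \<le> \<theta> \<and> limsup (\<lambda>n. ereal (real n / real (s n) powr \<theta>)) = 0} \<noteq> {}" by blast
    fix \<theta> assume "\<theta> \<in> {\<theta>. 0 \<le> \<theta> \<and> limsup (\<lambda>n. ereal (real n / real (s n) powr \<theta>)) = 0}"
    then have "0 \<le> \<theta>" "(\<lambda>n. real n / real (s n) powr \<theta>) \<longlonglongrightarrow> 0" unfolding upper_dim_set_iff by auto
    then show "\<tau> \<le> \<theta>" using SSall_not_tendsto[OF n0 s(1,2), of \<theta>] by (meson linear)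
  qed
  then have dim: "upper_dim s = \<tau>" using upper_dim_le[OF A(1) gen'] by simp
  have "Sup {upper_dim s | s. entropy_generating M T {A, space M - A} s} = \<tau>"
  proof (rule cSup_eq_maximum)
    show "\<tau> \<in> {upper_dim s | s. entropy_generating M T {A, space M - A} s}" using dim gen' by blast
  qed (use upper_dim_le[OF A(1)] in auto)
  then show ?thesis using gen' unfolding upper_entropy_dim_def by auto
qed

text \<open>Ensures that \<open>dimension_set\<close> is nonempty. One of the two columns of tower 0
  serves, since their widths add up to at most 1.\<close>

lemma ex_nontrivial_set: "\<exists>A\<in>sets M. 0 < measure M A \<and> measure M A < 1"
proof -
  have D: "hd (W 0) \<in> set (W 0)" using W_facts(5)[of 0] by (intro hd_in_set) (auto simp: c_def)
  have "v 0 < 1"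
  proof -
    have "2 * v 0 = mm 0" by (simp add: mm_def c_0 par)
    then show ?thesis using mm_le_1[of 0] by simp
  qed
  then show ?thesis
    using level_sets[OF D h_pos] measure_level[OF D h_pos] W_facts(4)[of 0]
    by (intro bexI[of _ "level (hd (W 0)) 0"]) auto
qed

lemma uniform_system: "uniform_entropy_dim_system \<tau> M T"
proof -
  have "pmp_system M T"
    unfolding pmp_system_def using prob_space_M T_measurable T_preserves by blast
  moreover have "dimension_set M T = {\<tau>}"
    unfolding dimension_set_def using upper_entropy_dim_eq ex_nontrivial_set by auto
  ultimately show ?thesis unfolding uniform_entropy_dim_system_def using tau by simp
qed

end

theorem theorem5p7:
  fixes \<tau> :: real and C :: nat
    and l nn h w e :: "nat \<Rightarrow> nat"
    and W :: "nat \<Rightarrow> tower"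
  assumes "0 < \<tau>" and "\<tau> < 1"
    and "cs_parameters \<tau> C l nn h w e"
    and "cs_towers C l nn h e W"
  shows "uniform_entropy_dim_system \<tau> (cs_measure W) (cs_map W)"
proof -
  interpret cs_sys \<tau> C l nn h w e W by unfold_locales (rule assms)+
  show ?thesis by (rule uniform_system)
qed

end
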